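(* The following property holds for $\mathbb P$-a.e. $\omega$: for every $h>h_c$ $$\lim_{n\uparrow\infty}\frac{M_n}{\log n}=\frac1{\mu(h)}\quad\text{in probability under }\mathsf P_{n,h,\omega},$$ i.e. for every $\varepsilon>0$, $\lim_{n\uparrow\infty}\mathsf P_{n,h,\omega}\big[\big|\frac{M_n}{\log n}-\frac1{\mu(h)}\big|>\varepsilon\big]=0$.
   Context: Notation: $\mathbb N=\{1,2,\ldots\}$, $\mathbb N_0=\{0\}\cup\mathbb N$. Renewal process: under a law $\mathsf P$ (expectation $\mathsf E$), $T_1,T_2,\ldots$ are i.i.d. $\mathbb N$-valued random variables with $p(t):=\mathsf P[T_1=t]=\ell(t)/t^{\alpha+1}>0$ for all $t\in\mathbb N$, where $\alpha\ge0$ and $\ell:[1,+\infty)\to[0,+\infty)$ is slowly varying at infinity. Set $S_0=0$, $S_i=T_1+\cdots+T_i$, $S=(S_i)_{i\in\mathbb N_0}$, $X_a=\mathbf 1_{\{a\in S\}}$ for $a\in\mathbb N_0$, $L_n=\sup\{i\ge0:S_i\le n\}$ and $M_n=\sup\{T_i:1\le i\le L_n\}$ (largest gap between contacts). Disorder: $\Omega=\mathbb R^{\mathbb N_0}$ with its Borel $\sigma$-field carries a probability measure $\mathbb P$ (expectation $\mathbb E$) under which the coordinates of $\omega=(\omega_a)_{a\in\mathbb N_0}$ form a centered stationary Gaussian sequence with covariance function $\gamma(a)=\int_\Omega\omega_0\omega_a\,\mathbb P[d\omega]$, $a\in\mathbb N_0$, satisfying $\bar\gamma:=\sum_{a\in\mathbb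 N_0}|\gamma(a)|<+\infty$. Pinning model: for $n\in\mathbb N$, $h\in\mathbb R$, $\omega\in\Omega$, the Gibbs measure $\mathsf P_{n,h,\omega}$ is defined by $\frac{d\mathsf P_{n,h,\omega}}{d\mathsf P}=\frac{1}{Z_{n,h}(\omega)}e^{\sum_{a=1}^n(h+\omega_a)X_a}X_n$ with $Z_{n,h}(\omega)=\mathsf E\big[e^{\sum_{a=1}^n(h+\omega_a)X_a}X_n\big]$. Set $Z^-_{n,h}(\omega)=e^{-(h+\omega_n)}Z_{n,h}(\omega)$. Free energies: $f(h)=\lim_{n\uparrow\infty}\mathbb E[\frac1n\log Z_{n,h}]$, which exists and is finite and non-negative for all $h\in\mathbb R$; $h_c=\inf\{h\in\mathbb R:f(h)>0\}$, and $-\infty<h_c\le0$. The alternative free energy is $\mu(h)=\lim_{n\uparrow\infty}-\frac1n\log\mathbb E[1/Z^-_{n,h}]$, which exists for all $h\in\mathbb R$ and satisfies $\mu(h)>0$ for $h>h_c$. *)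

theory Defs
  imports "HOL-Probability.Probability"
begin

text \<open>The limit forces \<open>ell\<close> to be eventually nonzero, because \<open>x / 0 = 0\<close>.\<close>

definition slowly_varying :: "(real \<Rightarrow> real) \<Rightarrow> bool" where
  "slowly_varying ell \<longleftrightarrow>
     ell \<in> borel_measurable (restrict_space borel {1..}) \<and>
     (\<forall>c>0. ((\<lambda>x. ell (c * x) / ell x) \<longlongrightarrow> 1) at_top)"

text \<open>The inter-arrival times are \<open>T 1, T 2, \<dots>\<close>; the value \<open>T 0\<close> is never used.\<close>

definition iid_positive_times :: "'a measure \<Rightarrow> (nat \<Rightarrow> 'a \<Rightarrow> nat) \<Rightarrow> (nat \<Rightarrow> real) \<Rightarrow> bool" where
  "iid_positive_times M T p \<longleftrightarrow>
     prob_space.indep_vars M (\<lambda>_. count_space UNIV) T {1..} \<and>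
     (\<forall>i\<ge>1. \<forall>x\<in>space M. T i x \<ge> 1) \<and>
     (\<forall>i\<ge>1. \<forall>t\<ge>1. measure M {x \<in> space M. T i x = t} = p t)"

definition renewal :: "(nat \<Rightarrow> 'a \<Rightarrow> nat) \<Rightarrow> nat \<Rightarrow> 'a \<Rightarrow> nat" where
  "renewal T i x = (\<Sum>j\<in>{1..i}. T j x)"

definition contact :: "(nat \<Rightarrow> 'a \<Rightarrow> nat) \<Rightarrow> nat \<Rightarrow> 'a \<Rightarrow> real" where
  "contact T a x = indicator (range (\<lambda>i. renewal T i x)) a"

definition num_contacts :: "(nat \<Rightarrow> 'a \<Rightarrow> nat) \<Rightarrow> nat \<Rightarrow> 'a \<Rightarrow> nat" where
  "num_contacts T n x = Sup {i. renewal T i x \<le> n}"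

text \<open>On \<^typ>\<open>nat\<close> the supremum of the empty set is 0, which is the value used when there is no
  renewal in \<open>{1..n}\<close>.\<close>

definition max_gap :: "(nat \<Rightarrow> 'a \<Rightarrow> nat) \<Rightarrow> nat \<Rightarrow> 'a \<Rightarrow> nat" where
  "max_gap T n x = Sup {T i x | i. 1 \<le> i \<and> i \<le> num_contacts T n x}"

text \<open>A sequence is Gaussian when all finite linear combinations of its coordinates are
  Gaussian, where a constant counts as Gaussian with zero variance.\<close>

definition centered_gaussian_rv :: "'b measure \<Rightarrow> ('b \<Rightarrow> real) \<Rightarrow> bool" where
  "centered_gaussian_rv Q Y \<longleftrightarrow>
     (\<exists>\<sigma>>0. distributed Q lborel Y (\<lambda>y. ennreal (normal_density 0 \<sigma> y))) \<or>
     (Y \<in> borel_measurable Q \<and> (AE \<omega> in Q. Y \<omega> = 0))"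

definition centered_gaussian_sequence :: "(nat \<Rightarrow> real) measure \<Rightarrow> bool" where
  "centered_gaussian_sequence Q \<longleftrightarrow>
     (\<forall>A c. finite A \<longrightarrow> centered_gaussian_rv Q (\<lambda>\<omega>. \<Sum>a\<in>A. c a * \<omega> a))"

definition stationary_sequence :: "(nat \<Rightarrow> real) measure \<Rightarrow> bool" where
  "stationary_sequence Q \<longleftrightarrow> distr Q Q (\<lambda>\<omega> a. \<omega> (Suc a)) = Q"

definition covariance :: "(nat \<Rightarrow> real) measure \<Rightarrow> nat \<Rightarrow> real" where
  "covariance Q a = (\<integral>\<omega>. \<omega> 0 * \<omega> a \<partial>Q)"

definition pinning_weight ::
    "(nat \<Rightarrow> 'a \<Rightarrow> nat) \<Rightarrow> nat \<Rightarrow> real \<Rightarrow> (nat \<Rightarrow> real) \<Rightarrow> 'a \<Rightarrow> real" where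
  "pinning_weight T n h \<omega> x = exp (\<Sum>a\<in>{1..n}. (h + \<omega> a) * contact T a x) * contact T n x"

definition partition_function ::
    "'a measure \<Rightarrow> (nat \<Rightarrow> 'a \<Rightarrow> nat) \<Rightarrow> nat \<Rightarrow> real \<Rightarrow> (nat \<Rightarrow> real) \<Rightarrow> real" where
  "partition_function M T n h \<omega> = (\<integral>x. pinning_weight T n h \<omega> x \<partial>M)"

definition partition_function_minus ::
    "'a measure \<Rightarrow> (nat \<Rightarrow> 'a \<Rightarrow> nat) \<Rightarrow> nat \<Rightarrow> real \<Rightarrow> (nat \<Rightarrow> real) \<Rightarrow> real" where
  "partition_function_minus M T n h \<omega> = exp (- (h + \<omega> n)) * partition_function M T n h \<omega>"

definition gibbs_measure ::
    "'a measure \<Rightarrow> (nat \<Rightarrow> 'a \<Rightarrow> nat) \<Rightarrow> nat \<Rightarrow> real \<Rightarrow> (nat \<Rightarrow> real) \<Rightarrow> 'a measure" where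
  "gibbs_measure M T n h \<omega> =
     density M (\<lambda>x. ennreal (pinning_weight T n h \<omega> x / partition_function M T n h \<omega>))"

definition free_energy ::
    "'a measure \<Rightarrow> (nat \<Rightarrow> 'a \<Rightarrow> nat) \<Rightarrow> (nat \<Rightarrow> real) measure \<Rightarrow> real \<Rightarrow> real" where
  "free_energy M T Q h =
     lim (\<lambda>n. \<integral>\<omega>. (1 / real n) * ln (partition_function M T n h \<omega>) \<partial>Q)"

definition critical_point ::
    "'a measure \<Rightarrow> (nat \<Rightarrow> 'a \<Rightarrow> nat) \<Rightarrow> (nat \<Rightarrow> real) measure \<Rightarrow> real" where
  "critical_point M T Q = Inf {h. free_energy M T Q h > 0}"

definition alt_free_energy ::
    "'a measure \<Rightarrow> (nat \<Rightarrow> 'a \<Rightarrow> nat) \<Rightarrow> (nat \<Rightarrow> real) measure \<Rightarrow> real \<Rightarrow> real" where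
  "alt_free_energy M T Q h =
     lim (\<lambda>n. - (1 / real n) * ln (\<integral>\<omega>. 1 / partition_function_minus M T n h \<omega> \<partial>Q))"

end

theory Submission
  imports Defs "HOL-Real_Asymp.Real_Asymp"
begin

text \<open>
  Between two contacts \<open>a < b\<close> the Gibbs probability of an uninterrupted gap is at most
  \<open>1 / Z\<^sup>-(a, b)\<close>, whose mean decays like \<open>exp (- \<mu> (b - a))\<close>; summing over \<open>a\<close> and \<open>b\<close> up to a power
  of 2 gives the upper bound on the largest gap by a Borel--Cantelli argument. For the lower bound,
  forcing contacts at the ends of disjoint blocks of logarithmic length costs only a subexponential
  factor in that length, so that the Gibbs probability of having no gap of length \<open>k\<close> is at most of
  order \<open>1 / \<Sum>\<^sub>j p k / Z\<^sup>-(a\<^sub>j, a\<^sub>j + k)\<close>, and the sum concentrates around its diverging mean.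

  All probabilistic input on the disorder comes from a single decoupling inequality for negative
  powers of partition functions in disjoint windows, with an error controlled by the sum of the
  cross covariances. It yields the existence of \<open>\<mu>\<close> by almost subadditivity, its positivity in the
  localized phase (through the moments of order \<open>- \<theta>\<close> for small \<open>\<theta>\<close>), and the variance bound behind
  the concentration. The simultaneity in \<open>h\<close> comes from monotonicity and the Lipschitz continuity of
  \<open>\<mu>\<close>.
\<close>

subsection \<open>Almost subadditive sequences and slow variation\<close>

text \<open>Summable covariances give no independence between windows: adjacent windows of length m
  are coupled through a sum of covariance tails that is o(m) but may be unbounded, which is why the
  errors below depend on m. The Gaussian structure compensates. A negative power of a sum of
  exponentials reacts to added Gaussian noise by a factor that depends on the noise variance alone,
  whatever the number of terms; Jensen's inequality shows this once for the power and once for the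
  exponential. The logarithm of this factor is linear in \<theta>, and this permits small \<theta>:
  ln E[Z^-\<theta>] / \<theta> is close to -E[ln Z], so a positive free energy makes some moment of
  small negative order decay exponentially, and the bound Z^- \<ge> p leads back to order -1 at
  subexponential cost. Dropping the reward at the right end is what bounds Z^- below uniformly in
  the disorder. All negative moments are then finite, and the block variables p / Z^- lie between 0
  and 1, so their second moments are bounded by their means.\<close>

lemma almost_subadditive_iterate:
  fixes u e :: "nat \<Rightarrow> real"
  assumes sub: "\<And>m n. m \<ge> 1 \<Longrightarrow> n \<ge> 1 \<Longrightarrow> u (m + n) \<le> u m + u n + e m"
    and m: "m \<ge> 1" and r: "r \<ge> 1"
  shows "u (q * m + r) \<le> real q * (u m + e m) + u r"
proof (induction q)
  case (Suc q)
  \<comment> \<open>Blocks of length \<open>m\<close> are peeled off on the left, so that every one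
    of them costs the same error \<open>e m\<close>.\<close>
  have "u (m + (q * m + r)) \<le> u m + u (q * m + r) + e m"
    using sub[of m "q * m + r"] m r by auto
  then show ?case using Suc by (simp add: algebra_simps)
qed simp

lemma almost_subadditive_upper:
  fixes u e :: "nat \<Rightarrow> real"
  assumes sub: "\<And>m n. m \<ge> 1 \<Longrightarrow> n \<ge> 1 \<Longrightarrow> u (m + n) \<le> u m + u n + e m"
    and m: "m \<ge> 1" and eps: "\<epsilon> > 0"
  shows "eventually (\<lambda>n. u n / real n \<le> (u m + e m) / real m + \<epsilon>) sequentially"
proof -
  define c where "c = u m + e m"
  define C where "C = Max ((\<lambda>r. \<bar>u r\<bar>) ` {1..m}) + \<bar>c\<bar>"
  have bnd: "u n \<le> c / m * n + C" if n: "n \<ge> 1" for n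
  proof -
    \<comment> \<open>The remainder is taken in \<open>{1..m}\<close> and not in
      \<open>{0..<m}\<close>, because \<open>sub\<close> speaks of positive lengths only.\<close>
    define q where "q = (n - 1) div m"
    define r where "r = (n - 1) mod m + 1"
    have r: "r \<in> {1..m}" using m by (auto simp: r_def Suc_le_eq)
    have nq: "n = q * m + r" unfolding q_def r_def using n by simp
    have "u n \<le> q * c + u r"
      unfolding nq c_def using almost_subadditive_iterate[OF sub m, of r] r by auto
    also have "q * c = c / m * n - c * (r / m)"
      using m by (simp add: nq field_simps)
    also have "- (c * (r / m)) \<le> \<bar>c\<bar>"
    proof -
      have "- (c * (r / m)) \<le> \<bar>c * (r / m)\<bar>" by linarith
      also have "\<dots> = \<bar>c\<bar> * (r / m)" by (simp add: abs_mult)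
      also have "\<dots> \<le> \<bar>c\<bar> * 1" using r m by (intro mult_left_mono) auto
      finally show ?thesis by simp
    qed
    then have "c / m * n - c * (r / m) + u r \<le> c / m * n + \<bar>c\<bar> + u r" by simp
    also have "u r \<le> Max ((\<lambda>r. \<bar>u r\<bar>) ` {1..m})"
      by (rule order_trans[OF abs_ge_self], rule Max_ge) (use r in auto)
    finally show ?thesis unfolding C_def by simp
  qed
  have "(\<lambda>n::nat. C / n) \<longlonglongrightarrow> 0" by real_asymp
  then have "eventually (\<lambda>n::nat. C / n < \<epsilon>) sequentially"
    using eps by (simp add: order_tendsto_iff)
  then show ?thesis
    using eventually_ge_at_top[of "1::nat"]
  proof eventually_elim
    case (elim n)
    then have "u n / n \<le> (c / m * n + C) / n" using bnd[of n] by (intro divide_right_mono) auto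
    also have "\<dots> = c / m + C / n" using elim by (simp add: field_simps)
    finally show ?case using elim unfolding c_def by simp
  qed
qed

text \<open>Fekete's argument with \<open>b m = (u m + e m) / m\<close> in place of
  \<open>u m / m\<close>: each \<open>b m\<close> bounds the quotients eventually from above, up to
  an arbitrarily small error, and the infimum of \<open>b\<close> bounds them from below up to
  \<open>e n / n\<close>, which vanishes. The linear lower bound on \<open>u\<close> makes the
  infimum finite.\<close>

lemma almost_subadditive_convergent:
  fixes u e :: "nat \<Rightarrow> real"
  assumes sub: "\<And>m n. m \<ge> 1 \<Longrightarrow> n \<ge> 1 \<Longrightarrow> u (m + n) \<le> u m + u n + e m"
    and e0: "\<And>m. e m \<ge> 0" and e: "(\<lambda>m. e m / real m) \<longlonglongrightarrow> 0"
    and lower: "\<And>n. n \<ge> 1 \<Longrightarrow> u n \<ge> - C * real n"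
  shows "convergent (\<lambda>n. u n / real n)"
proof -
  define b where "b m = (u m + e m) / real m" for m
  define L where "L = (INF m\<in>{1..}. b m)"
  have bl: "b m \<ge> - C" if "m \<ge> 1" for m
  proof -
    have "- C * real m \<le> u m + e m" using lower[OF that] e0[of m] by linarith
    then show ?thesis unfolding b_def using that by (simp add: le_divide_eq)
  qed
  then have bdd: "bdd_below (b ` {1..})" by (intro bdd_belowI2[of _ "- C"]) auto
  have "(\<lambda>n. u n / real n) \<longlonglongrightarrow> L"
  proof (rule LIMSEQ_I)
    fix \<epsilon> :: real assume eps: "\<epsilon> > 0"
    have "\<exists>m\<in>{1..}. b m < L + \<epsilon> / 2"
      using cINF_less_iff[of "{1::nat..}" b "L + \<epsilon> / 2"] bdd eps unfolding L_def by auto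
    then obtain m where m: "m \<ge> 1" "b m < L + \<epsilon> / 2" by auto
    have 1: "eventually (\<lambda>n. u n / n \<le> b m + \<epsilon> / 3) sequentially"
      unfolding b_def by (rule almost_subadditive_upper[OF sub m(1)]) (use eps in auto)
    have 2: "eventually (\<lambda>n. e n / n < \<epsilon>) sequentially"
      using e eps by (simp add: order_tendsto_iff)
    from 1 2 eventually_ge_at_top[of 1] have "eventually (\<lambda>n. norm (u n / n - L) < \<epsilon>) sequentially"
    proof eventually_elim
      case (elim n)
      have "L \<le> b n" unfolding L_def by (rule cINF_lower[OF bdd]) (use elim in auto)
      also have "b n = u n / n + e n / n" by (simp add: b_def add_divide_distrib)
      finally show ?case using elim m by (simp add: abs_less_iff)
    qed
    then show "\<exists>no. \<forall>n\<ge>no. norm (u n / real n - L) < \<epsilon>"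
      by (simp add: eventually_sequentially)
  qed
  then show ?thesis by (rule convergentI)
qed

lemma cesaro_null:
  fixes t :: "nat \<Rightarrow> real"
  assumes "t \<longlonglongrightarrow> 0"
  shows "(\<lambda>m. (\<Sum>r\<in>{1..m}. t r) / real m) \<longlonglongrightarrow> 0"
proof (rule LIMSEQ_I)
  fix \<epsilon> :: real assume eps: "\<epsilon> > 0"
  obtain N where N: "\<And>n. n \<ge> N \<Longrightarrow> \<bar>t n\<bar> < \<epsilon> / 2"
    using LIMSEQ_D[OF assms, of "\<epsilon> / 2"] eps by auto
  define C where "C = (\<Sum>r\<in>{1..N}. \<bar>t r\<bar>)"
  have "(\<lambda>n::nat. C / n) \<longlonglongrightarrow> 0" by real_asymp
  then have "eventually (\<lambda>n::nat. C / n < \<epsilon> / 2) sequentially"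
    using eps by (intro order_tendstoD(2)) auto
  then have "eventually (\<lambda>m. norm ((\<Sum>r\<in>{1..m}. t r) / real m - 0) < \<epsilon>) sequentially"
    using eventually_ge_at_top[of "max 1 N"]
  proof eventually_elim
    case (elim m)
    have "\<bar>\<Sum>r\<in>{1..m}. t r\<bar> \<le> (\<Sum>r\<in>{1..m}. \<bar>t r\<bar>)" by (rule sum_abs)
    also have "\<dots> = (\<Sum>r\<in>{1..N} \<union> {N<..m}. \<bar>t r\<bar>)"
      using elim by (intro sum.cong) auto
    also have "\<dots> = C + (\<Sum>r\<in>{N<..m}. \<bar>t r\<bar>)"
      unfolding C_def by (rule sum.union_disjoint) auto
    also have "(\<Sum>r\<in>{N<..m}. \<bar>t r\<bar>) \<le> (\<Sum>r\<in>{N<..m}. \<epsilon> / 2)"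
      by (rule sum_mono) (use N in \<open>auto simp: less_imp_le\<close>)
    also have "\<dots> \<le> m * (\<epsilon> / 2)" using eps by (auto simp: field_simps)
    finally have "\<bar>\<Sum>r\<in>{1..m}. t r\<bar> / m \<le> (C + m * (\<epsilon> / 2)) / m"
      by (intro divide_right_mono) auto
    also have "\<dots> = C / m + \<epsilon> / 2" using elim by (simp add: field_simps)
    finally have "\<bar>\<Sum>r\<in>{1..m}. t r\<bar> / m < \<epsilon>" using elim(1) by linarith
    then show ?case by simp
  qed
  then show "\<exists>no. \<forall>n\<ge>no. norm ((\<Sum>r\<in>{1..n}. t r) / real n - 0) < \<epsilon>"
    by (simp add: eventually_sequentially)
qed

text \<open>Boundedness of the increments is the part of Karamata's uniform convergence theorem that is
  needed; it is obtained by comparing both \<open>g z\<close> and \<open>g y\<close> with the average of \<open>g\<close> over a common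
  window.\<close>

lemma increments_bounded:
  fixes g :: "real \<Rightarrow> real"
  assumes [measurable]: "g \<in> borel_measurable borel"
    and g: "\<And>u. ((\<lambda>y. g (y + u) - g y) \<longlongrightarrow> 0) at_top"
  shows "\<exists>Y. \<forall>y\<ge>Y. \<forall>u\<in>{0..1}. \<bar>g (y + u) - g y\<bar> < 1"
proof -
  \<comment> \<open>Truncation at 1 supplies the constant majorant for dominated convergence and is
    harmless, as the bound aimed at is 1.\<close>
  define I where "I y = (LINT u|restrict_space lborel {0..2::real}. min 1 \<bar>g (y + u) - g y\<bar>)" for y
  have fin: "finite_measure (restrict_space lborel {0..2::real})"
    by (rule finite_measureI) (simp add: space_restrict_space emeasure_restrict_space)
  have "(I \<longlongrightarrow> (LINT u|restrict_space lborel {0..2::real}. 0)) at_top"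
    unfolding I_def
  proof (rule integral_dominated_convergence_at_top[where w = "\<lambda>_. 1"])
    show "integrable (restrict_space lborel {0..2}) (\<lambda>_::real. 1::real)"
      using fin by (simp add: finite_measure.integrable_const)
    show "AE x in restrict_space lborel {0..2}. ((\<lambda>i. min 1 \<bar>g (i + x) - g i\<bar>) \<longlongrightarrow> 0) at_top"
    proof (rule AE_I2)
      fix u
      have "((\<lambda>i. min 1 \<bar>g (i + u) - g i\<bar>) \<longlongrightarrow> min 1 \<bar>0\<bar>) at_top"
        by (intro tendsto_intros g)
      then show "((\<lambda>i. min 1 \<bar>g (i + u) - g i\<bar>) \<longlongrightarrow> 0) at_top" by simp
    qed
  qed (auto intro!: measurable_restrict_space1)
  then have "eventually (\<lambda>y. I y < 1 / 2) at_top" by (intro order_tendstoD(2)) auto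
  then obtain Y where Y: "\<And>y. y \<ge> Y \<Longrightarrow> I y < 1 / 2" by (auto simp: eventually_at_top_linorder)
  have key: "\<bar>g (y + u) - g y\<bar> < 1" if y: "y \<ge> Y" and u: "u \<in> {0..1}" for y u
  proof -
    let ?A = "\<lambda>t. indicator {0..2} t * min 1 \<bar>g (y + t) - g y\<bar>"
    let ?B = "\<lambda>t. indicator {0..2} (t - u) * min 1 \<bar>g (y + t) - g (y + u)\<bar>"
    have Ieq: "I z = (LINT t|lborel. indicator {0..2} t * min 1 \<bar>g (z + t) - g z\<bar>)" for z
      unfolding I_def by (subst integral_restrict_space) auto
    have A: "(LINT t|lborel. ?A t) < 1 / 2" using Y[OF y] by (simp add: Ieq)
    have "I (y + u) = (LINT t|lborel. indicator {0..2} (-u + 1 * t) * min 1 \<bar>g ((y + u) + (-u + 1 * t)) - g (y + u)\<bar>)"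
      unfolding Ieq by (subst lborel_integral_real_affine[of 1 _ "-u"]) auto
    then have B: "(LINT t|lborel. ?B t) < 1 / 2"
      using Y[of "y + u"] y u by (simp add: algebra_simps)
    have bnd: "integrable lborel (\<lambda>t. indicator {0..3::real} t :: real)" by simp
    have iA: "integrable lborel ?A"
      by (rule Bochner_Integration.integrable_bound[OF bnd])
         (auto simp: indicator_def)
    have iB: "integrable lborel ?B"
      by (rule Bochner_Integration.integrable_bound[OF bnd])
         (use u in \<open>auto simp: indicator_def\<close>)
    \<comment> \<open>The windows \<open>{0..2}\<close> and \<open>{u..u + 2}\<close> both contain
      \<open>{1..2}\<close>, of length one. There the triangle inequality bounds the constant
      integrand by the sum of the two others, whose integrals are below 1/2 each.\<close>
    have "min 1 \<bar>g (y + u) - g y\<bar> = (LINT t|lborel. indicator {1..2::real} t * min 1 \<bar>g (y + u) - g y\<bar>)"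
      by simp
    also have "\<dots> \<le> (LINT t|lborel. ?A t + ?B t)"
    proof (rule integral_mono)
      show "integrable lborel (\<lambda>t. indicator {1..2::real} t * min 1 \<bar>g (y + u) - g y\<bar>)" by simp
      show "integrable lborel (\<lambda>t. ?A t + ?B t)" using iA iB by simp
      show "indicator {1..2} t * min 1 \<bar>g (y + u) - g y\<bar> \<le> ?A t + ?B t" for t
        using u by (auto simp: indicator_def split: if_splits)
    qed
    also have "\<dots> < 1" using A B iA iB by simp
    finally show ?thesis by linarith
  qed
  then show ?thesis by blast
qed

lemma linear_lower_bound_of_increments:
  fixes g :: "real \<Rightarrow> real"
  assumes Y: "\<And>y u. y \<ge> Y \<Longrightarrow> u \<in> {0..1} \<Longrightarrow> \<bar>g (y + u) - g y\<bar> < 1" and y: "y \<ge> Y"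
  shows "g y \<ge> g Y - (y - Y) - 1"
proof -
  have *: "g (Y + real n) \<ge> g Y - real n" for n
  proof (induction n)
    case (Suc n)
    then show ?case using Y[of "Y + real n" 1] by (simp add: algebra_simps)
  qed simp
  define n where "n = nat \<lfloor>y - Y\<rfloor>"
  have n: "real n \<le> y - Y" "y - Y < real n + 1" using y unfolding n_def by linarith+
  show ?thesis using *[of n] Y[of "Y + real n" "y - Y - real n"] n by auto
qed

text \<open>In the coordinate \<open>g y = ln (ell (exp y))\<close> slow variation says that
  increments over a fixed distance vanish at infinity. Hence unit increments are eventually smaller
  than 1 and \<open>g\<close> decreases at most linearly with slope 1; this slope is the exponent of
  \<open>C / x\<close>.\<close>

lemma slowly_varying_polynomial_lower:
  assumes sv: "slowly_varying ell" and ell0: "\<And>x. x \<ge> 1 \<Longrightarrow> ell x \<ge> 0"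
  shows "\<exists>C>0. eventually (\<lambda>x. ell x \<ge> C / x) at_top"
proof -
  have lim: "((\<lambda>x. ell (c * x) / ell x) \<longlongrightarrow> 1) at_top" if "c > 0" for c
    using sv that by (simp add: slowly_varying_def)
  have ev: "eventually (\<lambda>x. ell x > 0) at_top"
  proof -
    have "eventually (\<lambda>x. ell (1 * x) / ell x > 0) at_top"
      using lim[of 1] by (simp add: order_tendsto_iff)
    then show ?thesis using eventually_ge_at_top[of 1]
      by eventually_elim (use ell0 in \<open>force simp: less_le\<close>)
  qed
  \<comment> \<open>The cut at 0 is due to \<open>ell\<close> being measurable on
    \<open>{1..}\<close> only.\<close>
  define g where "g y = (if y \<ge> 0 then ln (ell (exp y)) else 0)" for y
  have [measurable]: "g \<in> borel_measurable borel"
  proof -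
    have m1: "ell \<in> borel_measurable (restrict_space borel {1..})"
      using sv by (simp add: slowly_varying_def)
    have m2: "(\<lambda>y. exp y) \<in> measurable (restrict_space borel {0::real..}) (restrict_space borel {1::real..})"
      by (intro measurable_restrict_space3) auto
    have "(\<lambda>y. ell (exp y)) \<in> borel_measurable (restrict_space borel {0..})"
      using measurable_compose[OF m2 m1] by simp
    then have "(\<lambda>y. ln (ell (exp y))) \<in> borel_measurable (restrict_space borel {0..})"
      by measurable
    then have "(\<lambda>y. if y \<in> {0..} then ln (ell (exp y)) else 0) \<in> borel_measurable borel"
      by (subst (asm) measurable_restrict_space_iff[where c = 0]) (auto simp: if_distrib)
    then show ?thesis by (simp add: g_def[abs_def])
  qed
  have incr: "((\<lambda>y. g (y + u) - g y) \<longlongrightarrow> 0) at_top" for u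
  proof -
    have "((\<lambda>y. ln (ell (exp u * exp y) / ell (exp y))) \<longlongrightarrow> ln 1) at_top"
      by (intro tendsto_ln filterlim_compose[OF lim exp_at_top]) auto
    moreover have "eventually (\<lambda>y. ln (ell (exp u * exp y) / ell (exp y)) = g (y + u) - g y) at_top"
    proof -
      have e1: "eventually (\<lambda>y. ell (exp y) > 0) at_top"
        using ev exp_at_top by (auto simp: filterlim_iff)
      have e2: "eventually (\<lambda>y. ell (exp (y + u)) > 0) at_top"
      proof -
        have "filterlim (\<lambda>y. y + u) at_top at_top" by real_asymp
        with e1 show ?thesis by (auto simp: filterlim_iff)
      qed
      show ?thesis using e1 e2 eventually_ge_at_top[of "max 0 (-u)"]
        by eventually_elim (auto simp: g_def ln_div exp_add mult.commute)
    qed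
    ultimately show ?thesis by (simp add: tendsto_cong)
  qed
  obtain Y0 where Y0: "\<And>y u. y \<ge> Y0 \<Longrightarrow> u \<in> {0..1} \<Longrightarrow> \<bar>g (y + u) - g y\<bar> < 1"
    using increments_bounded[OF _ incr] by (meson \<open>g \<in> borel_measurable borel\<close>)
  define C where "C = exp (g Y0 + Y0 - 1)"
  have "eventually (\<lambda>x. ln x \<ge> max 0 Y0) at_top"
    using ln_at_top unfolding filterlim_at_top by blast
  then have "eventually (\<lambda>x. ell x \<ge> C / x) at_top"
    using ev eventually_gt_at_top[of 0]
  proof eventually_elim
    case (elim x)
    have "g (ln x) \<ge> g Y0 - (ln x - Y0) - 1"
      by (rule linear_lower_bound_of_increments[OF Y0]) (use elim in auto)
    moreover have "g (ln x) = ln (ell x)" using elim by (simp add: g_def)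
    ultimately have "exp (g Y0 + Y0 - 1 - ln x) \<le> exp (ln (ell x))" by simp
    then show ?case using elim by (simp add: C_def exp_diff)
  qed
  then show ?thesis unfolding C_def by (intro exI[of _ "exp (g Y0 + Y0 - 1)"]) auto
qed

text \<open>A polynomial lower bound beats \<open>exp (- \<delta> * t)\<close> from some
  \<open>N\<close> on, and positivity of \<open>p\<close> lets the constant absorb the finitely many
  earlier \<open>t\<close>. Later arguments need of the renewal law only that replacing
  \<open>p\<close> by a constant costs an exponential of arbitrarily small rate.\<close>

lemma renewal_law_subexponential:
  assumes "slowly_varying ell" and "\<And>x. x \<ge> 1 \<Longrightarrow> ell x \<ge> 0"
    and p: "\<And>t. t \<ge> 1 \<Longrightarrow> p t = ell (real t) / real t powr (alpha + 1)"
    and pos: "\<And>t. t \<ge> 1 \<Longrightarrow> p t > 0" and \<delta>: "\<delta> > 0"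
  shows "\<exists>c>0. \<forall>t\<ge>1. p t \<ge> c * exp (- \<delta> * real t)"
proof -
  obtain C where C: "C > 0" "eventually (\<lambda>x. ell x \<ge> C / x) at_top"
    using slowly_varying_polynomial_lower[OF assms(1,2)] by auto
  have "eventually (\<lambda>n. ell (real n) \<ge> C / real n) sequentially"
    using C(2) filterlim_real_sequentially by (auto simp: filterlim_iff)
  then have "eventually (\<lambda>n. exp (- \<delta> * n) / p n \<le> exp (- \<delta> * n) * n powr (alpha + 2) / C) sequentially"
    using eventually_ge_at_top[of 1]
  proof eventually_elim
    case (elim n)
    have "C / n powr (alpha + 2) = C / n / n powr (alpha + 1)"
      using elim by (simp add: powr_add field_simps power2_eq_square)
    also have "\<dots> \<le> ell n / n powr (alpha + 1)" using elim by (intro divide_right_mono) auto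
    also have "\<dots> = p n" using elim p[of n] by simp
    finally have "1 / p n \<le> 1 / (C / n powr (alpha + 2))"
      using elim C pos[of n] by (intro divide_left_mono) auto
    then have "exp (- \<delta> * n) * (1 / p n) \<le> exp (- \<delta> * n) * (1 / (C / n powr (alpha + 2)))"
      by (intro mult_left_mono) auto
    then show ?case by simp
  qed
  moreover have "(\<lambda>n::nat. exp (- \<delta> * n) * n powr (alpha + 2) / C) \<longlonglongrightarrow> 0"
    using C \<delta> by real_asymp
  then have "eventually (\<lambda>n::nat. exp (- \<delta> * n) * n powr (alpha + 2) / C < 1) sequentially"
    by (simp add: order_tendsto_iff)
  ultimately have "eventually (\<lambda>n. n \<ge> 1 \<longrightarrow> exp (- \<delta> * n) \<le> p n) sequentially"
  proof eventually_elim
    case (elim n)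
    then have "exp (- \<delta> * n) / p n < 1" by linarith
    then show ?case using pos[of n] by (auto simp: divide_less_eq)
  qed
  then obtain N where N: "\<And>n. n \<ge> N \<Longrightarrow> n \<ge> 1 \<Longrightarrow> exp (- \<delta> * n) \<le> p n"
    by (auto simp: eventually_sequentially)
  define c where "c = Min (insert 1 (p ` {1..N}))"
  have c: "c > 0" "c \<le> 1" and cle: "\<And>t. t \<in> {1..N} \<Longrightarrow> c \<le> p t"
    unfolding c_def using pos by (auto simp: Min_gr_iff simp del: Min_insert intro!: Min_le)
  have "p t \<ge> c * exp (- \<delta> * real t)" if t: "t \<ge> 1" for t
  proof (cases "t \<le> N")
    case True
    have "c * exp (- \<delta> * real t) \<le> c * 1" using c \<delta> by (intro mult_left_mono) auto
    then show ?thesis using cle[of t] True t by auto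
  next
    case False
    have "c * exp (- \<delta> * real t) \<le> 1 * exp (- \<delta> * real t)" using c by (intro mult_right_mono) auto
    also have "\<dots> \<le> p t" using N[of t] False t by auto
    finally show ?thesis .
  qed
  then show ?thesis using c by auto
qed

subsection \<open>Uniqueness of multivariate laws\<close>

text \<open>Both the characteristic function and the measure of a Borel set are affine in the
  weighted integrals of \<open>\<phi>\<close>. Equality of characteristic functions can therefore be
  pulled back to the signed weight.\<close>

lemma char_distr_weighted:
  fixes X \<phi> :: "'a \<Rightarrow> real"
  assumes "prob_space P"
    and [measurable]: "X \<in> borel_measurable P" "\<phi> \<in> borel_measurable P"
    and bnd: "\<And>x. \<bar>\<phi> x\<bar> \<le> 1"
  defines "m \<equiv> 2 + (\<integral>x. \<phi> x \<partial>P)"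
  defines "N \<equiv> distr (density P (\<lambda>x. ennreal ((2 + \<phi> x) / m))) borel X"
  shows "real_distribution N"
    and "char N t = (2 * (\<integral>x. iexp (t * X x) \<partial>P) + (\<integral>x. \<phi> x *\<^sub>R iexp (t * X x) \<partial>P)) / m"
    and "B \<in> sets borel \<Longrightarrow>
      measure N B = (2 * (\<integral>x. indicator B (X x) \<partial>P) + (\<integral>x. \<phi> x * indicator B (X x) \<partial>P)) / m"
    and "m \<ge> 1"
proof -
  interpret prob_space P by fact
  have i\<phi>: "integrable P \<phi>" using bnd by (intro integrable_const_bound[where B = 1]) auto
  have "(\<integral>x. \<phi> x \<partial>P) \<ge> (\<integral>x. -1 \<partial>P)"
  proof (rule integral_mono[OF _ i\<phi>])
    show "- 1 \<le> \<phi> x" for x using bnd[of x] by linarith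
  qed simp
  then show m: "m \<ge> 1" unfolding m_def by (simp add: prob_space)
  have pos: "(2 + \<phi> x) / m \<ge> 0" for x using bnd[of x] m by (auto simp: abs_le_iff)
  define D where "D = density P (\<lambda>x. ennreal ((2 + \<phi> x) / m))"
  have "emeasure D (space D) = (\<integral>\<^sup>+x. ennreal ((2 + \<phi> x) / m) \<partial>P)"
    unfolding D_def by (simp add: emeasure_density cong: nn_integral_cong)
  also have "\<dots> = ennreal (\<integral>x. (2 + \<phi> x) / m \<partial>P)"
    by (rule nn_integral_eq_integral) (use i\<phi> pos in auto)
  also have "(\<integral>x. (2 + \<phi> x) / m \<partial>P) = 1"
    using i\<phi> m by (simp add: m_def prob_space)
  finally have D: "prob_space D" by (intro prob_spaceI) simp
  have [measurable]: "X \<in> borel_measurable D" unfolding D_def by simp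
  have N: "N = distr D borel X" unfolding N_def D_def ..
  show "real_distribution N" unfolding N
    by (rule prob_space.real_distribution_distr[OF D]) simp
  have integral: "(\<integral>x. f (X x) \<partial>D) = (2 * (\<integral>x. f (X x) \<partial>P) + (\<integral>x. \<phi> x *\<^sub>R f (X x) \<partial>P)) / m"
    if f[measurable]: "f \<in> borel_measurable borel" and fb: "\<And>x. norm (f x) \<le> 1" for f :: "real \<Rightarrow> complex"
  proof -
    have i1: "integrable P (\<lambda>x. f (X x))"
      by (rule integrable_const_bound[where B = 1]) (use fb in auto)
    have i2: "integrable P (\<lambda>x. \<phi> x *\<^sub>R f (X x))"
    proof (rule integrable_const_bound[where B = 1])
      show "AE x in P. norm (\<phi> x *\<^sub>R f (X x)) \<le> 1"
        using bnd fb by (auto intro!: mult_le_one)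
    qed simp
    have "(\<integral>x. f (X x) \<partial>D) = (\<integral>x. ((2 + \<phi> x) / m) *\<^sub>R f (X x) \<partial>P)"
      unfolding D_def by (rule integral_density) (use pos in auto)
    also have "\<dots> = (\<integral>x. (1 / m) *\<^sub>R (2 * f (X x) + \<phi> x *\<^sub>R f (X x)) \<partial>P)"
      by (rule Bochner_Integration.integral_cong) (auto simp: scaleR_conv_of_real field_simps)
    also have "\<dots> = (2 * (\<integral>x. f (X x) \<partial>P) + (\<integral>x. \<phi> x *\<^sub>R f (X x) \<partial>P)) / m"
      using i1 i2 by (simp add: scaleR_conv_of_real)
    finally show ?thesis .
  qed
  have "char N t = (\<integral>x. iexp (t * X x) \<partial>D)"
    unfolding N char_def by (subst integral_distr) auto
  also have "\<dots> = (2 * (\<integral>x. iexp (t * X x) \<partial>P) + (\<integral>x. \<phi> x *\<^sub>R iexp (t * X x) \<partial>P)) / m"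
    by (rule integral) auto
  finally show "char N t = (2 * (\<integral>x. iexp (t * X x) \<partial>P) + (\<integral>x. \<phi> x *\<^sub>R iexp (t * X x) \<partial>P)) / m" .
  show "measure N B = (2 * (\<integral>x. indicator B (X x) \<partial>P) + (\<integral>x. \<phi> x * indicator B (X x) \<partial>P)) / m"
    if B[measurable]: "B \<in> sets borel"
  proof -
    interpret N: real_distribution N by fact
    have "complex_of_real (measure N B) = (\<integral>x. complex_of_real (indicator B x) \<partial>N)"
      using B by (simp add: N)
    also have "\<dots> = (\<integral>x. complex_of_real (indicator B (X x)) \<partial>D)"
      unfolding N by (subst integral_distr) auto
    also have "\<dots> = (2 * (\<integral>x. complex_of_real (indicator B (X x)) \<partial>P)
        + (\<integral>x. \<phi> x *\<^sub>R complex_of_real (indicator B (X x)) \<partial>P)) / m"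
      by (rule integral) (auto simp: indicator_def)
    also have "\<dots> = complex_of_real ((2 * (\<integral>x. indicator B (X x) \<partial>P) + (\<integral>x. \<phi> x * indicator B (X x) \<partial>P)) / m)"
    proof -
      have "\<phi> x *\<^sub>R complex_of_real (indicator B (X x)) = complex_of_real (\<phi> x * indicator B (X x))" for x
        by (simp add: scaleR_conv_of_real)
      then show ?thesis by (simp only: integral_complex_of_real) simp
    qed
    finally show ?thesis by (simp only: of_real_eq_iff)
  qed
qed

text \<open>Adding the constant 2 to the weight makes it a density, so that Levy's uniqueness theorem
  applies to a signed weight.\<close>

lemma weighted_char_uniqueness:
  fixes X \<phi> :: "'a \<Rightarrow> real" and Y \<psi> :: "'b \<Rightarrow> real"
  assumes P: "prob_space P" and Q: "prob_space Q"
    and X[measurable]: "X \<in> borel_measurable P" "\<phi> \<in> borel_measurable P"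
    and Y[measurable]: "Y \<in> borel_measurable Q" "\<psi> \<in> borel_measurable Q"
    and b: "\<And>x. \<bar>\<phi> x\<bar> \<le> 1" "\<And>x. \<bar>\<psi> x\<bar> \<le> 1"
    and c1: "\<And>t. (\<integral>x. iexp (t * X x) \<partial>P) = (\<integral>x. iexp (t * Y x) \<partial>Q)"
    and c2: "\<And>t. (\<integral>x. \<phi> x *\<^sub>R iexp (t * X x) \<partial>P) = (\<integral>x. \<psi> x *\<^sub>R iexp (t * Y x) \<partial>Q)"
    and B: "B \<in> sets borel"
  shows "(\<integral>x. \<phi> x * indicator B (X x) \<partial>P) = (\<integral>x. \<psi> x * indicator B (Y x) \<partial>Q)"
proof -
  have step: "2 * (\<integral>x. indicator B (X x) \<partial>P) + (\<integral>x. f x * indicator B (X x) \<partial>P)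
       = 2 * (\<integral>x. indicator B (Y x) \<partial>Q) + (\<integral>x. g x * indicator B (Y x) \<partial>Q)"
    if [measurable]: "f \<in> borel_measurable P" "g \<in> borel_measurable Q"
      and b: "\<And>x. \<bar>f x\<bar> \<le> (1::real)" "\<And>x. \<bar>g x\<bar> \<le> (1::real)"
      and c2: "\<And>t. (\<integral>x. f x *\<^sub>R iexp (t * X x) \<partial>P) = (\<integral>x. g x *\<^sub>R iexp (t * Y x) \<partial>Q)" for f g
  proof -
    note * = char_distr_weighted[OF P X(1) \<open>f \<in> _\<close> b(1)] char_distr_weighted[OF Q Y(1) \<open>g \<in> _\<close> b(2)]
    have "complex_of_real (\<integral>x. f x \<partial>P) = complex_of_real (\<integral>x. g x \<partial>Q)"
      using c2[of 0] by (simp add: scaleR_conv_of_real)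
    then have m: "(\<integral>x. f x \<partial>P) = (\<integral>x. g x \<partial>Q)" by (simp only: of_real_eq_iff)
    have "distr (density P (\<lambda>x. ennreal ((2 + f x) / (2 + (\<integral>x. f x \<partial>P))))) borel X
        = distr (density Q (\<lambda>x. ennreal ((2 + g x) / (2 + (\<integral>x. g x \<partial>Q))))) borel Y"
      by (rule Levy_uniqueness[OF *(1,5)]) (intro ext, simp only: *(2,6), simp only: m c1 c2)
    from arg_cong[OF this, of "\<lambda>N. measure N B"]
    have "(2 * (\<integral>x. indicator B (X x) \<partial>P) + (\<integral>x. f x * indicator B (X x) \<partial>P)) / (2 + (\<integral>x. g x \<partial>Q))
       = (2 * (\<integral>x. indicator B (Y x) \<partial>Q) + (\<integral>x. g x * indicator B (Y x) \<partial>Q)) / (2 + (\<integral>x. g x \<partial>Q))"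
      unfolding *(3)[OF B] *(7)[OF B] unfolding m .
    moreover have "2 + (\<integral>x. g x \<partial>Q) \<noteq> 0" using *(8) by linarith
    ultimately show ?thesis by (simp only: divide_cancel_right) blast
  qed
  \<comment> \<open>The instance with weight 0 compares the unweighted laws; subtracting it from the
    instance with \<open>\<phi>\<close> and \<open>\<psi>\<close> leaves the weighted
    integrals.\<close>
  have "2 * (\<integral>x. indicator B (X x) \<partial>P) + (\<integral>x. 0 * indicator B (X x) \<partial>P)
      = 2 * (\<integral>x. indicator B (Y x) \<partial>Q) + (\<integral>x. 0 * indicator B (Y x) \<partial>Q :: real)"
    by (rule step) (simp_all only: scaleR_zero_left integral_zero borel_measurable_const abs_zero zero_le_one)
  moreover have "2 * (\<integral>x. indicator B (X x) \<partial>P) + (\<integral>x. \<phi> x * indicator B (X x) \<partial>P)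
      = 2 * (\<integral>x. indicator B (Y x) \<partial>Q) + (\<integral>x. \<psi> x * indicator B (Y x) \<partial>Q)"
    by (rule step[OF X(2) Y(2) b c2])
  ultimately show ?thesis by (simp only: mult_zero_left integral_zero)
qed

text \<open>Coordinates are converted one at a time from an exponential into an indicator, and the
  statement mixes both kinds so that the induction closes. When coordinate \<open>j\<close> is
  converted, the indicators already obtained and the exponentials still present form a bounded
  weight, and uniqueness of one-dimensional laws under a weight applies to
  \<open>X j\<close>.\<close>

lemma box_probabilities_from_char:
  fixes X :: "'i \<Rightarrow> 'a \<Rightarrow> real" and Y :: "'i \<Rightarrow> 'b \<Rightarrow> real"
  assumes P: "prob_space P" and Q: "prob_space Q" and I: "finite I"
    and X[measurable]: "\<And>i. i \<in> I \<Longrightarrow> X i \<in> borel_measurable P"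
    and Y[measurable]: "\<And>i. i \<in> I \<Longrightarrow> Y i \<in> borel_measurable Q"
    and char: "\<And>t. (\<integral>x. iexp (\<Sum>i\<in>I. t i * X i x) \<partial>P) = (\<integral>x. iexp (\<Sum>i\<in>I. t i * Y i x) \<partial>Q)"
    and J: "J \<subseteq> I" and B: "\<And>i. i \<in> I \<Longrightarrow> B i \<in> sets borel"
  shows "(\<integral>x. (\<Prod>i\<in>J. indicator (B i) (X i x)) *\<^sub>R iexp (\<Sum>i\<in>I-J. t i * X i x) \<partial>P)
       = (\<integral>x. (\<Prod>i\<in>J. indicator (B i) (Y i x)) *\<^sub>R iexp (\<Sum>i\<in>I-J. t i * Y i x) \<partial>Q)"
  using finite_subset[OF J I] J
proof (induction J arbitrary: t rule: finite_induct)
  case empty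
  then show ?case using char by simp
next
  case (insert j J)
  then have jI: "j \<in> I" "J \<subseteq> I" "j \<notin> J" and fJ: "finite J" by auto
  interpret P: prob_space P by fact
  interpret Q: prob_space Q by fact
  let ?K = "I - insert j J"
  define pX where "pX x = (\<Prod>i\<in>J. indicator (B i) (X i x) :: real)" for x
  define pY where "pY x = (\<Prod>i\<in>J. indicator (B i) (Y i x) :: real)" for x
  define sX where "sX x = (\<Sum>i\<in>?K. t i * X i x)" for x
  define sY where "sY x = (\<Sum>i\<in>?K. t i * Y i x)" for x
  note B[measurable]
  have [measurable]: "pX \<in> borel_measurable P" "pY \<in> borel_measurable Q"
      "sX \<in> borel_measurable P" "sY \<in> borel_measurable Q"
    unfolding pX_def[abs_def] pY_def[abs_def] sX_def[abs_def] sY_def[abs_def]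
    using jI(2) X Y B by (auto intro!: borel_measurable_prod borel_measurable_sum borel_measurable_times
        measurable_compose[OF X borel_measurable_indicator] measurable_compose[OF Y borel_measurable_indicator])
  have [measurable]: "X j \<in> borel_measurable P" "Y j \<in> borel_measurable Q" using jI by auto
  have pb: "\<bar>pX x\<bar> \<le> 1" "\<bar>pY y\<bar> \<le> 1" for x y
    unfolding pX_def pY_def abs_prod by (auto intro!: prod_le_1 simp: indicator_def)
  \<comment> \<open>Scaling the remaining frequencies by \<open>c\<close> gives access to
    \<open>c = 1\<close> and \<open>c = -1\<close>. Their combinations have the real weights
    \<open>cos (sX x)\<close> and \<open>sin (sX x)\<close>, to which
    \<open>weighted_char_uniqueness\<close> applies.\<close>
  have IH: "(\<integral>x. pX x *\<^sub>R iexp (c * sX x + s * X j x) \<partial>P) = (\<integral>x. pY x *\<^sub>R iexp (c * sY x + s * Y j x) \<partial>Q)" for c s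
  proof -
    have K: "I - J = insert j ?K" using jI by auto
    have "(\<Sum>i\<in>I-J. (if i = j then s else c * t i) * X i x) = c * sX x + s * X j x" for x
    proof -
      have "(\<Sum>i\<in>?K. (if i = j then s else c * t i) * X i x) = c * sX x"
        unfolding sX_def sum_distrib_left by (intro sum.cong) auto
      then show ?thesis using I unfolding K by (subst sum.insert) auto
    qed
    moreover have "(\<Sum>i\<in>I-J. (if i = j then s else c * t i) * Y i x) = c * sY x + s * Y j x" for x
    proof -
      have "(\<Sum>i\<in>?K. (if i = j then s else c * t i) * Y i x) = c * sY x"
        unfolding sY_def sum_distrib_left by (intro sum.cong) auto
      then show ?thesis using I unfolding K by (subst sum.insert) auto
    qed
    ultimately show ?thesis
      using insert.IH[OF jI(2), of "\<lambda>i. if i = j then s else c * t i"]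
      unfolding pX_def pY_def by simp
  qed
  have cb: "norm (pX x *\<^sub>R iexp r) \<le> 1" "norm (pY y *\<^sub>R iexp r) \<le> 1" for x y r
    using pb by auto
  have iX: "integrable P (\<lambda>x. pX x *\<^sub>R iexp (c * sX x + s * X j x))" for c s
    by (rule P.integrable_const_bound[where B = 1]) (use cb in auto)
  have iY: "integrable Q (\<lambda>x. pY x *\<^sub>R iexp (c * sY x + s * Y j x))" for c s
    by (rule Q.integrable_const_bound[where B = 1]) (use cb in auto)
  have J0: "(\<integral>x. iexp (s * X j x) \<partial>P) = (\<integral>x. iexp (s * Y j x) \<partial>Q)" for s
  proof -
    have "(\<Sum>i\<in>I. (if i = j then s else 0) * X i x) = s * X j x" for x
      using jI I by (subst sum.remove[of _ j]) auto
    moreover have "(\<Sum>i\<in>I. (if i = j then s else 0) * Y i x) = s * Y j x" for x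
      using jI I by (subst sum.remove[of _ j]) auto
    ultimately show ?thesis using char[of "\<lambda>i. if i = j then s else 0"] by simp
  qed
  have e1: "iexp (1 * r + u) = iexp u * (complex_of_real (cos r) + \<i> * complex_of_real (sin r))"
    and e2: "iexp ((-1) * r + u) = iexp u * (complex_of_real (cos r) - \<i> * complex_of_real (sin r))" for r u :: real
  proof -
    have *: "iexp (a + b) = iexp b * iexp a" for a b :: real
      by (simp add: distrib_left exp_add)
    have **: "iexp a = complex_of_real (cos a) + \<i> * complex_of_real (sin a)" for a :: real
      by (simp add: exp_Euler cos_of_real sin_of_real)
    show "iexp (1 * r + u) = iexp u * (complex_of_real (cos r) + \<i> * complex_of_real (sin r))"
      unfolding * using **[of r] by simp
    show "iexp ((-1) * r + u) = iexp u * (complex_of_real (cos r) - \<i> * complex_of_real (sin r))"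
      unfolding * using **[of "(-1) * r"] by simp
  qed
  have cos_eq: "(p * cos r) *\<^sub>R iexp u = (1/2) *\<^sub>R (p *\<^sub>R iexp (1 * r + u) + p *\<^sub>R iexp ((-1) * r + u))" for p r u :: real
    unfolding e1 e2 scaleR_conv_of_real by (simp add: algebra_simps)
  have sin_eq: "(p * sin r) *\<^sub>R iexp u = (- \<i> / 2) * (p *\<^sub>R iexp (1 * r + u) - p *\<^sub>R iexp ((-1) * r + u))" for p r u :: real
    unfolding e1 e2 scaleR_conv_of_real by (simp add: algebra_simps)
  have c: "(\<integral>x. (pX x * cos (sX x)) *\<^sub>R iexp (s * X j x) \<partial>P) = (\<integral>x. (pY x * cos (sY x)) *\<^sub>R iexp (s * Y j x) \<partial>Q)" for s
    by (simp only: cos_eq integral_scaleR_right Bochner_Integration.integral_add[OF iX iX]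
        Bochner_Integration.integral_add[OF iY iY] IH)
  have s: "(\<integral>x. (pX x * sin (sX x)) *\<^sub>R iexp (s * X j x) \<partial>P) = (\<integral>x. (pY x * sin (sY x)) *\<^sub>R iexp (s * Y j x) \<partial>Q)" for s
    by (simp only: sin_eq integral_mult_right_zero Bochner_Integration.integral_diff[OF iX iX]
        Bochner_Integration.integral_diff[OF iY iY] IH)
  have le1: "\<bar>pX x * cos r\<bar> \<le> 1" "\<bar>pY y * cos r\<bar> \<le> 1" "\<bar>pX x * sin r\<bar> \<le> 1" "\<bar>pY y * sin r\<bar> \<le> 1" for x y r
    unfolding abs_mult using pb by (auto intro!: mult_le_one)
  have C: "(\<integral>x. (pX x * cos (sX x)) * indicator (B j) (X j x) \<partial>P) = (\<integral>x. (pY x * cos (sY x)) * indicator (B j) (Y j x) \<partial>Q)"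
    by (rule weighted_char_uniqueness[OF P Q]) (use J0 c B jI le1 in auto)
  have S: "(\<integral>x. (pX x * sin (sX x)) * indicator (B j) (X j x) \<partial>P) = (\<integral>x. (pY x * sin (sY x)) * indicator (B j) (Y j x) \<partial>Q)"
    by (rule weighted_char_uniqueness[OF P Q]) (use J0 s B jI le1 in auto)
  have [measurable]: "B j \<in> sets borel" using B jI by auto
  have iB: "integrable P (\<lambda>x. complex_of_real (pX x * cos (sX x) * indicator (B j) (X j x)))"
       "integrable P (\<lambda>x. complex_of_real (pX x * sin (sX x) * indicator (B j) (X j x)))"
    by (rule P.integrable_const_bound[where B = 1], use le1 in \<open>auto simp: indicator_def norm_mult abs_mult\<close>)+
  have iB': "integrable Q (\<lambda>x. complex_of_real (pY x * cos (sY x) * indicator (B j) (Y j x)))"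
       "integrable Q (\<lambda>x. complex_of_real (pY x * sin (sY x) * indicator (B j) (Y j x)))"
    by (rule Q.integrable_const_bound[where B = 1], use le1 in \<open>auto simp: indicator_def norm_mult abs_mult\<close>)+
  have split: "(indicator (B j) u * p) *\<^sub>R iexp r = complex_of_real (p * cos r * indicator (B j) u)
       + \<i> * complex_of_real (p * sin r * indicator (B j) u)" for p u r
    by (simp add: scaleR_conv_of_real exp_Euler algebra_simps flip: cos_of_real sin_of_real)
  have "(\<integral>x. (indicator (B j) (X j x) * pX x) *\<^sub>R iexp (sX x) \<partial>P)
      = (\<integral>x. (indicator (B j) (Y j x) * pY x) *\<^sub>R iexp (sY x) \<partial>Q)"
    by (simp only: split Bochner_Integration.integral_add[OF iB(1) integrable_mult_right[OF iB(2)]]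
        Bochner_Integration.integral_add[OF iB'(1) integrable_mult_right[OF iB'(2)]]
        integral_mult_right_zero integral_complex_of_real C S)
  then show ?case using jI fJ unfolding pX_def pY_def sX_def sY_def by simp
qed

text \<open>The previous lemma with \<open>J = I\<close>: no exponential is left, and boxes form an
  intersection-stable generator of the product.\<close>

lemma distr_PiM_eqI_char:
  fixes X :: "'i \<Rightarrow> 'a \<Rightarrow> real" and Y :: "'i \<Rightarrow> 'b \<Rightarrow> real"
  assumes P: "prob_space P" and Q: "prob_space Q" and I: "finite I"
    and X[measurable]: "\<And>i. i \<in> I \<Longrightarrow> X i \<in> borel_measurable P"
    and Y[measurable]: "\<And>i. i \<in> I \<Longrightarrow> Y i \<in> borel_measurable Q"
    and char: "\<And>t. (\<integral>x. iexp (\<Sum>i\<in>I. t i * X i x) \<partial>P) = (\<integral>x. iexp (\<Sum>i\<in>I. t i * Y i x) \<partial>Q)"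
  shows "distr P (PiM I (\<lambda>_. borel)) (\<lambda>x. \<lambda>i\<in>I. X i x) = distr Q (PiM I (\<lambda>_. borel)) (\<lambda>x. \<lambda>i\<in>I. Y i x)"
    (is "?L = ?R")
proof -
  interpret P: prob_space P by fact
  interpret Q: prob_space Q by fact
  have mX[measurable]: "(\<lambda>x. \<lambda>i\<in>I. X i x) \<in> measurable P (PiM I (\<lambda>_. borel))" by (rule measurable_restrict) (rule X)
  have mY[measurable]: "(\<lambda>x. \<lambda>i\<in>I. Y i x) \<in> measurable Q (PiM I (\<lambda>_. borel))" by (rule measurable_restrict) (rule Y)
  interpret L: prob_space ?L by (rule P.prob_space_distr) fact
  interpret R: prob_space ?R by (rule Q.prob_space_distr) fact
  show ?thesis
  proof (rule measure_eqI_PiM_finite[OF I])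
    fix B :: "'i \<Rightarrow> real set" assume B: "\<And>i. i \<in> I \<Longrightarrow> B i \<in> sets borel"
    then have [measurable]: "Pi\<^sub>E I B \<in> sets (PiM I (\<lambda>_. borel))"
      using I by (intro sets_PiM_I_finite) auto
    have l: "measure ?L (Pi\<^sub>E I B) = (\<integral>x. (\<Prod>i\<in>I. indicator (B i) (X i x)) \<partial>P)"
    proof -
      have "measure ?L (Pi\<^sub>E I B) = measure P ((\<lambda>x. \<lambda>i\<in>I. X i x) -` Pi\<^sub>E I B \<inter> space P)"
        by (rule measure_distr) auto
      also have "\<dots> = (\<integral>x. indicator ((\<lambda>x. \<lambda>i\<in>I. X i x) -` Pi\<^sub>E I B \<inter> space P) x \<partial>P)" by simp
      also have "\<dots> = (\<integral>x. (\<Prod>i\<in>I. indicator (B i) (X i x)) \<partial>P)"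
        using I by (intro Bochner_Integration.integral_cong) (auto simp: indicator_def PiE_iff prod.neutral)
      finally show ?thesis .
    qed
    have r: "measure ?R (Pi\<^sub>E I B) = (\<integral>x. (\<Prod>i\<in>I. indicator (B i) (Y i x)) \<partial>Q)"
    proof -
      have "measure ?R (Pi\<^sub>E I B) = measure Q ((\<lambda>x. \<lambda>i\<in>I. Y i x) -` Pi\<^sub>E I B \<inter> space Q)"
        by (rule measure_distr) auto
      also have "\<dots> = (\<integral>x. indicator ((\<lambda>x. \<lambda>i\<in>I. Y i x) -` Pi\<^sub>E I B \<inter> space Q) x \<partial>Q)" by simp
      also have "\<dots> = (\<integral>x. (\<Prod>i\<in>I. indicator (B i) (Y i x)) \<partial>Q)"
        using I by (intro Bochner_Integration.integral_cong) (auto simp: indicator_def PiE_iff prod.neutral)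
      finally show ?thesis .
    qed
    have "complex_of_real (\<integral>x. (\<Prod>i\<in>I. indicator (B i) (X i x)) \<partial>P)
        = complex_of_real (\<integral>x. (\<Prod>i\<in>I. indicator (B i) (Y i x)) \<partial>Q)"
      using box_probabilities_from_char[where t = "\<lambda>_. 0", OF P Q I X Y char subset_refl B]
      by (simp only: Diff_cancel sum.empty of_real_0 mult_zero_right exp_zero scaleR_conv_of_real
          mult_1_right integral_complex_of_real)
    then show "emeasure ?L (Pi\<^sub>E I B) = emeasure ?R (Pi\<^sub>E I B)"
      by (simp only: of_real_eq_iff L.emeasure_eq_measure R.emeasure_eq_measure l r)
  next
    show "range (\<lambda>_::nat. space (PiM I (\<lambda>_. borel :: real measure))) \<subseteq> prod_algebra I (\<lambda>_. borel)"
      using I by (auto intro!: prod_algebraI_finite simp: space_PiM)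
  qed (simp_all add: space_PiM)
qed

subsection \<open>Exponential sums and Gaussian noise\<close>

lemma integrable_std_normal_exp: "integrable std_normal_distribution (\<lambda>x. exp (r * x))"
  and integral_std_normal_exp: "(\<integral>x. exp (r * x) \<partial>std_normal_distribution) = exp (r\<^sup>2 / 2)"
proof -
  have *: "std_normal_density x *\<^sub>R exp (r * x) = exp (r\<^sup>2 / 2) * normal_density r 1 x" for x
  proof -
    have "- x\<^sup>2 / 2 + r * x = r\<^sup>2 / 2 + (- (x - r)\<^sup>2 / 2)" by (simp add: power2_eq_square field_simps)
    then have "exp (- x\<^sup>2 / 2) * exp (r * x) = exp (r\<^sup>2 / 2) * exp (- (x - r)\<^sup>2 / 2)"
      by (simp flip: exp_add)
    then show ?thesis by (simp add: normal_density_def)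
  qed
  show "integrable std_normal_distribution (\<lambda>x. exp (r * x))"
    by (subst integrable_density) (auto simp del: real_scaleR_def simp add: *)
  show "(\<integral>x. exp (r * x) \<partial>std_normal_distribution) = exp (r\<^sup>2 / 2)"
    by (subst integral_density) (auto simp del: real_scaleR_def simp add: *)
qed

lemma integral_std_normal_iexp:
  "(\<integral>x. iexp (r * x) \<partial>std_normal_distribution) = complex_of_real (exp (- r\<^sup>2 / 2))"
  using fun_cong[OF char_std_normal_distribution, of r] by (simp add: char_def)

lemma prob_space_std_normal: "prob_space std_normal_distribution"
  by (rule prob_space_normal_density) simp

text \<open>Everything is expressed through the second moment, so that variables vanishing almost
  surely need no separate treatment later.\<close>

lemma (in prob_space) centered_gaussian_rv_moments:
  assumes "centered_gaussian_rv M Y"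
  shows "integrable M (\<lambda>x. (Y x)\<^sup>2)"
    and "(\<integral>x. iexp (Y x) \<partial>M) = complex_of_real (exp (- (\<integral>x. (Y x)\<^sup>2 \<partial>M) / 2))"
    and "integrable M (\<lambda>x. exp (Y x))"
    and "(\<integral>x. exp (Y x) \<partial>M) = exp ((\<integral>x. (Y x)\<^sup>2 \<partial>M) / 2)"
    and "(\<integral>x. Y x \<partial>M) = 0"
proof -
  have "integrable M (\<lambda>x. (Y x)\<^sup>2) \<and>
    (\<integral>x. iexp (Y x) \<partial>M) = complex_of_real (exp (- (\<integral>x. (Y x)\<^sup>2 \<partial>M) / 2)) \<and>
    integrable M (\<lambda>x. exp (Y x)) \<and>
    (\<integral>x. exp (Y x) \<partial>M) = exp ((\<integral>x. (Y x)\<^sup>2 \<partial>M) / 2) \<and> (\<integral>x. Y x \<partial>M) = 0"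
    using assms unfolding centered_gaussian_rv_def
  proof (elim disjE exE conjE)
    fix \<sigma> :: real assume \<sigma>: "\<sigma> > 0" and "distributed M lborel Y (\<lambda>y. ennreal (normal_density 0 \<sigma> y))"
    then have D: "distributed M lborel (\<lambda>x. Y x / \<sigma>) (\<lambda>y. ennreal (std_normal_density y))"
      by (subst (asm) normal_standard_normal_convert) auto
    define Z where "Z = (\<lambda>x. Y x / \<sigma>)"
    have [measurable]: "Z \<in> borel_measurable M"
      using distributed_measurable[OF D] by (simp add: Z_def)
    have dd: "distr M borel Z = std_normal_distribution"
      using distributed_distr_eq_density[OF D] by (simp add: Z_def cong: distr_cong)
    have Y: "Y x = \<sigma> * Z x" for x using \<sigma> by (simp add: Z_def)
    have i: "integrable M (\<lambda>x. f (Z x))" if "integrable std_normal_distribution f"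
      and [measurable]: "f \<in> borel_measurable borel" for f :: "real \<Rightarrow> real"
      using that(1) unfolding dd[symmetric] by (subst (asm) integrable_distr_eq) auto
    have e: "(\<integral>x. f (Z x) \<partial>M) = (\<integral>x. f x \<partial>std_normal_distribution)"
      if [measurable]: "f \<in> borel_measurable borel" for f :: "real \<Rightarrow> 'z::{banach, second_countable_topology}"
      unfolding dd[symmetric] by (subst integral_distr) auto
    have v: "(\<integral>x. (Y x)\<^sup>2 \<partial>M) = \<sigma>\<^sup>2"
    proof -
      have "(\<integral>x. (Z x)\<^sup>2 \<partial>M) = 1"
        using e[of "\<lambda>x. x^2"] std_normal_distribution_even_moments(1)[of 1] by (simp add: fact_numeral)
      then show ?thesis unfolding Y by (simp add: power_mult_distrib)
    qed
    have "integrable M (\<lambda>x. (Z x)\<^sup>2)"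
      by (rule i[OF integrable_std_normal_distribution_moment]) simp
    then have "integrable M (\<lambda>x. (Y x)\<^sup>2)" unfolding Y by (simp add: power_mult_distrib)
    moreover have "(\<integral>x. iexp (\<sigma> * Z x) \<partial>M) = complex_of_real (exp (- \<sigma>\<^sup>2 / 2))"
      by (subst e[of "\<lambda>x. iexp (\<sigma> * x)"]) (simp, rule integral_std_normal_iexp)
    moreover have "integrable M (\<lambda>x. exp (\<sigma> * Z x))"
      by (rule i[OF integrable_std_normal_exp]) simp
    moreover have "(\<integral>x. exp (\<sigma> * Z x) \<partial>M) = exp (\<sigma>\<^sup>2 / 2)"
      by (subst e[of "\<lambda>x. exp (\<sigma> * x)"]) (simp, rule integral_std_normal_exp)
    moreover have "(\<integral>x. Z x \<partial>M) = 0"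
      using e[of "\<lambda>x. x"] integral_std_normal_distribution_moment_odd[of 1] by simp
    then have "(\<integral>x. \<sigma> * Z x \<partial>M) = 0" by simp
    ultimately show ?thesis unfolding v unfolding Y by blast
  next
    assume [measurable]: "Y \<in> borel_measurable M" and ae: "AE x in M. Y x = 0"
    have 1: "(\<integral>x. f (Y x) \<partial>M) = f 0" if [measurable]: "f \<in> borel_measurable borel"
      for f :: "real \<Rightarrow> 'z::{banach, second_countable_topology}"
    proof -
      have "(\<integral>x. f (Y x) \<partial>M) = (\<integral>x. f 0 \<partial>M)"
        by (rule integral_cong_AE) (use ae in auto)
      then show ?thesis by (simp add: prob_space)
    qed
    have 2: "integrable M (\<lambda>x. f (Y x))" if [measurable]: "f \<in> borel_measurable borel" for f :: "real \<Rightarrow> real"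
      by (rule integrable_const_bound[where B = "\<bar>f 0\<bar>"]) (use ae in auto)
    show ?thesis
      using 1[of "\<lambda>x. x^2"] 1[of iexp] 1[of exp] 1[of "\<lambda>x. x"] 2[of "\<lambda>x. x^2"] 2[of exp] by simp
  qed
  then show "integrable M (\<lambda>x. (Y x)\<^sup>2)"
    "(\<integral>x. iexp (Y x) \<partial>M) = complex_of_real (exp (- (\<integral>x. (Y x)\<^sup>2 \<partial>M) / 2))"
    "integrable M (\<lambda>x. exp (Y x))"
    "(\<integral>x. exp (Y x) \<partial>M) = exp ((\<integral>x. (Y x)\<^sup>2 \<partial>M) / 2)" "(\<integral>x. Y x \<partial>M) = 0"
    by auto
qed

section \<open>Independent Gaussian noise and its effect on exponential sums\<close>

abbreviation normal_noise :: "'k set \<Rightarrow> ('k \<Rightarrow> real) measure" where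
  "normal_noise K \<equiv> PiM K (\<lambda>_. std_normal_distribution)"

lemma prob_space_normal_noise: "prob_space (normal_noise K)"
  by (intro prob_space_PiM prob_space_std_normal)

lemma
  assumes K: "finite K"
  shows integrable_normal_noise_exp: "integrable (normal_noise K) (\<lambda>g. exp (\<Sum>k\<in>K. r k * g k))"
    and integral_normal_noise_exp: "(\<integral>g. exp (\<Sum>k\<in>K. r k * g k) \<partial>normal_noise K) = exp ((\<Sum>k\<in>K. (r k)\<^sup>2) / 2)"
    and integral_normal_noise_iexp: "(\<integral>g. iexp (\<Sum>k\<in>K. r k * g k) \<partial>normal_noise K)
        = complex_of_real (exp (- (\<Sum>k\<in>K. (r k)\<^sup>2) / 2))"
proof -
  interpret product_prob_space "\<lambda>_. std_normal_distribution" K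
    by (simp add: product_prob_space_def product_prob_space_axioms_def product_sigma_finite_def
        prob_space_std_normal prob_space_imp_sigma_finite)
  have e: "exp (\<Sum>k\<in>K. r k * g k) = (\<Prod>k\<in>K. exp (r k * g k))" for g
    by (rule exp_sum[OF K])
  have ie: "iexp (\<Sum>k\<in>K. r k * g k) = (\<Prod>k\<in>K. iexp (r k * g k))" for g
    by (simp add: sum_distrib_left exp_sum[OF K])
  show "integrable (normal_noise K) (\<lambda>g. exp (\<Sum>k\<in>K. r k * g k))"
    unfolding e by (rule product_integrable_prod[OF K integrable_std_normal_exp])
  have "(\<integral>g. exp (\<Sum>k\<in>K. r k * g k) \<partial>normal_noise K) = (\<Prod>k\<in>K. exp ((r k)\<^sup>2 / 2))"
    unfolding e using product_integral_prod[OF K integrable_std_normal_exp, of "r"]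
    by (simp only: integral_std_normal_exp)
  then show "(\<integral>g. exp (\<Sum>k\<in>K. r k * g k) \<partial>normal_noise K) = exp ((\<Sum>k\<in>K. (r k)\<^sup>2) / 2)"
    using K by (simp add: sum_divide_distrib exp_sum)
  have ii: "integrable std_normal_distribution (\<lambda>x. iexp (c * x))" for c
  proof -
    show ?thesis by (rule finite_measure.integrable_const_bound[OF prob_space.finite_measure[OF prob_space_std_normal], where B = 1]) auto
  qed
  have "(\<integral>g. iexp (\<Sum>k\<in>K. r k * g k) \<partial>normal_noise K) = (\<Prod>k\<in>K. complex_of_real (exp (- (r k)\<^sup>2 / 2)))"
    unfolding ie using product_integral_prod[OF K ii, of "r"]
    by (simp only: integral_std_normal_iexp)
  moreover have "(\<Sum>k\<in>K. - (r k)\<^sup>2 / 2) = - (\<Sum>k\<in>K. (r k)\<^sup>2) / 2"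
    by (simp add: sum_negf sum_divide_distrib)
  ultimately show "(\<integral>g. iexp (\<Sum>k\<in>K. r k * g k) \<partial>normal_noise K)
        = complex_of_real (exp (- (\<Sum>k\<in>K. (r k)\<^sup>2) / 2))"
    by (simp only: of_real_prod[symmetric] exp_sum[OF K, symmetric])
qed

lemma pair_prob_integral_mult:
  fixes f :: "'a \<Rightarrow> complex" and g :: "'b \<Rightarrow> complex"
  assumes P: "prob_space P" and R: "prob_space R"
    and [measurable]: "f \<in> borel_measurable P" "g \<in> borel_measurable R"
    and b: "\<And>x. norm (f x) \<le> 1" "\<And>y. norm (g y) \<le> 1"
  shows "(\<integral>z. f (fst z) * g (snd z) \<partial>(P \<Otimes>\<^sub>M R)) = (\<integral>x. f x \<partial>P) * (\<integral>y. g y \<partial>R)"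
proof -
  interpret PP: prob_space P by fact
  interpret RR: prob_space R by fact
  interpret PR: pair_prob_space P R ..
  have "integrable (P \<Otimes>\<^sub>M R) (\<lambda>z. f (fst z) * g (snd z))"
    by (rule PR.P.integrable_const_bound[where B = 1]) (use b in \<open>auto simp: norm_mult intro!: mult_le_one\<close>)
  from PR.integral_fst'[OF this] show ?thesis by simp
qed

text \<open>Positive combinations of exponentials of coordinate sums. Reciprocals of partition functions
  are negative powers of such functions, and the class is closed under products.\<close>

definition expsum :: "'i set \<Rightarrow> ('i \<Rightarrow> real) \<Rightarrow> ('i \<Rightarrow> nat set) \<Rightarrow> (nat \<Rightarrow> real) \<Rightarrow> real" where
  "expsum I c s x = (\<Sum>i\<in>I. c i * exp (\<Sum>a\<in>s i. x a))"

lemma expsum_pos: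
  "finite I \<Longrightarrow> I \<noteq> {} \<Longrightarrow> (\<And>i. i \<in> I \<Longrightarrow> c i > 0) \<Longrightarrow> expsum I c s x > 0"
  unfolding expsum_def by (intro sum_pos) auto

lemma expsum_cong: "(\<And>i a. i \<in> I \<Longrightarrow> a \<in> s i \<Longrightarrow> x a = y a) \<Longrightarrow> expsum I c s x = expsum I c s y"
  unfolding expsum_def by (auto intro!: sum.cong)

lemma expsum_measurable:
  assumes "\<And>i a. i \<in> I \<Longrightarrow> a \<in> s i \<Longrightarrow> (\<lambda>x. X x a) \<in> borel_measurable N"
  shows "(\<lambda>x. expsum I c s (X x)) \<in> borel_measurable N"
  unfolding expsum_def
  by (intro borel_measurable_sum borel_measurable_times borel_measurable_const
      borel_measurable_exp[THEN measurable_compose[rotated]] assms) auto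

lemma expsum_mult:
  assumes "finite A" "finite B" "A \<inter> B = {}"
    and "\<And>i. i \<in> I \<Longrightarrow> s i \<subseteq> A" "\<And>j. j \<in> J \<Longrightarrow> s' j \<subseteq> B"
  shows "expsum I c s x * expsum J c' s' x
    = expsum (I \<times> J) (\<lambda>(i, j). c i * c' j) (\<lambda>(i, j). s i \<union> s' j) x"
proof -
  have "c i * exp (\<Sum>a\<in>s i. x a) * (c' j * exp (\<Sum>a\<in>s' j. x a)) = c i * c' j * exp (\<Sum>a\<in>s i \<union> s' j. x a)"
    if "i \<in> I" "j \<in> J" for i j
  proof -
    have "s i \<subseteq> A" "s' j \<subseteq> B" using assms that by auto
    then have "(\<Sum>a\<in>s i \<union> s' j. x a) = (\<Sum>a\<in>s i. x a) + (\<Sum>a\<in>s' j. x a)"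
      using assms(1-3) by (intro sum.union_disjoint) (auto intro: finite_subset)
    then show ?thesis by (simp add: exp_add)
  qed
  then show ?thesis
    unfolding expsum_def sum_product sum.cartesian_product by (intro sum.cong) auto
qed

text \<open>Meant for tangent-line minorants \<open>g\<close>, which take negative values; the
  comparison goes through the positive part.\<close>

lemma ennreal_integral_le_nn_integral:
  fixes f g :: "'a \<Rightarrow> real"
  assumes "integrable M g" "\<And>x. g x \<le> f x"
  shows "ennreal (\<integral>x. g x \<partial>M) \<le> (\<integral>\<^sup>+x. ennreal (f x) \<partial>M)"
proof -
  have "(\<integral>x. g x \<partial>M) \<le> (\<integral>x. max 0 (g x) \<partial>M)" using assms(1) by (intro integral_mono) auto
  then have "ennreal (\<integral>x. g x \<partial>M) \<le> ennreal (\<integral>x. max 0 (g x) \<partial>M)" by (rule ennreal_leI)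
  also have "\<dots> = (\<integral>\<^sup>+x. ennreal (max 0 (g x)) \<partial>M)"
    by (rule nn_integral_eq_integral[symmetric]) (use assms(1) in auto)
  also have "\<dots> \<le> (\<integral>\<^sup>+x. ennreal (f x) \<partial>M)"
  proof (rule nn_integral_mono)
    show "ennreal (max 0 (g x)) \<le> ennreal (f x)" for x
    proof (cases "g x \<ge> 0")
      case True
      then show ?thesis using assms(2)[of x] by (intro ennreal_leI) auto
    qed (simp add: max_absorb1)
  qed
  finally show ?thesis .
qed

lemma noise_linear_sum:
  fixes L :: "nat \<Rightarrow> 'k \<Rightarrow> real"
  shows "(\<Sum>a\<in>S. v a * (\<Sum>k\<in>K. L a k * g k)) = (\<Sum>k\<in>K. (\<Sum>a\<in>S. v a * L a k) * g k)"
  unfolding sum_distrib_left sum_distrib_right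
  by (subst sum.swap) (simp add: mult.assoc)

text \<open>Jensen's inequality for the convex function \<open>y powr - \<theta>\<close>. The noise
  in each exponent has variance at most \<open>2 * d\<close>, so the mean of the noisy sum is at
  most \<open>m = exp d * H\<close>. The tangent is taken at \<open>m\<close> instead of the mean
  itself; it is decreasing, so this only helps.\<close>

lemma expsum_powr_noise_lower:
  fixes L :: "nat \<Rightarrow> 'k \<Rightarrow> real"
  assumes I: "finite I" "I \<noteq> {}" and c: "\<And>i. i \<in> I \<Longrightarrow> c i > 0" and K: "finite K" and \<theta>: "\<theta> > 0"
    and L: "\<And>i. i \<in> I \<Longrightarrow> (\<Sum>k\<in>K. (\<Sum>a\<in>s i. L a k)\<^sup>2) \<le> 2 * d"
  shows "ennreal (exp (- \<theta> * d)) * ennreal (expsum I c s x powr - \<theta>)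
    \<le> (\<integral>\<^sup>+g. ennreal (expsum I c s (\<lambda>a. x a + (\<Sum>k\<in>K. L a k * g k)) powr - \<theta>) \<partial>normal_noise K)"
proof -
  define H where "H = expsum I c s x"
  have H: "H > 0" unfolding H_def by (rule expsum_pos) (use I c in auto)
  define m where "m = exp d * H"
  have m: "m > 0" using H by (simp add: m_def)
  define Y where "Y g = expsum I c s (\<lambda>a. x a + (\<Sum>k\<in>K. L a k * g k))" for g :: "'k \<Rightarrow> real"
  have Ypos: "Y g > 0" for g unfolding Y_def by (rule expsum_pos) (use I c in auto)
  have Y_eq: "Y g = (\<Sum>i\<in>I. (c i * exp (\<Sum>a\<in>s i. x a)) * exp (\<Sum>k\<in>K. (\<Sum>a\<in>s i. L a k) * g k))" for g
    unfolding Y_def expsum_def sum.distrib exp_add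
    using noise_linear_sum[where v = "\<lambda>_. 1"] by (intro sum.cong) auto
  have Yi: "integrable (normal_noise K) Y"
    unfolding Y_eq[abs_def] by (intro Bochner_Integration.integrable_sum integrable_mult_right integrable_normal_noise_exp K)
  have "(\<integral>g. Y g \<partial>normal_noise K)
      = (\<Sum>i\<in>I. (c i * exp (\<Sum>a\<in>s i. x a)) * exp ((\<Sum>k\<in>K. (\<Sum>a\<in>s i. L a k)\<^sup>2) / 2))"
    unfolding Y_eq
    by (simp only: Bochner_Integration.integral_sum[OF integrable_mult_right[OF integrable_normal_noise_exp[OF K]]]
        integral_mult_right_zero integral_normal_noise_exp[OF K])
  also have "\<dots> \<le> (\<Sum>i\<in>I. (c i * exp (\<Sum>a\<in>s i. x a)) * exp d)"
  proof (intro sum_mono mult_left_mono)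
    show "exp ((\<Sum>k\<in>K. (\<Sum>a\<in>s i. L a k)\<^sup>2) / 2) \<le> exp d" if "i \<in> I" for i
      using L[OF that] by simp
  qed (use c in \<open>auto simp: less_imp_le\<close>)
  also have "\<dots> = m" unfolding m_def H_def expsum_def by (simp add: sum_distrib_left mult_ac)
  finally have EY: "(\<integral>g. Y g \<partial>normal_noise K) \<le> m" .
  interpret prob_space "normal_noise K" by (rule prob_space_normal_noise)
  have "m powr - \<theta> \<le> m powr - \<theta> * (1 + \<theta> - \<theta> * ((\<integral>g. Y g \<partial>normal_noise K) / m))"
  proof -
    have "(\<integral>g. Y g \<partial>normal_noise K) / m \<le> 1" using EY m by simp
    then have "\<theta> * ((\<integral>g. Y g \<partial>normal_noise K) / m) \<le> \<theta> * 1" using \<theta> by (intro mult_left_mono) auto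
    then show ?thesis using m by (simp add: mult_le_cancel_left)
  qed
  also have "\<dots> = (\<integral>g. m powr - \<theta> * (1 + \<theta> - \<theta> * (Y g / m)) \<partial>normal_noise K)"
    using Yi by (simp add: prob_space)
  finally have "ennreal (m powr - \<theta>) \<le> ennreal \<dots>" by (rule ennreal_leI)
  also have "\<dots> \<le> (\<integral>\<^sup>+g. ennreal (Y g powr - \<theta>) \<partial>normal_noise K)"
  proof (rule ennreal_integral_le_nn_integral)
    show "integrable (normal_noise K) (\<lambda>g. m powr - \<theta> * (1 + \<theta> - \<theta> * (Y g / m)))"
      using Yi by simp
    show "m powr - \<theta> * (1 + \<theta> - \<theta> * (Y g / m)) \<le> Y g powr - \<theta>" for g
    proof -
      \<comment> \<open>The tangent of \<open>y powr - \<theta>\<close> at 1 comes from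
        \<open>ln y \<le> y - 1\<close> followed by \<open>1 + z \<le> exp z\<close> with
        \<open>z = - \<theta> * ln y\<close>.\<close>
      define y where "y = Y g / m"
      have y: "y > 0" using Ypos m by (simp add: y_def)
      have "1 + \<theta> - \<theta> * y \<le> 1 + (- \<theta> * ln y)"
        using mult_left_mono[OF ln_le_minus_one[OF y], of \<theta>] \<theta> by (simp add: algebra_simps)
      also have "\<dots> \<le> exp (- \<theta> * ln y)" by (rule exp_ge_add_one_self)
      also have "\<dots> = y powr - \<theta>" using y by (simp add: powr_def)
      finally have "m powr - \<theta> * (1 + \<theta> - \<theta> * y) \<le> m powr - \<theta> * y powr - \<theta>" by (intro mult_left_mono) auto
      also have "\<dots> = Y g powr - \<theta>" using m y Ypos[of g] by (simp flip: powr_mult add: y_def)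
      finally show ?thesis by (simp add: y_def)
    qed
  qed
  finally have "ennreal (m powr - \<theta>) \<le> (\<integral>\<^sup>+g. ennreal (Y g powr - \<theta>) \<partial>normal_noise K)" .
  moreover have "m powr - \<theta> = exp (- \<theta> * d) * H powr - \<theta>"
    unfolding m_def using H by (simp add: powr_mult) (simp add: powr_def)
  ultimately show ?thesis unfolding Y_def H_def by (simp add: ennreal_mult)
qed

text \<open>Jensen's inequality for the exponential. Under the Gibbs weights \<open>q\<close> of the
  unperturbed sum, the noisy sum is at least \<open>H * exp mm\<close>, where \<open>mm\<close> is
  the \<open>q\<close>-mean of the noise, and \<open>mm\<close> is a single centered Gaussian of
  variance at most \<open>4 * d\<close>. Its exponential moment of order \<open>- \<theta>\<close>
  is at most \<open>exp (2 * \<theta>\<^sup>2 * d)\<close>, and \<open>\<theta> \<le> 1\<close>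
  makes the exponent linear in \<open>\<theta>\<close>.\<close>

lemma expsum_powr_noise_upper:
  fixes L :: "nat \<Rightarrow> 'k \<Rightarrow> real"
  assumes I: "finite I" "I \<noteq> {}" and c: "\<And>i. i \<in> I \<Longrightarrow> c i > 0" and K: "finite K" and \<theta>: "0 < \<theta>" "\<theta> \<le> 1"
    and C: "finite C" "\<And>i. i \<in> I \<Longrightarrow> s i \<subseteq> C"
    and L: "\<And>v. (\<And>a. v a \<in> {0..1}) \<Longrightarrow> (\<Sum>k\<in>K. (\<Sum>a\<in>C. v a * L a k)\<^sup>2) \<le> 4 * d"
  shows "(\<integral>\<^sup>+g. ennreal (expsum I c s (\<lambda>a. x a + (\<Sum>k\<in>K. L a k * g k)) powr - \<theta>) \<partial>normal_noise K)
    \<le> ennreal (exp (2 * \<theta> * d)) * ennreal (expsum I c s x powr - \<theta>)"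
proof -
  define H where "H = expsum I c s x"
  have H: "H > 0" unfolding H_def by (rule expsum_pos) (use I c in auto)
  define q where "q i = c i * exp (\<Sum>a\<in>s i. x a) / H" for i
  have q: "q i > 0" if "i \<in> I" for i using c that H by (simp add: q_def)
  have q1: "(\<Sum>i\<in>I. q i) = 1" unfolding q_def using H by (simp add: H_def expsum_def flip: sum_divide_distrib)
  \<comment> \<open>\<open>v a\<close> is the \<open>q\<close>-probability that the random set
    \<open>s i\<close> contains \<open>a\<close>. It depends on \<open>x\<close>, which is why the
    variance hypothesis is uniform over all coefficients in \<open>{0..1}\<close>.\<close>
  define v where "v a = (\<Sum>i\<in>I. q i * indicator (s i) a)" for a
  have v: "v a \<in> {0..1}" for a
  proof -
    have "v a \<le> (\<Sum>i\<in>I. q i)" unfolding v_def by (intro sum_mono) (auto simp: indicator_def less_imp_le q)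
    moreover have "v a \<ge> 0" unfolding v_def by (intro sum_nonneg) (auto simp: indicator_def less_imp_le q)
    ultimately show ?thesis using q1 by auto
  qed
  define r where "r k = - \<theta> * (\<Sum>a\<in>C. v a * L a k)" for k
  have key: "expsum I c s (\<lambda>a. x a + (\<Sum>k\<in>K. L a k * g k)) powr - \<theta> \<le> H powr - \<theta> * exp (\<Sum>k\<in>K. r k * g k)" for g
  proof -
    define \<xi> where "\<xi> a = (\<Sum>k\<in>K. L a k * g k)" for a
    define u where "u i = (\<Sum>a\<in>s i. \<xi> a)" for i
    define mm where "mm = (\<Sum>i\<in>I. q i * u i)"
    have u: "u i = (\<Sum>a\<in>C. indicator (s i) a * \<xi> a)" if "i \<in> I" for i
      unfolding u_def using C(1) C(2)[OF that] by (intro sum.mono_neutral_cong_left) (auto simp: indicator_def)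
    have "mm = (\<Sum>i\<in>I. q i * (\<Sum>a\<in>C. indicator (s i) a * \<xi> a))"
      unfolding mm_def using u by (intro sum.cong) auto
    also have "\<dots> = (\<Sum>a\<in>C. v a * \<xi> a)"
      unfolding v_def sum_distrib_left sum_distrib_right by (subst sum.swap) (simp add: mult_ac)
    also have "\<dots> = (\<Sum>k\<in>K. (\<Sum>a\<in>C. v a * L a k) * g k)" unfolding \<xi>_def by (rule noise_linear_sum)
    finally have mm: "(\<Sum>k\<in>K. r k * g k) = - \<theta> * mm" unfolding r_def by (simp add: sum_distrib_left mult_ac)
    have "exp mm = exp mm * (\<Sum>i\<in>I. q i * (1 + (u i - mm)))"
    proof -
      have "(\<Sum>i\<in>I. q i * (1 + (u i - mm))) = (\<Sum>i\<in>I. q i) + (\<Sum>i\<in>I. q i * u i) - (\<Sum>i\<in>I. q i) * mm"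
        unfolding sum_distrib_right by (simp add: sum.distrib sum_subtractf algebra_simps)
      then show ?thesis using q1 by (simp add: mm_def)
    qed
    also have "\<dots> \<le> exp mm * (\<Sum>i\<in>I. q i * exp (u i - mm))"
      using q by (intro mult_left_mono sum_mono exp_ge_add_one_self) (auto simp: less_imp_le)
    also have "\<dots> = (\<Sum>i\<in>I. q i * exp (u i))" by (simp add: sum_distrib_left exp_diff field_simps)
    finally have jen: "H * exp mm \<le> H * (\<Sum>i\<in>I. q i * exp (u i))" using H by simp
    also have "\<dots> = expsum I c s (\<lambda>a. x a + \<xi> a)"
      unfolding expsum_def u_def q_def using H
      by (simp add: sum_distrib_left sum.distrib exp_add field_simps)
    finally have "expsum I c s (\<lambda>a. x a + \<xi> a) powr - \<theta> \<le> (H * exp mm) powr - \<theta>"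
      using H \<theta> by (intro powr_mono2') auto
    also have "\<dots> = H powr - \<theta> * exp (- \<theta> * mm)" using H by (simp add: powr_mult) (simp add: powr_def)
    finally show ?thesis unfolding mm \<xi>_def .
  qed
  have "(\<integral>\<^sup>+g. ennreal (expsum I c s (\<lambda>a. x a + (\<Sum>k\<in>K. L a k * g k)) powr - \<theta>) \<partial>normal_noise K)
     \<le> (\<integral>\<^sup>+g. ennreal (H powr - \<theta> * exp (\<Sum>k\<in>K. r k * g k)) \<partial>normal_noise K)"
    by (intro nn_integral_mono ennreal_leI key)
  also have "\<dots> = ennreal (\<integral>g. H powr - \<theta> * exp (\<Sum>k\<in>K. r k * g k) \<partial>normal_noise K)"
    by (rule nn_integral_eq_integral) (auto intro!: integrable_mult_right integrable_normal_noise_exp K)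
  also have "(\<integral>g. H powr - \<theta> * exp (\<Sum>k\<in>K. r k * g k) \<partial>normal_noise K) = H powr - \<theta> * exp ((\<Sum>k\<in>K. (r k)\<^sup>2) / 2)"
    by (simp only: integral_mult_right_zero integral_normal_noise_exp[OF K])
  also have "ennreal \<dots> \<le> ennreal (H powr - \<theta> * exp (2 * \<theta> * d))"
  proof (intro ennreal_leI mult_left_mono)
    have Lv: "(\<Sum>k\<in>K. (\<Sum>a\<in>C. v a * L a k)\<^sup>2) \<le> 4 * d" using L[of v] v by blast
    have "0 \<le> (\<Sum>k\<in>K. (\<Sum>a\<in>C. v a * L a k)\<^sup>2)" by (intro sum_nonneg) auto
    then have d: "d \<ge> 0" using Lv by linarith
    have "(\<Sum>k\<in>K. (r k)\<^sup>2) = \<theta>\<^sup>2 * (\<Sum>k\<in>K. (\<Sum>a\<in>C. v a * L a k)\<^sup>2)"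
      by (simp add: r_def power_mult_distrib flip: sum_distrib_left)
    also have "\<dots> \<le> \<theta>\<^sup>2 * (4 * d)" using Lv by (intro mult_left_mono) auto
    also have "\<dots> \<le> \<theta> * (4 * d)" using \<theta> d by (intro mult_right_mono) (auto simp: power2_eq_square)
    finally show "exp ((\<Sum>k\<in>K. (r k)\<^sup>2) / 2) \<le> exp (2 * \<theta> * d)" by simp
  qed simp
  finally show ?thesis by (simp add: H_def ennreal_mult mult.commute)
qed

subsection \<open>Decoupling in a Gaussian environment\<close>

lemma measurable_noise_linear: "(\<lambda>g. \<Sum>k\<in>K. r k * g k) \<in> borel_measurable (normal_noise K)"
proof (intro borel_measurable_sum borel_measurable_times borel_measurable_const)
  fix k assume "k \<in> K"
  then have "(\<lambda>g. g k) \<in> measurable (normal_noise K) std_normal_distribution"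
    by (rule measurable_component_singleton)
  then show "(\<lambda>g. g k) \<in> borel_measurable (normal_noise K)" by simp
qed

lemma measurable_iexp_of: "f \<in> borel_measurable N \<Longrightarrow> (\<lambda>x. iexp (f x)) \<in> borel_measurable N"
  by measurable

lemma exp_half_add: "complex_of_real (exp (- v / 2)) * complex_of_real (exp (- w / 2)) = complex_of_real (exp (- (v + w) / 2))"
  by (simp only: of_real_mult[symmetric] exp_add[symmetric]) (simp add: add_divide_distrib diff_divide_distrib)

lemma norm_iexp_le: "norm (iexp x) \<le> 1" and norm_iexp_mult_le: "norm (iexp x * iexp y) \<le> 1"
  by (simp_all add: norm_mult)

locale gaussian_environment = prob_space Q for Q :: "(nat \<Rightarrow> real) measure" +
  assumes sets_Q: "sets Q = sets borel"
    and gauss: "centered_gaussian_sequence Q"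
    and stat: "stationary_sequence Q"
    and summ: "summable (\<lambda>a. \<bar>covariance Q a\<bar>)"
begin

lemma space_Q [simp]: "space Q = UNIV"
  using sets_eq_imp_space_eq[OF sets_Q] by simp

lemma measurable_coordinate [measurable]: "(\<lambda>\<omega>. \<omega> a) \<in> borel_measurable Q"
  unfolding measurable_cong_sets[OF sets_Q refl] by simp

lemma measurable_shift: "(\<lambda>\<omega> a. \<omega> (a + m)) \<in> measurable Q Q"
proof -
  have "(\<lambda>\<omega> a. \<omega> (a + m)) \<in> measurable Q (PiM UNIV (\<lambda>_. borel))"
    by (rule measurable_PiM_single') auto
  then show ?thesis by (simp add: sets_PiM_equal_borel measurable_cong_sets[OF refl sets_Q]
      measurable_cong_sets[OF refl sets_PiM_equal_borel])
qed

lemma distr_shift: "distr Q Q (\<lambda>\<omega> a. \<omega> (a + m)) = Q"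
proof (induction m)
  case 0
  then show ?case by (simp add: distr_id)
next
  case (Suc m)
  have "distr Q Q (\<lambda>\<omega> a. \<omega> (a + Suc m)) = distr Q Q ((\<lambda>\<omega> a. \<omega> (a + m)) \<circ> (\<lambda>\<omega> a. \<omega> (a + 1)))"
    by (simp add: comp_def)
  also have "\<dots> = distr (distr Q Q (\<lambda>\<omega> a. \<omega> (a + 1))) Q (\<lambda>\<omega> a. \<omega> (a + m))"
    by (rule distr_distr[symmetric]) (rule measurable_shift)+
  also have "distr Q Q (\<lambda>\<omega> a. \<omega> (a + 1)) = Q" using stat by (simp add: stationary_sequence_def)
  finally show ?case using Suc by simp
qed

lemma integral_shift:
  fixes F :: "(nat \<Rightarrow> real) \<Rightarrow> 'z::{banach, second_countable_topology}"
  assumes "F \<in> borel_measurable Q"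
  shows "(\<integral>\<omega>. F (\<lambda>a. \<omega> (a + m)) \<partial>Q) = (\<integral>\<omega>. F \<omega> \<partial>Q)"
  using integral_distr[OF measurable_shift[of m] assms] by (simp add: distr_shift)

lemma integrable_shift:
  fixes F :: "(nat \<Rightarrow> real) \<Rightarrow> 'z::{banach, second_countable_topology}"
  assumes "integrable Q F"
  shows "integrable Q (\<lambda>\<omega>. F (\<lambda>a. \<omega> (a + m)))"
  using integrable_distr[OF measurable_shift[of m], of F] assms by (simp add: distr_shift)

lemma gaussian_combination: "finite A \<Longrightarrow> centered_gaussian_rv Q (\<lambda>\<omega>. \<Sum>a\<in>A. c a * \<omega> a)"
  using gauss unfolding centered_gaussian_sequence_def by blast

definition cv :: "nat \<Rightarrow> nat \<Rightarrow> real" where "cv a b = (\<integral>\<omega>. \<omega> a * \<omega> b \<partial>Q)"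

lemma gaussian_coordinate: "centered_gaussian_rv Q (\<lambda>\<omega>. c * \<omega> a)"
  using gaussian_combination[of "{a}" "\<lambda>_. c"] by simp

lemma integrable_square: "integrable Q (\<lambda>\<omega>. (\<omega> a)\<^sup>2)"
  using centered_gaussian_rv_moments(1)[OF gaussian_coordinate[of 1 a]] by simp

lemma integrable_coordinate_mult: "integrable Q (\<lambda>\<omega>. \<omega> a * \<omega> b)"
proof (rule Bochner_Integration.integrable_bound)
  show "integrable Q (\<lambda>\<omega>. (\<omega> a)\<^sup>2 + (\<omega> b)\<^sup>2)" by (intro Bochner_Integration.integrable_add integrable_square)
  show "AE \<omega> in Q. norm (\<omega> a * \<omega> b) \<le> norm ((\<omega> a)\<^sup>2 + (\<omega> b)\<^sup>2)"
  proof (rule AE_I2)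
    fix \<omega> :: "nat \<Rightarrow> real"
    have "2 * \<bar>\<omega> a * \<omega> b\<bar> \<le> (\<omega> a)\<^sup>2 + (\<omega> b)\<^sup>2"
      using sum_squares_bound[of "\<bar>\<omega> a\<bar>" "\<bar>\<omega> b\<bar>"] by (simp add: abs_mult)
    then show "norm (\<omega> a * \<omega> b) \<le> norm ((\<omega> a)\<^sup>2 + (\<omega> b)\<^sup>2)" by simp
  qed
qed simp

lemma integral_coordinate [simp]: "(\<integral>\<omega>. \<omega> a \<partial>Q) = 0"
  using centered_gaussian_rv_moments(5)[OF gaussian_coordinate[of 1 a]] by simp

lemma integrable_coordinate [simp]: "integrable Q (\<lambda>\<omega>. \<omega> a)"
  by (rule square_integrable_imp_integrable) (auto intro: integrable_square)

lemma cv_covariance: "cv a b = covariance Q (if a \<le> b then b - a else a - b)"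
proof -
  have *: "cv a (d + a) = covariance Q d" for a d
  proof -
    have "(\<integral>\<omega>. (\<lambda>\<omega>. \<omega> 0 * \<omega> d) (\<lambda>i. \<omega> (i + a)) \<partial>Q) = (\<integral>\<omega>. \<omega> 0 * \<omega> d \<partial>Q)"
      by (rule integral_shift) simp
    then show ?thesis by (simp add: cv_def covariance_def)
  qed
  have "cv a b = cv b a" by (simp add: cv_def mult.commute)
  with *[of a "b - a"] *[of b "a - b"] show ?thesis by auto
qed

lemma variance_combination:
  assumes "finite A"
  shows "(\<integral>\<omega>. (\<Sum>a\<in>A. t a * \<omega> a)\<^sup>2 \<partial>Q) = (\<Sum>a\<in>A. \<Sum>b\<in>A. t a * t b * cv a b)"
proof -
  have "(\<Sum>a\<in>A. t a * \<omega> a)\<^sup>2 = (\<Sum>a\<in>A. \<Sum>b\<in>A. t a * t b * (\<omega> a * \<omega> b))" for \<omega> :: "nat \<Rightarrow> real"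
    unfolding power2_eq_square sum_product by (intro sum.cong) (auto simp: mult_ac)
  then show ?thesis
    by (simp add: cv_def integrable_coordinate_mult Bochner_Integration.integral_sum)
qed

lemma char_combination:
  assumes "finite A"
  shows "(\<integral>\<omega>. iexp (\<Sum>a\<in>A. t a * \<omega> a) \<partial>Q) = complex_of_real (exp (- (\<Sum>a\<in>A. \<Sum>b\<in>A. t a * t b * cv a b) / 2))"
  using centered_gaussian_rv_moments(2)[OF gaussian_combination[OF assms, of t]]
  unfolding variance_combination[OF assms] .

lemma exp_coordinate:
  "integrable Q (\<lambda>\<omega>. exp (r * \<omega> a))" "(\<integral>\<omega>. exp (r * \<omega> a) \<partial>Q) = exp (r\<^sup>2 * covariance Q 0 / 2)"
proof -
  show "integrable Q (\<lambda>\<omega>. exp (r * \<omega> a))"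
    by (rule centered_gaussian_rv_moments(3)[OF gaussian_coordinate])
  have "(\<integral>\<omega>. (r * \<omega> a)\<^sup>2 \<partial>Q) = r\<^sup>2 * cv a a"
    by (simp add: power_mult_distrib cv_def) (simp add: power2_eq_square)
  then show "(\<integral>\<omega>. exp (r * \<omega> a) \<partial>Q) = exp (r\<^sup>2 * covariance Q 0 / 2)"
    using centered_gaussian_rv_moments(4)[OF gaussian_coordinate[of r a]] by (simp add: cv_covariance)
qed

lemma covariance_0_nonneg: "covariance Q 0 \<ge> 0"
  unfolding covariance_def by (intro integral_nonneg_AE) auto

definition coupling :: "nat set \<Rightarrow> nat set \<Rightarrow> real" where
  "coupling A B = (\<Sum>a\<in>A. \<Sum>b\<in>B. \<bar>cv a b\<bar>)"

lemma char_noisy: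
  assumes C: "finite C" and K: "finite K"
  shows "(\<integral>z. iexp (\<Sum>a\<in>C. t a * (fst z a + (\<Sum>k\<in>K. L a k * snd z k))) \<partial>(Q \<Otimes>\<^sub>M normal_noise K))
    = complex_of_real (exp (- ((\<Sum>a\<in>C. \<Sum>b\<in>C. t a * t b * cv a b) + (\<Sum>k\<in>K. (\<Sum>a\<in>C. t a * L a k)\<^sup>2)) / 2))"
proof -
  have "iexp (\<Sum>a\<in>C. t a * (fst z a + (\<Sum>k\<in>K. L a k * snd z k)))
     = iexp (\<Sum>a\<in>C. t a * fst z a) * iexp (\<Sum>k\<in>K. (\<Sum>a\<in>C. t a * L a k) * snd z k)" for z
  proof -
    have "(\<Sum>a\<in>C. t a * (fst z a + (\<Sum>k\<in>K. L a k * snd z k)))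
        = (\<Sum>a\<in>C. t a * fst z a) + (\<Sum>k\<in>K. (\<Sum>a\<in>C. t a * L a k) * snd z k)"
      unfolding distrib_left sum.distrib noise_linear_sum ..
    then show ?thesis by (simp only: of_real_add distrib_left exp_add)
  qed
  then have "(\<integral>z. iexp (\<Sum>a\<in>C. t a * (fst z a + (\<Sum>k\<in>K. L a k * snd z k))) \<partial>(Q \<Otimes>\<^sub>M normal_noise K))
     = (\<integral>z. iexp (\<Sum>a\<in>C. t a * fst z a) * iexp (\<Sum>k\<in>K. (\<Sum>a\<in>C. t a * L a k) * snd z k) \<partial>(Q \<Otimes>\<^sub>M normal_noise K))"
    by simp
  also have "\<dots> = (\<integral>\<omega>. iexp (\<Sum>a\<in>C. t a * \<omega> a) \<partial>Q)
      * (\<integral>g. iexp (\<Sum>k\<in>K. (\<Sum>a\<in>C. t a * L a k) * g k) \<partial>normal_noise K)"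
    by (rule pair_prob_integral_mult[OF prob_space_axioms prob_space_normal_noise])
      (intro measurable_iexp_of measurable_noise_linear borel_measurable_sum borel_measurable_times
        borel_measurable_const measurable_coordinate norm_iexp_le)+
  also have "\<dots> = complex_of_real (exp (- ((\<Sum>a\<in>C. \<Sum>b\<in>C. t a * t b * cv a b) + (\<Sum>k\<in>K. (\<Sum>a\<in>C. t a * L a k)\<^sup>2)) / 2))"
    unfolding char_combination[OF C] integral_normal_noise_iexp[OF K]
    by (simp only: exp_half_add)
  finally show ?thesis .
qed

lemma char_noisy_independent:
  assumes A: "finite A" and B: "finite B" "A \<inter> B = {}" and K: "finite K"
  shows "(\<integral>z. iexp (\<Sum>a\<in>A \<union> B. t a * ((if a \<in> A then fst (fst z) a else snd (fst z) a) + (\<Sum>k\<in>K. L a k * snd z k)))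
        \<partial>((Q \<Otimes>\<^sub>M Q) \<Otimes>\<^sub>M normal_noise K))
    = complex_of_real (exp (- ((\<Sum>a\<in>A. \<Sum>b\<in>A. t a * t b * cv a b) + (\<Sum>a\<in>B. \<Sum>b\<in>B. t a * t b * cv a b)
        + (\<Sum>k\<in>K. (\<Sum>a\<in>A \<union> B. t a * L a k)\<^sup>2)) / 2))"
proof -
  interpret QQ: pair_prob_space Q Q ..
  let ?f = "\<lambda>w. iexp (\<Sum>a\<in>A. t a * fst w a) * iexp (\<Sum>a\<in>B. t a * snd w a)"
  have "iexp (\<Sum>a\<in>A \<union> B. t a * ((if a \<in> A then fst (fst z) a else snd (fst z) a) + (\<Sum>k\<in>K. L a k * snd z k)))
     = ?f (fst z) * iexp (\<Sum>k\<in>K. (\<Sum>a\<in>A \<union> B. t a * L a k) * snd z k)" for z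
  proof -
    have "(\<Sum>a\<in>A \<union> B. t a * ((if a \<in> A then fst (fst z) a else snd (fst z) a) + (\<Sum>k\<in>K. L a k * snd z k)))
      = (\<Sum>a\<in>A \<union> B. t a * (if a \<in> A then fst (fst z) a else snd (fst z) a)) + (\<Sum>k\<in>K. (\<Sum>a\<in>A \<union> B. t a * L a k) * snd z k)"
      unfolding distrib_left sum.distrib noise_linear_sum ..
    also have "(\<Sum>a\<in>A \<union> B. t a * (if a \<in> A then fst (fst z) a else snd (fst z) a))
       = (\<Sum>a\<in>A. t a * (if a \<in> A then fst (fst z) a else snd (fst z) a))
       + (\<Sum>a\<in>B. t a * (if a \<in> A then fst (fst z) a else snd (fst z) a))"
      using A B by (intro sum.union_disjoint) auto
    also have "(\<Sum>a\<in>A. t a * (if a \<in> A then fst (fst z) a else snd (fst z) a)) = (\<Sum>a\<in>A. t a * fst (fst z) a)"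
      by (intro sum.cong) auto
    also have "(\<Sum>a\<in>B. t a * (if a \<in> A then fst (fst z) a else snd (fst z) a)) = (\<Sum>a\<in>B. t a * snd (fst z) a)"
      using B by (intro sum.cong) auto
    finally show ?thesis by (simp only: of_real_add distrib_left exp_add)
  qed
  then have "(\<integral>z. iexp (\<Sum>a\<in>A \<union> B. t a * ((if a \<in> A then fst (fst z) a else snd (fst z) a) + (\<Sum>k\<in>K. L a k * snd z k)))
        \<partial>((Q \<Otimes>\<^sub>M Q) \<Otimes>\<^sub>M normal_noise K))
     = (\<integral>z. ?f (fst z) * iexp (\<Sum>k\<in>K. (\<Sum>a\<in>A \<union> B. t a * L a k) * snd z k) \<partial>((Q \<Otimes>\<^sub>M Q) \<Otimes>\<^sub>M normal_noise K))"
    by simp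
  also have "\<dots> = (\<integral>w. ?f w \<partial>(Q \<Otimes>\<^sub>M Q))
      * (\<integral>g. iexp (\<Sum>k\<in>K. (\<Sum>a\<in>A \<union> B. t a * L a k) * g k) \<partial>normal_noise K)"
    by (rule pair_prob_integral_mult[OF QQ.P.prob_space_axioms prob_space_normal_noise])
      (intro measurable_iexp_of measurable_noise_linear borel_measurable_sum borel_measurable_times
        borel_measurable_const measurable_fst'' measurable_snd'' measurable_coordinate norm_iexp_le norm_iexp_mult_le)+
  also have "(\<integral>w. ?f w \<partial>(Q \<Otimes>\<^sub>M Q)) = (\<integral>\<omega>. iexp (\<Sum>a\<in>A. t a * \<omega> a) \<partial>Q) * (\<integral>\<omega>. iexp (\<Sum>a\<in>B. t a * \<omega> a) \<partial>Q)"
    by (rule pair_prob_integral_mult[OF prob_space_axioms prob_space_axioms])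
      (intro measurable_iexp_of borel_measurable_sum borel_measurable_times
        borel_measurable_const measurable_coordinate norm_iexp_le)+
  also have "\<dots> * (\<integral>g. iexp (\<Sum>k\<in>K. (\<Sum>a\<in>A \<union> B. t a * L a k) * g k) \<partial>normal_noise K)
     = complex_of_real (exp (- ((\<Sum>a\<in>A. \<Sum>b\<in>A. t a * t b * cv a b) + (\<Sum>a\<in>B. \<Sum>b\<in>B. t a * t b * cv a b)
        + (\<Sum>k\<in>K. (\<Sum>a\<in>A \<union> B. t a * L a k)\<^sup>2)) / 2))"
    unfolding char_combination[OF A] char_combination[OF B(1)] integral_normal_noise_iexp[OF K]
    by (simp only: exp_half_add)
  finally show ?thesis .
qed

text \<open>The diagonally dominant matrix built from the cross covariances is the covariance of the noise
  \<open>L2\<close>, and its diagonal is the covariance of the noise \<open>L1\<close>; hence \<open>\<omega> + L1\<close> has the same law as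
  the noise \<open>L2\<close> added to two independent copies of the environment. Both noises have total variance
  of the order of the coupling.\<close>

lemma decoupling:
  fixes cA :: "'i \<Rightarrow> real" and cB :: "'j \<Rightarrow> real"
  assumes A: "finite A" and B: "finite B" and AB: "A \<inter> B = {}"
    and IA: "finite IA" "IA \<noteq> {}" "\<And>i. i \<in> IA \<Longrightarrow> cA i > 0" "\<And>i. i \<in> IA \<Longrightarrow> sA i \<subseteq> A"
    and IB: "finite IB" "IB \<noteq> {}" "\<And>i. i \<in> IB \<Longrightarrow> cB i > 0" "\<And>i. i \<in> IB \<Longrightarrow> sB i \<subseteq> B"
    and \<theta>: "0 < \<theta>" "\<theta> \<le> 1"
  shows "(\<integral>\<^sup>+\<omega>. ennreal (expsum IA cA sA \<omega> powr - \<theta> * expsum IB cB sB \<omega> powr - \<theta>) \<partial>Q)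
    \<le> ennreal (exp (3 * \<theta> * coupling A B)) * (\<integral>\<^sup>+\<omega>. ennreal (expsum IA cA sA \<omega> powr - \<theta>) \<partial>Q)
       * (\<integral>\<^sup>+\<omega>. ennreal (expsum IB cB sB \<omega> powr - \<theta>) \<partial>Q)"
proof -
  define C where "C = A \<union> B"
  have C: "finite C" using A B by (simp add: C_def)
  define d where "d = coupling A B"
  define I where "I = IA \<times> IB"
  define c where "c = (\<lambda>(i, j). cA i * cB j)"
  define s where "s = (\<lambda>(i, j). sA i \<union> sB j)"
  have s_sub: "s i \<subseteq> C" if "i \<in> I" for i
    using IA(4)[of "fst i"] IB(4)[of "snd i"] that by (auto simp: I_def s_def C_def)
  have c_pos: "c i > 0" if "i \<in> I" for i
    using IA(3)[of "fst i"] IB(3)[of "snd i"] that by (auto simp: I_def c_def)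
  have I0: "finite I" "I \<noteq> {}"
    using IA(1,2) IB(1,2) by (auto simp: I_def)
  note I = I0 c_pos s_sub
  \<comment> \<open>The two powers are merged into one power of a single exponential sum over pairs,
    the form required by both noise lemmas.\<close>
  define F where "F x = ennreal (expsum I c s x powr - \<theta>)" for x
  have F_eq: "F x = ennreal (expsum IA cA sA x powr - \<theta> * expsum IB cB sB x powr - \<theta>)" for x
  proof -
    have "expsum IA cA sA x > 0" "expsum IB cB sB x > 0" by (rule expsum_pos; use IA IB in auto)+
    moreover have "expsum IA cA sA x * expsum IB cB sB x = expsum I c s x"
      unfolding I_def c_def s_def by (rule expsum_mult[OF A B AB]) (use IA IB in auto)
    ultimately show ?thesis unfolding F_def by (simp flip: powr_mult)
  qed
  have F_cong: "F x = F y" if "\<And>a. a \<in> C \<Longrightarrow> x a = y a" for x y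
    unfolding F_def using expsum_cong[of I s x y c] I(4) that by (metis subsetD)
  have F_meas: "(\<lambda>x. F (X x)) \<in> borel_measurable N" if "\<And>a. a \<in> C \<Longrightarrow> (\<lambda>x. X x a) \<in> borel_measurable N" for X and N :: "'n measure"
  proof -
    have [measurable]: "(\<lambda>x. expsum I c s (X x)) \<in> borel_measurable N"
      by (rule expsum_measurable) (use that I(4) in auto)
    show ?thesis unfolding F_def by measurable
  qed
  define K1 where "K1 = A \<times> B \<times> (UNIV :: bool set)"
  define K2 where "K2 = A \<times> B"
  have K: "finite K1" "finite K2" using A B by (auto simp: K1_def K2_def)
  \<comment> \<open>Every pair \<open>(a, b)\<close> owns two independent variables of variance
    \<open>\<bar>cv a b\<bar>\<close>; the Boolean tells whether the variable is added at
    \<open>a\<close> or at \<open>b\<close>.\<close>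
  define L1 where "L1 e = (\<lambda>(a, b, u). if (if u then a else b) = e then sqrt \<bar>cv a b\<bar> else 0)" for e :: nat
  \<comment> \<open>Here a pair owns one variable, added at both sites with the sign of
    \<open>cv a b\<close>: the diagonal variances are those of \<open>L1\<close>, and the cross
    covariance is exactly \<open>cv a b\<close>.\<close>
  define L2 where "L2 e = (\<lambda>(a, b). (if a = e then sqrt \<bar>cv a b\<bar> else 0) + (if b = e then sgn (cv a b) * sqrt \<bar>cv a b\<bar> else 0))" for e :: nat
  have L1_sum: "(\<Sum>k\<in>K1. (\<Sum>e\<in>S. t e * L1 e k)\<^sup>2)
      = (\<Sum>a\<in>A. \<Sum>b\<in>B. (if a \<in> S then (t a)\<^sup>2 else 0) * \<bar>cv a b\<bar> + (if b \<in> S then (t b)\<^sup>2 else 0) * \<bar>cv a b\<bar>)"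
    if "finite S" for S t
  proof -
    have 1: "(\<Sum>e\<in>S. t e * L1 e (a, b, u)) = (if (if u then a else b) \<in> S then t (if u then a else b) * sqrt \<bar>cv a b\<bar> else 0)" for a b u
      using that by (simp add: L1_def if_distrib[of "\<lambda>x. _ * x"] cong: if_cong)
    show ?thesis
      unfolding K1_def sum.cartesian_product' 1
      by (intro sum.cong refl) (auto simp: UNIV_bool power_mult_distrib)
  qed
  have L2_sum: "(\<Sum>k\<in>K2. (\<Sum>e\<in>C. t e * L2 e k)\<^sup>2)
      = (\<Sum>a\<in>A. \<Sum>b\<in>B. ((t a)\<^sup>2 + (t b)\<^sup>2) * \<bar>cv a b\<bar> + 2 * (t a * t b * cv a b))" for t
  proof -
    have 1: "(\<Sum>e\<in>C. t e * L2 e (a, b)) = t a * sqrt \<bar>cv a b\<bar> + t b * (sgn (cv a b) * sqrt \<bar>cv a b\<bar>)" if "a \<in> A" "b \<in> B" for a b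
      using C that by (simp add: L2_def distrib_left sum.distrib if_distrib[of "\<lambda>x. _ * x"] C_def cong: if_cong)
    have 2: "(ta * sqrt \<bar>r\<bar> + tb * (sgn r * sqrt \<bar>r\<bar>))\<^sup>2 = (ta\<^sup>2 + tb\<^sup>2) * \<bar>r\<bar> + 2 * (ta * tb * r)" for ta tb r :: real
    proof -
      have "(ta * sqrt \<bar>r\<bar> + tb * (sgn r * sqrt \<bar>r\<bar>))\<^sup>2 = (sqrt \<bar>r\<bar>)\<^sup>2 * (ta + tb * sgn r)\<^sup>2"
        by (simp add: power2_eq_square algebra_simps)
      also have "\<dots> = \<bar>r\<bar> * (ta + tb * sgn r)\<^sup>2" by simp
      also have "\<dots> = (ta\<^sup>2 + tb\<^sup>2) * \<bar>r\<bar> + 2 * (ta * tb * r)"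
        by (cases r "0::real" rule: linorder_cases) (auto simp: power2_eq_square algebra_simps)
      finally show ?thesis .
    qed
    show ?thesis unfolding K2_def sum.cartesian_product' by (intro sum.cong refl) (simp add: 1 2)
  qed
  define P1 where "P1 = Q \<Otimes>\<^sub>M normal_noise K1"
  define P2 where "P2 = (Q \<Otimes>\<^sub>M Q) \<Otimes>\<^sub>M normal_noise K2"
  define X1 where "X1 a z = fst z a + (\<Sum>k\<in>K1. L1 a k * snd z k)" for a and z :: "(nat \<Rightarrow> real) \<times> (nat \<times> nat \<times> bool \<Rightarrow> real)"
  \<comment> \<open>One environment glued from two independent copies, the first on \<open>A\<close>
    and the second elsewhere.\<close>
  define mix where "mix w a = (if a \<in> A then fst w a else snd w a)" for w :: "(nat \<Rightarrow> real) \<times> (nat \<Rightarrow> real)" and a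
  define X2 where "X2 a z = mix (fst z) a + (\<Sum>k\<in>K2. L2 a k * snd z k)"
    for a and z :: "((nat \<Rightarrow> real) \<times> (nat \<Rightarrow> real)) \<times> (nat \<times> nat \<Rightarrow> real)"
  interpret W1: prob_space "normal_noise K1" by (rule prob_space_normal_noise)
  interpret W2: prob_space "normal_noise K2" by (rule prob_space_normal_noise)
  interpret QW: pair_prob_space Q "normal_noise K1" ..
  interpret QQ: pair_prob_space Q Q ..
  interpret QQW: pair_prob_space "Q \<Otimes>\<^sub>M Q" "normal_noise K2" ..
  have P1: "prob_space P1" unfolding P1_def by (rule QW.P.prob_space_axioms)
  have P2: "prob_space P2" unfolding P2_def by (rule QQW.P.prob_space_axioms)
  have mix_meas: "(\<lambda>w. mix w a) \<in> borel_measurable (Q \<Otimes>\<^sub>M Q)" for a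
    unfolding mix_def by (cases "a \<in> A") (auto intro: measurable_fst'' measurable_snd'')
  have X1_meas: "X1 a \<in> borel_measurable P1" for a
    unfolding X1_def[abs_def] P1_def
    by (intro borel_measurable_add measurable_fst''[OF measurable_coordinate] measurable_snd''[OF measurable_noise_linear])
  have X2_meas: "X2 a \<in> borel_measurable P2" for a
    unfolding X2_def[abs_def] P2_def
    by (intro borel_measurable_add measurable_fst''[OF mix_meas] measurable_snd''[OF measurable_noise_linear])
  have law: "distr P1 (PiM C (\<lambda>_. borel)) (\<lambda>x. \<lambda>a\<in>C. X1 a x) = distr P2 (PiM C (\<lambda>_. borel)) (\<lambda>x. \<lambda>a\<in>C. X2 a x)"
  proof (rule distr_PiM_eqI_char[OF P1 P2 C X1_meas X2_meas])
    fix t :: "nat \<Rightarrow> real"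
    have V: "(\<Sum>a\<in>C. \<Sum>b\<in>C. t a * t b * cv a b)
        = (\<Sum>a\<in>A. \<Sum>b\<in>A. t a * t b * cv a b) + (\<Sum>a\<in>B. \<Sum>b\<in>B. t a * t b * cv a b)
          + 2 * (\<Sum>a\<in>A. \<Sum>b\<in>B. t a * t b * cv a b)"
    proof -
      have "(\<Sum>a\<in>B. \<Sum>b\<in>A. t a * t b * cv a b) = (\<Sum>a\<in>A. \<Sum>b\<in>B. t a * t b * cv a b)"
        by (subst sum.swap) (simp add: cv_def mult_ac)
      then show ?thesis unfolding C_def by (simp add: sum.union_disjoint[OF A B AB] sum.distrib)
    qed
    have "(\<Sum>a\<in>C. \<Sum>b\<in>C. t a * t b * cv a b) + (\<Sum>k\<in>K1. (\<Sum>a\<in>C. t a * L1 a k)\<^sup>2)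
        = (\<Sum>a\<in>A. \<Sum>b\<in>A. t a * t b * cv a b) + (\<Sum>a\<in>B. \<Sum>b\<in>B. t a * t b * cv a b)
        + (\<Sum>k\<in>K2. (\<Sum>a\<in>A \<union> B. t a * L2 a k)\<^sup>2)"
    proof -
      have "(\<Sum>k\<in>K1. (\<Sum>a\<in>C. t a * L1 a k)\<^sup>2) = (\<Sum>a\<in>A. \<Sum>b\<in>B. ((t a)\<^sup>2 + (t b)\<^sup>2) * \<bar>cv a b\<bar>)"
        unfolding L1_sum[OF C] by (intro sum.cong refl) (auto simp: C_def distrib_right)
      then show ?thesis unfolding V C_def[symmetric] L2_sum by (simp add: sum.distrib sum_distrib_left)
    qed
    then show "(\<integral>x. iexp (\<Sum>a\<in>C. t a * X1 a x) \<partial>P1) = (\<integral>x. iexp (\<Sum>a\<in>C. t a * X2 a x) \<partial>P2)"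
      unfolding X1_def P1_def char_noisy[OF C K(1)]
      unfolding X2_def P2_def mix_def C_def char_noisy_independent[OF A B AB K(2)] by simp
  qed
  have restr: "(\<lambda>x. F x) \<in> borel_measurable (PiM C (\<lambda>_. borel))"
    by (rule F_meas) (rule measurable_component_singleton)
  have same: "(\<integral>\<^sup>+z. F (\<lambda>a. X1 a z) \<partial>P1) = (\<integral>\<^sup>+z. F (\<lambda>a. X2 a z) \<partial>P2)"
  proof -
    have "(\<integral>\<^sup>+z. F (\<lambda>a. X1 a z) \<partial>P1) = (\<integral>\<^sup>+z. F (\<lambda>a\<in>C. X1 a z) \<partial>P1)"
      by (intro nn_integral_cong F_cong) auto
    also have "\<dots> = (\<integral>\<^sup>+x. F x \<partial>distr P1 (PiM C (\<lambda>_. borel)) (\<lambda>x. \<lambda>a\<in>C. X1 a x))"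
      by (rule nn_integral_distr[symmetric]) (rule measurable_restrict[OF X1_meas], simp add: restr)
    also have "\<dots> = (\<integral>\<^sup>+z. F (\<lambda>a\<in>C. X2 a z) \<partial>P2)" unfolding law
      by (rule nn_integral_distr) (rule measurable_restrict[OF X2_meas], simp add: restr)
    also have "\<dots> = (\<integral>\<^sup>+z. F (\<lambda>a. X2 a z) \<partial>P2)" by (intro nn_integral_cong F_cong) auto
    finally show ?thesis .
  qed
  have FQ: "F \<in> borel_measurable Q" using F_meas[of "\<lambda>x. x" Q] by simp
  \<comment> \<open>Conditionally on the environment, adding \<open>L1\<close> costs at most
    \<open>exp (- \<theta> * d)\<close>: for a subset of sites its variance is at most
    \<open>2 * d\<close>.\<close>
  have "ennreal (exp (- \<theta> * d)) * (\<integral>\<^sup>+\<omega>. F \<omega> \<partial>Q) = (\<integral>\<^sup>+\<omega>. ennreal (exp (- \<theta> * d)) * F \<omega> \<partial>Q)"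
    by (rule nn_integral_cmult[symmetric]) (rule FQ)
  also have "\<dots> \<le> (\<integral>\<^sup>+\<omega>. (\<integral>\<^sup>+g. F (\<lambda>a. X1 a (\<omega>, g)) \<partial>normal_noise K1) \<partial>Q)"
  proof (rule nn_integral_mono)
    fix \<omega> :: "nat \<Rightarrow> real"
    show "ennreal (exp (- \<theta> * d)) * F \<omega> \<le> (\<integral>\<^sup>+g. F (\<lambda>a. X1 a (\<omega>, g)) \<partial>normal_noise K1)"
      unfolding F_def X1_def fst_conv snd_conv
    proof (rule expsum_powr_noise_lower[OF I(1-3) K(1) \<theta>(1)])
      fix i assume "i \<in> I"
      then have S: "finite (s i)" using I(4) C finite_subset by blast
      have "(\<Sum>k\<in>K1. (\<Sum>a\<in>s i. 1 * L1 a k)\<^sup>2) \<le> (\<Sum>a\<in>A. \<Sum>b\<in>B. \<bar>cv a b\<bar> + \<bar>cv a b\<bar>)"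
        unfolding L1_sum[OF S] by (intro sum_mono) auto
      then show "(\<Sum>k\<in>K1. (\<Sum>a\<in>s i. L1 a k)\<^sup>2) \<le> 2 * d" by (simp add: d_def coupling_def sum_distrib_left)
    qed
  qed
  also have "\<dots> = (\<integral>\<^sup>+z. F (\<lambda>a. X1 a z) \<partial>P1)"
    unfolding P1_def by (rule W1.nn_integral_fst) (rule F_meas, use X1_meas in \<open>auto simp: P1_def\<close>)
  also note same
  also have "(\<integral>\<^sup>+z. F (\<lambda>a. X2 a z) \<partial>P2) = (\<integral>\<^sup>+w. (\<integral>\<^sup>+g. F (\<lambda>a. X2 a (w, g)) \<partial>normal_noise K2) \<partial>(Q \<Otimes>\<^sub>M Q))"
    unfolding P2_def by (rule W2.nn_integral_fst[symmetric]) (rule F_meas, use X2_meas in \<open>auto simp: P2_def\<close>)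
  \<comment> \<open>Conditionally on the two copies, removing \<open>L2\<close> costs at most
    \<open>exp (2 * \<theta> * d)\<close>: site and cross terms together give variance at most
    \<open>4 * d\<close>.\<close>
  also have "\<dots> \<le> (\<integral>\<^sup>+w. ennreal (exp (2 * \<theta> * d)) * F (mix w) \<partial>(Q \<Otimes>\<^sub>M Q))"
  proof (rule nn_integral_mono)
    fix w :: "(nat \<Rightarrow> real) \<times> (nat \<Rightarrow> real)"
    show "(\<integral>\<^sup>+g. F (\<lambda>a. X2 a (w, g)) \<partial>normal_noise K2) \<le> ennreal (exp (2 * \<theta> * d)) * F (mix w)"
      unfolding F_def X2_def fst_conv snd_conv
    proof (rule expsum_powr_noise_upper[OF I(1-3) K(2) \<theta> C I(4)])
      fix v :: "nat \<Rightarrow> real" assume v: "\<And>a. v a \<in> {0..1}"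
      have "(\<Sum>k\<in>K2. (\<Sum>a\<in>C. v a * L2 a k)\<^sup>2) \<le> (\<Sum>a\<in>A. \<Sum>b\<in>B. 4 * \<bar>cv a b\<bar>)"
        unfolding L2_sum
      proof (intro sum_mono)
        fix a b
        have v': "0 \<le> v a" "v a \<le> 1" "0 \<le> v b" "v b \<le> 1" using v by auto
        have "(v a)\<^sup>2 \<le> 1" "(v b)\<^sup>2 \<le> 1" using v' by (auto simp: power_le_one)
        then have "((v a)\<^sup>2 + (v b)\<^sup>2) * \<bar>cv a b\<bar> \<le> 2 * \<bar>cv a b\<bar>" by (intro mult_right_mono) auto
        moreover have "v a * v b * cv a b \<le> 1 * \<bar>cv a b\<bar>"
        proof -
          have "v a * v b * cv a b \<le> v a * v b * \<bar>cv a b\<bar>" using v' by (intro mult_left_mono) auto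
          also have "\<dots> \<le> 1 * \<bar>cv a b\<bar>" using v' by (intro mult_right_mono mult_le_one) auto
          finally show ?thesis .
        qed
        ultimately show "((v a)\<^sup>2 + (v b)\<^sup>2) * \<bar>cv a b\<bar> + 2 * (v a * v b * cv a b) \<le> 4 * \<bar>cv a b\<bar>" by linarith
      qed
      then show "(\<Sum>k\<in>K2. (\<Sum>a\<in>C. v a * L2 a k)\<^sup>2) \<le> 4 * d" by (simp add: d_def coupling_def sum_distrib_left)
    qed
  qed
  also have "\<dots> = ennreal (exp (2 * \<theta> * d)) * (\<integral>\<^sup>+w. F (mix w) \<partial>(Q \<Otimes>\<^sub>M Q))"
    by (rule nn_integral_cmult) (rule F_meas, rule mix_meas)
  also have "(\<integral>\<^sup>+w. F (mix w) \<partial>(Q \<Otimes>\<^sub>M Q)) = (\<integral>\<^sup>+w. ennreal (expsum IA cA sA (fst w) powr - \<theta>) * ennreal (expsum IB cB sB (snd w) powr - \<theta>) \<partial>(Q \<Otimes>\<^sub>M Q))"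
  proof (rule nn_integral_cong)
    fix w :: "(nat \<Rightarrow> real) \<times> (nat \<Rightarrow> real)"
    have "expsum IA cA sA (mix w) = expsum IA cA sA (fst w)"
      by (rule expsum_cong) (use IA in \<open>auto simp: mix_def\<close>)
    moreover have "expsum IB cB sB (mix w) = expsum IB cB sB (snd w)"
      by (rule expsum_cong) (use IB AB in \<open>auto simp: mix_def\<close>)
    ultimately show "F (mix w) = ennreal (expsum IA cA sA (fst w) powr - \<theta>) * ennreal (expsum IB cB sB (snd w) powr - \<theta>)"
      unfolding F_eq by (simp add: ennreal_mult)
  qed
  also have "\<dots> = (\<integral>\<^sup>+\<omega>. ennreal (expsum IA cA sA \<omega> powr - \<theta>) \<partial>Q) * (\<integral>\<^sup>+\<omega>. ennreal (expsum IB cB sB \<omega> powr - \<theta>) \<partial>Q)"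
  proof -
    have mA[measurable]: "expsum IA cA sA \<in> borel_measurable Q" by (rule expsum_measurable) (rule measurable_coordinate)
    have mB[measurable]: "expsum IB cB sB \<in> borel_measurable Q" by (rule expsum_measurable) (rule measurable_coordinate)
    show ?thesis
      by (subst nn_integral_fst[symmetric]) (simp_all add: nn_integral_cmult nn_integral_multc)
  qed
  finally have main: "ennreal (exp (- \<theta> * d)) * (\<integral>\<^sup>+\<omega>. F \<omega> \<partial>Q)
     \<le> ennreal (exp (2 * \<theta> * d)) * ((\<integral>\<^sup>+\<omega>. ennreal (expsum IA cA sA \<omega> powr - \<theta>) \<partial>Q) * (\<integral>\<^sup>+\<omega>. ennreal (expsum IB cB sB \<omega> powr - \<theta>) \<partial>Q))" .
  \<comment> \<open>The exponent \<open>3 * \<theta> * d\<close> of the statement is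
    \<open>\<theta> * d\<close> for \<open>L1\<close> plus \<open>2 * \<theta> * d\<close> for
    \<open>L2\<close>.\<close>
  have e: "ennreal (exp (\<theta> * d)) * ennreal (exp (- \<theta> * d)) = 1" "ennreal (exp (\<theta> * d)) * ennreal (exp (2 * \<theta> * d)) = ennreal (exp (3 * \<theta> * d))"
    by (simp_all flip: ennreal_mult exp_add)
  have "(\<integral>\<^sup>+\<omega>. F \<omega> \<partial>Q) = ennreal (exp (\<theta> * d)) * (ennreal (exp (- \<theta> * d)) * (\<integral>\<^sup>+\<omega>. F \<omega> \<partial>Q))"
    unfolding mult.assoc[symmetric] e(1) by simp
  also have "\<dots> \<le> ennreal (exp (\<theta> * d)) * (ennreal (exp (2 * \<theta> * d)) * ((\<integral>\<^sup>+\<omega>. ennreal (expsum IA cA sA \<omega> powr - \<theta>) \<partial>Q) * (\<integral>\<^sup>+\<omega>. ennreal (expsum IB cB sB \<omega> powr - \<theta>) \<partial>Q)))"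
    by (intro mult_left_mono main) simp
  also have "\<dots> = ennreal (exp (3 * \<theta> * d)) * (\<integral>\<^sup>+\<omega>. ennreal (expsum IA cA sA \<omega> powr - \<theta>) \<partial>Q) * (\<integral>\<^sup>+\<omega>. ennreal (expsum IB cB sB \<omega> powr - \<theta>) \<partial>Q)"
    unfolding e(2)[symmetric] by (simp only: mult.assoc)
  finally show ?thesis unfolding F_eq d_def .
qed

end

subsection \<open>Renewal configurations\<close>

text \<open>A renewal configuration between two contacts \<open>a\<close> and \<open>b\<close> is encoded by its finite set of
  contacts; \<open>p\<close> is the inter-arrival law and \<open>v c\<close> the Boltzmann factor of a contact at \<open>c\<close>. The
  leftmost contact carries no Boltzmann factor.\<close>

definition traj :: "nat \<Rightarrow> nat \<Rightarrow> nat set set" where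
  "traj a b = {S. S \<subseteq> {a..b} \<and> a \<in> S \<and> b \<in> S}"

definition prev :: "nat set \<Rightarrow> nat \<Rightarrow> nat" where
  "prev S b = Max {a \<in> S. a < b}"

definition weight :: "(nat \<Rightarrow> real) \<Rightarrow> (nat \<Rightarrow> real) \<Rightarrow> nat set \<Rightarrow> real" where
  "weight p v S = (\<Prod>b\<in>S - {Min S}. p (b - prev S b) * v b)"

definition window :: "(nat \<Rightarrow> real) \<Rightarrow> (nat \<Rightarrow> real) \<Rightarrow> nat \<Rightarrow> nat \<Rightarrow> real" where
  "window p v a b = (\<Sum>S\<in>traj a b. weight p v S)"

text \<open>For \<open>a < b\<close> the contact at \<open>b\<close> occurs in every trajectory, so
  the division removes its factor. What remains depends on \<open>v\<close> strictly inside the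
  window and is at least \<open>p (b - a)\<close> whatever \<open>v\<close> is.\<close>

definition window_minus :: "(nat \<Rightarrow> real) \<Rightarrow> (nat \<Rightarrow> real) \<Rightarrow> nat \<Rightarrow> nat \<Rightarrow> real" where
  "window_minus p v a b = window p v a b / v b"

definition consecutive :: "nat set \<Rightarrow> nat \<Rightarrow> nat \<Rightarrow> bool" where
  "consecutive S a b \<longleftrightarrow> a \<in> S \<and> b \<in> S \<and> a < b \<and> S \<inter> {a<..<b} = {}"

definition gap_ge :: "nat \<Rightarrow> nat set \<Rightarrow> bool" where
  "gap_ge m S \<longleftrightarrow> (\<exists>a b. consecutive S a b \<and> b - a \<ge> m)"

lemma finite_traj [simp]: "finite (traj a b)"
  by (rule finite_subset[of _ "Pow {a..b}"]) (auto simp: traj_def)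

lemma traj_finite: "S \<in> traj a b \<Longrightarrow> finite S"
  by (auto simp: traj_def intro: finite_subset)

lemma traj_Min: "S \<in> traj a b \<Longrightarrow> Min S = a"
  by (auto simp: traj_def intro!: Min_eqI intro: finite_subset)

text \<open>The renewal property at a contact: the predecessor of a contact beyond \<open>c\<close>
  is at or beyond \<open>c\<close>, so each factor can be read on its own side. The point
  \<open>c\<close> belongs to both halves but is leftmost in the right one, where it carries no
  factor.\<close>

lemma weight_split:
  assumes S: "finite S" "c \<in> S"
  shows "weight p v S = weight p v (S \<inter> {..c}) * weight p v (S \<inter> {c..})"
proof -
  have ne: "S \<noteq> {}" using S by auto
  have M1: "Min (S \<inter> {..c}) = Min S"
    using S ne by (intro Min_eqI) (auto intro: Min_in order_trans[OF Min_le])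
  have M2: "Min (S \<inter> {c..}) = c" using S by (intro Min_eqI) auto
  have eq: "S - {Min S} = (S \<inter> {..c} - {Min S}) \<union> (S \<inter> {c..} - {c})"
    using Min_le[OF S] by auto
  have "(\<Prod>b\<in>S - {Min S}. p (b - prev S b) * v b)
      = (\<Prod>b\<in>S \<inter> {..c} - {Min S}. p (b - prev S b) * v b) * (\<Prod>b\<in>S \<inter> {c..} - {c}. p (b - prev S b) * v b)"
    unfolding eq using S by (intro prod.union_disjoint) auto
  also have "(\<Prod>b\<in>S \<inter> {..c} - {Min S}. p (b - prev S b) * v b) = (\<Prod>b\<in>S \<inter> {..c} - {Min S}. p (b - prev (S \<inter> {..c}) b) * v b)"
  proof (rule prod.cong[OF refl])
    fix b assume "b \<in> S \<inter> {..c} - {Min S}"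
    then have "{a \<in> S. a < b} = {a \<in> S \<inter> {..c}. a < b}" by auto
    then show "p (b - prev S b) * v b = p (b - prev (S \<inter> {..c}) b) * v b" by (simp add: prev_def)
  qed
  also have "(\<Prod>b\<in>S \<inter> {c..} - {c}. p (b - prev S b) * v b) = (\<Prod>b\<in>S \<inter> {c..} - {c}. p (b - prev (S \<inter> {c..}) b) * v b)"
  proof (rule prod.cong[OF refl])
    fix b assume b: "b \<in> S \<inter> {c..} - {c}"
    have "Max {a \<in> S. a < b} = Max {a \<in> S \<inter> {c..}. a < b}"
    proof (rule Max_eqI)
      show "finite {a \<in> S. a < b}" using S by auto
      have ne: "{a \<in> S \<inter> {c..}. a < b} \<noteq> {}" "finite {a \<in> S \<inter> {c..}. a < b}" using b S by auto
      show "Max {a \<in> S \<inter> {c..}. a < b} \<in> {a \<in> S. a < b}" using Max_in[OF ne(2,1)] by auto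
      fix a assume a: "a \<in> {a \<in> S. a < b}"
      show "a \<le> Max {a \<in> S \<inter> {c..}. a < b}"
      proof (cases "a \<ge> c")
        case True
        then show ?thesis using a ne by (intro Max_ge) auto
      next
        case False
        have "c \<le> Max {a \<in> S \<inter> {c..}. a < b}" using b S ne by (intro Max_ge) auto
        then show ?thesis using False by simp
      qed
    qed
    then show "p (b - prev S b) * v b = p (b - prev (S \<inter> {c..}) b) * v b" by (simp add: prev_def)
  qed
  finally show ?thesis unfolding weight_def M1 M2 .
qed

lemma weight_pair: "a < b \<Longrightarrow> weight p v {a, b} = p (b - a) * v b"
proof -
  assume ab: "a < b"
  then have "Min {a, b} = a" "{a, b} - {a} = {b}" "{x \<in> {a, b}. x < b} = {a}" by auto
  then show ?thesis by (simp only: weight_def prev_def) simp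
qed

lemma weight_triple:
  assumes "i < c" "c < l"
  shows "weight p v {i, c, l} = p (c - i) * v c * (p (l - c) * v l)"
proof -
  have "{i, c, l} \<inter> {..c} = {i, c}" "{i, c, l} \<inter> {c..} = {c, l}" using assms by auto
  then show ?thesis using weight_split[of "{i, c, l}" c p v] weight_pair assms by simp
qed

lemma sum_traj_split:
  fixes f g :: "nat set \<Rightarrow> real"
  assumes "a \<le> c" "c \<le> b"
  shows "(\<Sum>S | S \<in> traj a b \<and> c \<in> S. f (S \<inter> {..c}) * g (S \<inter> {c..})) = (\<Sum>S\<in>traj a c. f S) * (\<Sum>S\<in>traj c b. g S)"
proof -
  have "(\<Sum>S\<in>traj a c. f S) * (\<Sum>S\<in>traj c b. g S) = (\<Sum>(S1, S2)\<in>traj a c \<times> traj c b. f S1 * g S2)"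
    by (simp add: sum_product sum.cartesian_product)
  also have "\<dots> = (\<Sum>S | S \<in> traj a b \<and> c \<in> S. f (S \<inter> {..c}) * g (S \<inter> {c..}))"
  proof (rule sum.reindex_bij_witness[where i = "\<lambda>S. (S \<inter> {..c}, S \<inter> {c..})" and j = "\<lambda>(S1, S2). S1 \<union> S2"], goal_cases)
    case (1 x)
    obtain S1 S2 where x: "x = (S1, S2)" by force
    with 1 have "S1 \<subseteq> {a..c}" "c \<in> S1" "S2 \<subseteq> {c..b}" "c \<in> S2" by (auto simp: traj_def)
    then have "(S1 \<union> S2) \<inter> {..c} = S1" "(S1 \<union> S2) \<inter> {c..} = S2" by force+
    then show ?case using x by simp
  next
    case (2 x)
    then show ?case using assms by (force simp: traj_def)
  next
    case (3 S)
    then show ?case by auto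
  next
    case (4 S)
    then show ?case using assms by (auto simp: traj_def)
  next
    case (5 x)
    obtain S1 S2 where x: "x = (S1, S2)" by force
    with 5 have "S1 \<subseteq> {a..c}" "c \<in> S1" "S2 \<subseteq> {c..b}" "c \<in> S2" by (auto simp: traj_def)
    then have "(S1 \<union> S2) \<inter> {..c} = S1" "(S1 \<union> S2) \<inter> {c..} = S2" by force+
    then show ?case using x by simp
  qed
  finally show ?thesis by simp
qed

section \<open>Gap estimates for fixed positive weights\<close>

locale renewal_weights =
  fixes p :: "nat \<Rightarrow> real"
  assumes p_pos: "\<And>t. t \<ge> 1 \<Longrightarrow> p t > 0" and p_le_1: "\<And>t. t \<ge> 1 \<Longrightarrow> p t \<le> 1"

locale pinning_weights = renewal_weights +
  fixes v :: "nat \<Rightarrow> real"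
  assumes v_pos: "\<And>c. v c > 0"
begin

abbreviation w where "w \<equiv> weight p v"
abbreviation Z where "Z \<equiv> window p v"
abbreviation Zm where "Zm \<equiv> window_minus p v"

lemma weight_pos: "finite S \<Longrightarrow> w S > 0"
  unfolding weight_def
proof (rule prod_pos, rule mult_pos_pos[OF p_pos v_pos])
  fix b assume S: "finite S" and b: "b \<in> S - {Min S}"
  have "{a \<in> S. a < b} \<noteq> {}"
  proof -
    have "Min S \<le> b" "Min S \<in> S" using S b by (auto intro: Min_le Min_in)
    then have "Min S < b" using b by (auto simp: le_less)
    then show ?thesis using \<open>Min S \<in> S\<close> by auto
  qed
  then have "prev S b < b" unfolding prev_def using Max_in[of "{a \<in> S. a < b}"] S by auto
  then show "1 \<le> b - prev S b" by simp
qed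

lemma weight_nonneg: "S \<in> traj a b \<Longrightarrow> w S \<ge> 0"
  using weight_pos traj_finite less_imp_le by blast

lemma window_pos: "a \<le> b \<Longrightarrow> Z a b > 0"
  unfolding window_def
  by (rule sum_pos) (auto simp: traj_def intro!: weight_pos exI[of _ "{a, b}"] intro: finite_subset)

lemma window_minus_pos: "a \<le> b \<Longrightarrow> Zm a b > 0"
  unfolding window_minus_def by (intro divide_pos_pos window_pos v_pos)

lemma window_eq: "Z a b = Zm a b * v b"
  using v_pos[of b] by (simp add: window_minus_def)

lemma window_through:
  assumes "a \<le> c" "c \<le> b"
  shows "(\<Sum>S | S \<in> traj a b \<and> c \<in> S. w S) = Z a c * Z c b"
proof -
  have "(\<Sum>S | S \<in> traj a b \<and> c \<in> S. w S) = (\<Sum>S | S \<in> traj a b \<and> c \<in> S. w (S \<inter> {..c}) * w (S \<inter> {c..}))"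
    by (intro sum.cong refl weight_split) (auto dest: traj_finite)
  then show ?thesis unfolding sum_traj_split[OF assms, of w w] window_def .
qed

lemma window_superadditive:
  assumes "a \<le> c" "c \<le> b"
  shows "Z a c * Z c b \<le> Z a b"
  unfolding window_through[OF assms, symmetric] window_def[of _ _ a b]
  by (rule sum_mono2) (auto intro: weight_nonneg)

lemma window_minus_ge: "a < b \<Longrightarrow> Zm a b \<ge> p (b - a)"
proof -
  assume ab: "a < b"
  have "w {a, b} \<le> Z a b" unfolding window_def
    by (rule member_le_sum) (use ab in \<open>auto simp: traj_def intro: weight_nonneg[of _ a b]\<close>)
  then show ?thesis using weight_pair[OF ab] v_pos[of b] by (simp add: window_minus_def le_divide_eq)
qed

text \<open>Factorisation at both ends of an empty stretch. The extra event \<open>E\<close> looks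
  at the part from \<open>b\<close> on; it will hold the conditions on the blocks further
  right.\<close>

lemma sum_consecutive:
  assumes ab: "a < b" "b \<le> n"
  shows "(\<Sum>S | S \<in> traj 0 n \<and> consecutive S a b \<and> E (S \<inter> {b..}). w S)
    = Z 0 a * (p (b - a) * v b) * (\<Sum>S | S \<in> traj b n \<and> E S. w S)"
proof -
  have trajab: "S \<in> traj a b \<Longrightarrow> S \<inter> {a<..<b} = {} \<longleftrightarrow> S = {a, b}" for S
    using ab by (fastforce simp: traj_def subset_iff)
  have mid: "(\<Sum>S\<in>traj a b. (if S \<inter> {a<..<b} = {} then w S else 0)) = p (b - a) * v b"
  proof -
    have "(\<Sum>S\<in>traj a b. (if S \<inter> {a<..<b} = {} then w S else 0)) = (\<Sum>S\<in>traj a b. (if S = {a, b} then w S else 0))"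
      by (intro sum.cong refl) (simp add: trajab)
    also have "\<dots> = w {a, b}" using ab by (simp add: sum.delta' traj_def) 
    finally show ?thesis using weight_pair ab by simp
  qed
  define gE where "gE S = (if E S then w S else 0)" for S
  \<comment> \<open>The sum is cut at \<open>a\<close> first; \<open>gM\<close> carries the
    constraint on the stretch up to \<open>b\<close>, and the remaining cut, along to the right-hand
    part.\<close>
  define gM where "gM S = (if S \<inter> {a<..<b} = {} \<and> b \<in> S then w (S \<inter> {..b}) * gE (S \<inter> {b..}) else 0)" for S
  have "(\<Sum>S | S \<in> traj 0 n \<and> consecutive S a b \<and> E (S \<inter> {b..}). w S)
      = (\<Sum>S | S \<in> traj 0 n \<and> a \<in> S. (if consecutive S a b \<and> E (S \<inter> {b..}) then w S else 0))"
    by (subst sum.inter_filter[symmetric]) (auto intro!: sum.cong simp: consecutive_def)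
  also have "\<dots> = (\<Sum>S | S \<in> traj 0 n \<and> a \<in> S. w (S \<inter> {..a}) * gM (S \<inter> {a..}))"
  proof (rule sum.cong[OF refl])
    fix S assume "S \<in> {S. S \<in> traj 0 n \<and> a \<in> S}"
    then have S: "finite S" "a \<in> S" by (auto dest: traj_finite)
    have e1: "S \<inter> {a..} \<inter> {a<..<b} = S \<inter> {a<..<b}" using ab by auto
    have e2: "S \<inter> {a..} \<inter> {b..} = S \<inter> {b..}" using ab by auto
    show "(if consecutive S a b \<and> E (S \<inter> {b..}) then w S else 0) = w (S \<inter> {..a}) * gM (S \<inter> {a..})"
    proof (cases "consecutive S a b \<and> E (S \<inter> {b..})")
      case True
      then have "w S = w (S \<inter> {..a}) * (w (S \<inter> {a..} \<inter> {..b}) * w (S \<inter> {a..} \<inter> {b..}))"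
        using S weight_split[of S a p v] weight_split[of "S \<inter> {a..}" b p v] ab by (auto simp: consecutive_def)
      then show ?thesis using True ab unfolding gM_def gE_def e1 e2 by (auto simp: consecutive_def)
    next
      case False
      then show ?thesis using S ab unfolding gM_def gE_def e1 e2 by (auto simp: consecutive_def)
    qed
  qed
  also have "\<dots> = Z 0 a * (\<Sum>S\<in>traj a n. gM S)"
    using sum_traj_split[of 0 a n w gM] ab by (simp add: window_def)
  also have "(\<Sum>S\<in>traj a n. gM S) = (\<Sum>S | S \<in> traj a n \<and> b \<in> S. (if (S \<inter> {..b}) \<inter> {a<..<b} = {} then w (S \<inter> {..b}) else 0) * gE (S \<inter> {b..}))"
  proof -
    have "(\<Sum>S\<in>traj a n. gM S) = (\<Sum>S | S \<in> traj a n \<and> b \<in> S. gM S)"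
      by (rule sum.mono_neutral_right) (auto simp: gM_def)
    also have "\<dots> = (\<Sum>S | S \<in> traj a n \<and> b \<in> S. (if (S \<inter> {..b}) \<inter> {a<..<b} = {} then w (S \<inter> {..b}) else 0) * gE (S \<inter> {b..}))"
    proof (rule sum.cong[OF refl])
      fix S
      have "S \<inter> {..b} \<inter> {a<..<b} = S \<inter> {a<..<b}" by auto
      then show "S \<in> {S. S \<in> traj a n \<and> b \<in> S} \<Longrightarrow> gM S = (if (S \<inter> {..b}) \<inter> {a<..<b} = {} then w (S \<inter> {..b}) else 0) * gE (S \<inter> {b..})"
        by (simp add: gM_def)
    qed
    finally show ?thesis .
  qed
  also have "\<dots> = (p (b - a) * v b) * (\<Sum>S\<in>traj b n. gE S)"
    using sum_traj_split[of a b n "\<lambda>S. if S \<inter> {a<..<b} = {} then w S else 0" gE] ab mid by simp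
  also have "(\<Sum>S\<in>traj b n. gE S) = (\<Sum>S | S \<in> traj b n \<and> E S. w S)"
    unfolding gE_def by (rule sum.inter_filter[symmetric]) simp
  finally show ?thesis by (simp add: mult.assoc)
qed

text \<open>Union bound over the ends of the gap. Filling the empty stretch with arbitrary
  trajectories multiplies its contribution by \<open>Z a b / (p (b - a) * v b)\<close>, and by
  superadditivity the result still is at most \<open>Z 0 n\<close>. As \<open>p \<le> 1\<close>, a
  gap from \<open>a\<close> to \<open>b\<close> has relative weight at most
  \<open>1 / Zm a b\<close>.\<close>

lemma sum_gap_ge_upper:
  assumes m: "m \<ge> 1"
  shows "(\<Sum>S | S \<in> traj 0 n \<and> gap_ge m S. w S)
    \<le> Z 0 n * (\<Sum>b\<in>{..n}. \<Sum>a\<in>{a. a + m \<le> b}. 1 / Zm a b)"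
proof -
  define X where "X = Sigma {..n} (\<lambda>b. {a. a + m \<le> b})"
  have fin: "finite {a. a + m \<le> b}" for b by (rule finite_subset[of _ "{..b}"]) auto
  have finX: "finite X" using fin by (simp add: X_def)
  have "(\<Sum>S | S \<in> traj 0 n \<and> gap_ge m S. w S) \<le> (\<Sum>S\<in>traj 0 n. \<Sum>(b, a)\<in>X. if consecutive S a b then w S else 0)"
  proof -
    have "(\<Sum>S | S \<in> traj 0 n \<and> gap_ge m S. w S) = (\<Sum>S\<in>traj 0 n. if gap_ge m S then w S else 0)"
      by (rule sum.inter_filter) simp
    also have "\<dots> \<le> (\<Sum>S\<in>traj 0 n. \<Sum>(b, a)\<in>X. if consecutive S a b then w S else 0)"
    proof (rule sum_mono)
      fix S assume S: "S \<in> traj 0 n"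
      have nn: "0 \<le> (case z of (b, a) \<Rightarrow> if consecutive S a b then w S else 0)" for z
        using weight_nonneg[OF S] by (auto split: prod.split)
      show "(if gap_ge m S then w S else 0) \<le> (\<Sum>(b, a)\<in>X. if consecutive S a b then w S else 0)"
      proof (cases "gap_ge m S")
        case True
        then obtain a b where ab: "consecutive S a b" "b - a \<ge> m" by (auto simp: gap_ge_def)
        then have "(b, a) \<in> X" using S by (auto simp: X_def consecutive_def traj_def)
        from member_le_sum[OF this, of "\<lambda>(b, a). if consecutive S a b then w S else 0"] nn finX
        show ?thesis using ab True by simp
      next
        case False
        then show ?thesis using nn by (auto intro!: sum_nonneg)
      qed
    qed
    finally show ?thesis .
  qed
  also have "\<dots> = (\<Sum>(b, a)\<in>X. \<Sum>S\<in>traj 0 n. if consecutive S a b then w S else 0)"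
    by (subst sum.swap) (simp add: case_prod_beta)
  also have "\<dots> \<le> (\<Sum>(b, a)\<in>X. Z 0 n * (1 / Zm a b))"
  proof (intro sum_mono, clarify)
    fix b a assume "(b, a) \<in> X"
    then have ab: "a < b" "b \<le> n" using m by (auto simp: X_def)
    have "(\<Sum>S\<in>traj 0 n. if consecutive S a b then w S else 0) = (\<Sum>S | S \<in> traj 0 n \<and> consecutive S a b \<and> True. w S)"
      by (simp add: sum.inter_filter)
    also have "\<dots> = Z 0 a * (p (b - a) * v b) * Z b n"
      unfolding sum_consecutive[OF ab, of "\<lambda>_. True"] by (simp add: window_def)
    also have "\<dots> \<le> Z 0 a * (1 * v b) * Z b n"
      using ab window_pos[of 0 a] window_pos[of b n] v_pos[of b] p_le_1[of "b - a"]
      by (intro mult_right_mono mult_left_mono) auto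
    also have "\<dots> = Z 0 a * Z a b * Z b n * (1 / Zm a b)"
      using window_minus_pos[of a b] ab by (simp add: window_eq[of a b])
    also have "\<dots> \<le> Z 0 n * (1 / Zm a b)"
    proof (rule mult_right_mono)
      have "Z 0 a * Z a b * Z b n \<le> Z 0 b * Z b n"
        using ab window_pos[of b n] by (intro mult_right_mono window_superadditive) auto
      also have "\<dots> \<le> Z 0 n" using ab by (intro window_superadditive) auto
      finally show "Z 0 a * Z a b * Z b n \<le> Z 0 n" .
      show "0 \<le> 1 / Zm a b" using window_minus_pos[of a b] ab by simp
    qed
    finally show "(\<Sum>S\<in>traj 0 n. if consecutive S a b then w S else 0) \<le> Z 0 n * (1 / Zm a b)" .
  qed
  also have "\<dots> = Z 0 n * (\<Sum>b\<in>{..n}. \<Sum>a\<in>{a. a + m \<le> b}. 1 / Zm a b)"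
    unfolding X_def using fin by (subst sum.Sigma[symmetric]) (auto simp: sum_distrib_left)
  finally show ?thesis .
qed

text \<open>Insertion of \<open>c\<close> changes only the factor of the gap of \<open>S\<close>
  around \<open>c\<close>. The contacts in \<open>{s..c}\<close> and \<open>{c..t}\<close> confine
  this gap to the range in which \<open>\<kappa>\<close> compares the two factors.\<close>

lemma weight_insert:
  assumes S: "S \<in> traj 0 n" and c: "c \<notin> S" and s: "S \<inter> {s..c} \<noteq> {}" and t: "S \<inter> {c..t} \<noteq> {}"
    and \<kappa>: "\<And>i l. s \<le> i \<Longrightarrow> i < c \<Longrightarrow> c < l \<Longrightarrow> l \<le> t \<Longrightarrow> p (l - i) \<le> \<kappa> * (p (c - i) * v c * p (l - c))"
  shows "w S \<le> \<kappa> * w (insert c S)"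
proof -
  have fS: "finite S" using S by (rule traj_finite)
  define i where "i = Max {a \<in> S. a < c}"
  define l where "l = Min {a \<in> S. a > c}"
  obtain i0 where i0: "i0 \<in> S" "s \<le> i0" "i0 < c" using s c by (force simp: le_less)
  obtain l0 where l0: "l0 \<in> S" "l0 \<le> t" "c < l0" using t c by (force simp: le_less)
  have i: "i \<in> S" "i < c" "s \<le> i" and imax: "\<And>a. a \<in> S \<Longrightarrow> a < c \<Longrightarrow> a \<le> i"
  proof -
    have "i \<in> {a \<in> S. a < c}" unfolding i_def by (rule Max_in) (use fS i0 in auto)
    then show "i \<in> S" "i < c" by auto
    show le: "a \<in> S \<Longrightarrow> a < c \<Longrightarrow> a \<le> i" for a unfolding i_def by (rule Max_ge) (use fS in auto)
    show "s \<le> i" using le[of i0] i0 by simp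
  qed
  have l: "l \<in> S" "c < l" "l \<le> t" and lmin: "\<And>a. a \<in> S \<Longrightarrow> c < a \<Longrightarrow> l \<le> a"
  proof -
    have "l \<in> {a \<in> S. a > c}" unfolding l_def by (rule Min_in) (use fS l0 in auto)
    then show "l \<in> S" "c < l" by auto
    show le: "a \<in> S \<Longrightarrow> c < a \<Longrightarrow> l \<le> a" for a unfolding l_def by (rule Min_le) (use fS in auto)
    show "l \<le> t" using le[of l0] l0 by simp
  qed
  have dec: "w S' = w (S' \<inter> {..i}) * (w (S' \<inter> {i..} \<inter> {..l}) * w (S' \<inter> {i..} \<inter> {l..}))"
    if "finite S'" "i \<in> S'" "l \<in> S'" for S'
    using that i l weight_split[of S' i p v] weight_split[of "S' \<inter> {i..}" l p v] by auto
  have m1: "S \<inter> {i..} \<inter> {..l} = {i, l}"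
  proof -
    have "x = i \<or> x = l" if "x \<in> S" "i \<le> x" "x \<le> l" for x
      using imax[of x] lmin[of x] that c by (cases x c rule: linorder_cases) auto
    then show ?thesis using i l by auto
  qed
  have m2: "insert c S \<inter> {i..} \<inter> {..l} = {i, c, l}" using m1 i l by auto
  have l1: "insert c S \<inter> {..i} = S \<inter> {..i}" using i by auto
  have r1: "insert c S \<inter> {i..} \<inter> {l..} = S \<inter> {i..} \<inter> {l..}" using l by auto
  define P where "P = w (S \<inter> {..i})"
  define R where "R = w (S \<inter> {i..} \<inter> {l..})"
  have PR: "P \<ge> 0" "R \<ge> 0" unfolding P_def R_def using fS by (auto intro!: less_imp_le weight_pos)
  have "w S = P * (p (l - i) * v l * R)"
    using dec[of S] fS i l m1 weight_pair[of i l p v] by (simp add: P_def R_def)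
  also have "\<dots> \<le> P * (\<kappa> * (p (c - i) * v c * p (l - c)) * v l * R)"
    using PR v_pos[of l] i l by (intro mult_left_mono mult_right_mono \<kappa>) auto
  also have "\<dots> = \<kappa> * (P * (p (c - i) * v c * (p (l - c) * v l) * R))" by (simp add: mult_ac)
  also have "P * (p (c - i) * v c * (p (l - c) * v l) * R) = w (insert c S)"
  proof -
    have "w (insert c S) = w (insert c S \<inter> {..i}) * (w (insert c S \<inter> {i..} \<inter> {..l}) * w (insert c S \<inter> {i..} \<inter> {l..}))"
      by (rule dec) (use fS i l in auto)
    then show ?thesis unfolding l1 r1 m2 using weight_triple[of i c l p v] i l by (simp add: P_def R_def)
  qed
  finally show ?thesis .
qed

text \<open>On trajectories avoiding \<open>c\<close> the map \<open>insert c\<close> is injective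
  and costs \<open>\<kappa>\<close>; those already through \<open>c\<close> contribute the
  1.\<close>

lemma force_contact:
  assumes c: "c \<le> n" and \<kappa>0: "\<kappa> \<ge> 0"
    and \<kappa>: "\<And>i l. s \<le> i \<Longrightarrow> i < c \<Longrightarrow> c < l \<Longrightarrow> l \<le> t \<Longrightarrow> p (l - i) \<le> \<kappa> * (p (c - i) * v c * p (l - c))"
    and E: "\<And>S. E S \<Longrightarrow> E (insert c S)"
  shows "(\<Sum>S | S \<in> traj 0 n \<and> E S \<and> S \<inter> {s..c} \<noteq> {} \<and> S \<inter> {c..t} \<noteq> {}. w S)
    \<le> (1 + \<kappa>) * (\<Sum>S | S \<in> traj 0 n \<and> E S \<and> c \<in> S. w S)"
proof -
  let ?G = "{S. S \<in> traj 0 n \<and> E S \<and> S \<inter> {s..c} \<noteq> {} \<and> S \<inter> {c..t} \<noteq> {}}"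
  let ?T = "{S. S \<in> traj 0 n \<and> E S \<and> c \<in> S}"
  have fin: "finite ?G" "finite ?T" by (auto intro: finite_subset[OF _ finite_traj[of 0 n]])
  have "sum w ?G = sum w {S \<in> ?G. c \<in> S} + sum w {S \<in> ?G. c \<notin> S}"
    using fin(1) by (subst sum.union_disjoint[symmetric]) (auto intro!: sum.cong)
  also have "sum w {S \<in> ?G. c \<in> S} \<le> sum w ?T"
    by (rule sum_mono2) (use fin in \<open>auto intro: weight_nonneg\<close>)
  also have "sum w {S \<in> ?G. c \<notin> S} \<le> (\<Sum>S\<in>{S \<in> ?G. c \<notin> S}. \<kappa> * w (insert c S))"
    by (rule sum_mono) (auto intro!: weight_insert[OF _ _ _ _ \<kappa>])
  also have "\<dots> = \<kappa> * sum w (insert c ` {S \<in> ?G. c \<notin> S})"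
    by (subst sum.reindex) (auto simp: sum_distrib_left intro!: inj_onI)
  also have "\<dots> \<le> \<kappa> * sum w ?T"
    using \<kappa>0 fin c E by (intro mult_left_mono sum_mono2) (auto intro: weight_nonneg simp: traj_def)
  finally show ?thesis by (simp add: distrib_right)
qed

text \<open>Contacts at \<open>a\<close> and \<open>b\<close> are forced at the price
  \<open>1 + \<kappa>\<close> each. Once both are present, the sum contains the free factor
  \<open>Z a b\<close>; replacing it by the single gap \<open>p (b - a) * v b\<close> produces the
  trajectories having exactly this gap. They are disjoint from those on the left, so a multiple of
  the left sum fits into the total in addition to it.\<close>

lemma block_inequality:
  assumes ord: "s \<le> a" "a < b" "b < t" "t \<le> n" and \<kappa>0: "\<kappa> \<ge> 0"
    and \<kappa>: "\<And>c i l. c \<in> {a, b} \<Longrightarrow> s \<le> i \<Longrightarrow> i < c \<Longrightarrow> c < l \<Longrightarrow> l \<le> t \<Longrightarrow> p (l - i) \<le> \<kappa> * (p (c - i) * v c * p (l - c))"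
    and E: "\<And>S S'. S \<inter> {t..} = S' \<inter> {t..} \<Longrightarrow> E S = E S'"
  shows "(1 + p (b - a) / ((1 + \<kappa>)\<^sup>2 * Zm a b))
      * (\<Sum>S | S \<in> traj 0 n \<and> E S \<and> S \<inter> {s..a} \<noteq> {} \<and> S \<inter> {b..t} \<noteq> {} \<and> \<not> consecutive S a b. w S)
    \<le> (\<Sum>S | S \<in> traj 0 n \<and> E S. w S)"
proof -
  define \<Psi> where "\<Psi> = (\<Sum>S | S \<in> traj b n \<and> E S. w S)"
  define U where "U = (\<Sum>S | S \<in> traj 0 n \<and> E S \<and> S \<inter> {s..a} \<noteq> {} \<and> S \<inter> {b..t} \<noteq> {} \<and> \<not> consecutive S a b. w S)"
  define V where "V = (\<Sum>S | S \<in> traj 0 n \<and> E S \<and> consecutive S a b. w S)"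
  have EI: "E (insert c S) = E S" if "c \<in> {a, b}" for c S
    by (rule E) (use that ord in auto)
  have fin: "finite {S. S \<in> traj 0 n \<and> X S}" for X
    by (rule finite_subset[OF _ finite_traj[of 0 n]]) auto
  have "U \<le> (\<Sum>S | S \<in> traj 0 n \<and> (E S \<and> S \<inter> {b..t} \<noteq> {}) \<and> S \<inter> {s..a} \<noteq> {} \<and> S \<inter> {a..t} \<noteq> {}. w S)"
    unfolding U_def using ord by (intro sum_mono2 fin) (force, auto intro: weight_nonneg)
  also have "\<dots> \<le> (1 + \<kappa>) * (\<Sum>S | S \<in> traj 0 n \<and> (E S \<and> S \<inter> {b..t} \<noteq> {}) \<and> a \<in> S. w S)"
    by (rule force_contact[OF _ \<kappa>0 \<kappa>]) (use ord EI in auto)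
  also have "(\<Sum>S | S \<in> traj 0 n \<and> (E S \<and> S \<inter> {b..t} \<noteq> {}) \<and> a \<in> S. w S)
      \<le> (\<Sum>S | S \<in> traj 0 n \<and> (E S \<and> a \<in> S) \<and> S \<inter> {s..b} \<noteq> {} \<and> S \<inter> {b..t} \<noteq> {}. w S)"
    using ord by (intro sum_mono2 fin) (force, auto intro: weight_nonneg)
  also have "\<dots> \<le> (1 + \<kappa>) * (\<Sum>S | S \<in> traj 0 n \<and> (E S \<and> a \<in> S) \<and> b \<in> S. w S)"
    by (rule force_contact[OF _ \<kappa>0 \<kappa>]) (use ord EI in auto)
  also have "(\<Sum>S | S \<in> traj 0 n \<and> (E S \<and> a \<in> S) \<and> b \<in> S. w S) = Z 0 a * Z a b * \<Psi>"
  proof -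
    define g where "g S = (if E S then w S else 0)" for S
    define f where "f S = (if a \<in> S then w S else 0)" for S
    have "(\<Sum>S | S \<in> traj 0 n \<and> (E S \<and> a \<in> S) \<and> b \<in> S. w S) = (\<Sum>S | S \<in> traj 0 n \<and> b \<in> S. if E S \<and> a \<in> S then w S else 0)"
      by (subst sum.inter_filter[symmetric]) (auto intro!: sum.cong fin)
    also have "\<dots> = (\<Sum>S | S \<in> traj 0 n \<and> b \<in> S. f (S \<inter> {..b}) * g (S \<inter> {b..}))"
    proof (rule sum.cong[OF refl])
      fix S assume S: "S \<in> {S. S \<in> traj 0 n \<and> b \<in> S}"
      have "E (S \<inter> {b..}) = E S" by (rule E) (use ord in auto)
      then show "(if E S \<and> a \<in> S then w S else 0) = f (S \<inter> {..b}) * g (S \<inter> {b..})"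
        using S weight_split[of S b p v] ord by (auto simp: f_def g_def dest: traj_finite)
    qed
    also have "\<dots> = (\<Sum>S\<in>traj 0 b. f S) * (\<Sum>S\<in>traj b n. g S)"
      by (rule sum_traj_split) (use ord in auto)
    also have "(\<Sum>S\<in>traj b n. g S) = \<Psi>" unfolding g_def \<Psi>_def by (rule sum.inter_filter[symmetric]) simp
    also have "(\<Sum>S\<in>traj 0 b. f S) = (\<Sum>S | S \<in> traj 0 b \<and> a \<in> S. w S)" unfolding f_def by (rule sum.inter_filter[symmetric]) simp
    also have "\<dots> = Z 0 a * Z a b" by (rule window_through) (use ord in auto)
    finally show ?thesis .
  qed
  finally have U: "U \<le> (1 + \<kappa>) * ((1 + \<kappa>) * (Z 0 a * Z a b * \<Psi>))" using \<kappa>0 by (simp add: mult_left_mono)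
  have V: "V = Z 0 a * (p (b - a) * v b) * \<Psi>"
  proof -
    have "E (S \<inter> {b..}) = E S" for S by (rule E) (use ord in auto)
    then have "V = (\<Sum>S | S \<in> traj 0 n \<and> consecutive S a b \<and> E (S \<inter> {b..}). w S)"
      unfolding V_def by (intro sum.cong) auto
    then show ?thesis unfolding \<Psi>_def using sum_consecutive[of a b n E] ord by simp
  qed
  have pos: "Zm a b > 0" "v b > 0" "p (b - a) > 0" using window_minus_pos[of a b] v_pos p_pos[of "b - a"] ord by auto
  define q where "q = p (b - a) / ((1 + \<kappa>)\<^sup>2 * Zm a b)"
  have q0: "q \<ge> 0" unfolding q_def using pos by simp
  have "q * U \<le> q * ((1 + \<kappa>) * ((1 + \<kappa>) * (Z 0 a * Z a b * \<Psi>)))" by (rule mult_left_mono[OF U q0])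
  also have "\<dots> = V" unfolding q_def V window_eq[of a b] using pos \<kappa>0 by (simp add: power2_eq_square)
  finally have qU: "q * U \<le> V" .
  have "U + V \<le> (\<Sum>S | S \<in> traj 0 n \<and> E S. w S)"
    unfolding U_def V_def
    by (subst sum.union_disjoint[symmetric]) (auto intro!: fin sum_mono2 intro: weight_nonneg)
  with qU show ?thesis unfolding q_def U_def[symmetric] by (simp add: distrib_right)
qed

text \<open>Each block contributes a factor \<open>1 + q j\<close>. Blocks are treated from the last
  to the first, so that the conditions already imposed concern \<open>{t i..}\<close> only and can
  serve as the event \<open>E\<close> of \<open>block_inequality\<close>. The product is then
  weakened to one plus the sum, whose variance can be controlled.\<close>

lemma blocks_inequality:
  fixes s a b t :: "nat \<Rightarrow> nat"
  assumes ord: "\<And>j. j < J \<Longrightarrow> s j \<le> a j \<and> a j < b j \<and> b j < t j \<and> t j \<le> n"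
    and sep: "\<And>i j. i < j \<Longrightarrow> j < J \<Longrightarrow> t i \<le> s j" and \<kappa>0: "\<kappa> \<ge> 0"
    and \<kappa>: "\<And>j c i l. j < J \<Longrightarrow> c \<in> {a j, b j} \<Longrightarrow> s j \<le> i \<Longrightarrow> i < c \<Longrightarrow> c < l \<Longrightarrow> l \<le> t j
        \<Longrightarrow> p (l - i) \<le> \<kappa> * (p (c - i) * v c * p (l - c))"
  defines "F \<equiv> \<lambda>j S. S \<inter> {s j..a j} \<noteq> {} \<and> S \<inter> {b j..t j} \<noteq> {} \<and> \<not> consecutive S (a j) (b j)"
  shows "(1 + (\<Sum>j<J. p (b j - a j) / ((1 + \<kappa>)\<^sup>2 * Zm (a j) (b j))))
    * (\<Sum>S | S \<in> traj 0 n \<and> (\<forall>j<J. F j S). w S) \<le> Z 0 n"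
proof -
  define q where "q j = p (b j - a j) / ((1 + \<kappa>)\<^sup>2 * Zm (a j) (b j))" for j
  have q0: "q j \<ge> 0" if "j < J" for j
  proof -
    have "p (b j - a j) > 0" "Zm (a j) (b j) > 0"
      using ord[OF that] by (auto intro!: p_pos window_minus_pos)
    then show ?thesis unfolding q_def by simp
  qed
  have ind: "(\<Prod>j\<in>{i..<J}. 1 + q j) * (\<Sum>S | S \<in> traj 0 n \<and> (\<forall>j\<in>{i..<J}. F j S). w S) \<le> Z 0 n" if "i \<le> J" for i
    using that
  proof (induction i rule: inc_induct)
    case base
    then show ?case by (simp add: window_def)
  next
    case (step i)
    let ?E = "\<lambda>S. \<forall>j\<in>{Suc i..<J}. F j S"
    have iJ: "{i..<J} = insert i {Suc i..<J}" using step by auto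
    have "(1 + q i) * (\<Sum>S | S \<in> traj 0 n \<and> ?E S \<and> S \<inter> {s i..a i} \<noteq> {} \<and> S \<inter> {b i..t i} \<noteq> {} \<and> \<not> consecutive S (a i) (b i). w S)
      \<le> (\<Sum>S | S \<in> traj 0 n \<and> ?E S. w S)"
      unfolding q_def
    proof (rule block_inequality[OF _ _ _ _ \<kappa>0 \<kappa>])
      show "?E S = ?E S'" if eq: "S \<inter> {t i..} = S' \<inter> {t i..}" for S S'
      proof (rule ball_cong[OF refl])
        fix j assume j: "j \<in> {Suc i..<J}"
        have o: "t i \<le> s j" "s j \<le> a j" "a j < b j" "b j < t j" using sep[of i j] ord[of j] j by auto
        have mem: "x \<in> S \<longleftrightarrow> x \<in> S'" if "x \<ge> t i" for x using eq that by (auto simp: set_eq_iff)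
        have "S \<inter> {s j..a j} = S' \<inter> {s j..a j}" "S \<inter> {b j..t j} = S' \<inter> {b j..t j}" "S \<inter> {a j<..<b j} = S' \<inter> {a j<..<b j}"
          using mem o by auto
        moreover have "a j \<in> S \<longleftrightarrow> a j \<in> S'" "b j \<in> S \<longleftrightarrow> b j \<in> S'" using mem o by auto
        ultimately show "F j S = F j S'" by (simp add: F_def consecutive_def)
      qed
    qed (use ord[of i] step in auto)
    moreover have "{S. S \<in> traj 0 n \<and> ?E S \<and> S \<inter> {s i..a i} \<noteq> {} \<and> S \<inter> {b i..t i} \<noteq> {} \<and> \<not> consecutive S (a i) (b i)}
       = {S. S \<in> traj 0 n \<and> (\<forall>j\<in>{i..<J}. F j S)}"
      unfolding iJ by (auto simp: F_def)
    ultimately have "(1 + q i) * (\<Sum>S | S \<in> traj 0 n \<and> (\<forall>j\<in>{i..<J}. F j S). w S) \<le> (\<Sum>S | S \<in> traj 0 n \<and> ?E S. w S)"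
      by simp
    then have "(\<Prod>j\<in>{Suc i..<J}. 1 + q j) * ((1 + q i) * (\<Sum>S | S \<in> traj 0 n \<and> (\<forall>j\<in>{i..<J}. F j S). w S))
        \<le> (\<Prod>j\<in>{Suc i..<J}. 1 + q j) * (\<Sum>S | S \<in> traj 0 n \<and> ?E S. w S)"
      by (rule mult_left_mono) (auto intro!: prod_nonneg add_nonneg_nonneg q0)
    also have "\<dots> \<le> Z 0 n" using step by simp
    finally show ?case unfolding iJ by (simp add: mult_ac)
  qed
  have W0: "(\<Sum>S | S \<in> traj 0 n \<and> (\<forall>j<J. F j S). w S) \<ge> 0" by (auto intro!: sum_nonneg weight_nonneg)
  have "1 + (\<Sum>j<J. q j) \<le> (\<Prod>j<J. 1 + q j)"
    using q0
  proof (induction J)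
    case (Suc J)
    then have IH: "1 + (\<Sum>j<J. q j) \<le> (\<Prod>j<J. 1 + q j)" and qJ: "q J \<ge> 0" by auto
    have "0 \<le> (\<Sum>j<J. q j)" by (intro sum_nonneg Suc.prems) auto
    then have "q J * 1 \<le> q J * (\<Prod>j<J. 1 + q j)" using IH qJ by (intro mult_left_mono) auto
    then show ?case using IH by (simp add: distrib_left distrib_right mult.commute)
  qed simp
  from mult_right_mono[OF this W0]
  have "(1 + (\<Sum>j<J. q j)) * (\<Sum>S | S \<in> traj 0 n \<and> (\<forall>j<J. F j S). w S) \<le> Z 0 n"
    by (rule order_trans) (use ind[of 0] in \<open>simp add: atLeast0LessThan Ball_def\<close>)
  then show ?thesis unfolding q_def .
qed

lemma gap_ge_if_empty:
  assumes S: "S \<in> traj 0 n" and e: "S \<inter> {s..a} = {}" and sa: "s \<le> a" "a \<le> n" and R: "R \<le> a - s"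
  shows "gap_ge R S"
proof -
  have fS: "finite S" using S by (rule traj_finite)
  have S0: "0 \<in> S" "n \<in> S" using S by (auto simp: traj_def)
  have s0: "0 < s" "a < n" using S0 e sa by (auto simp: le_less)
  define i where "i = Max {x \<in> S. x < s}"
  define l where "l = Min {x \<in> S. x > a}"
  have i: "i \<in> {x \<in> S. x < s}" unfolding i_def by (rule Max_in) (use fS S0 s0 in auto)
  have l: "l \<in> {x \<in> S. x > a}" unfolding l_def by (rule Min_in) (use fS S0 s0 in auto)
  have imax: "x \<le> i" if "x \<in> S" "x < s" for x unfolding i_def by (rule Max_ge) (use fS that in auto)
  have lmin: "l \<le> x" if "x \<in> S" "x > a" for x unfolding l_def by (rule Min_le) (use fS that in auto)
  have "consecutive S i l"
    unfolding consecutive_def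
  proof (intro conjI equals0I)
    fix x assume x: "x \<in> S \<inter> {i<..<l}"
    then have "\<not> x < s" "\<not> x > a" using imax[of x] lmin[of x] by auto
    then have "x \<in> S \<inter> {s..a}" using x by auto
    then show False using e by auto
  qed (use i l sa in auto)
  moreover have "l - i \<ge> R" using i l R sa by auto
  ultimately show ?thesis by (auto simp: gap_ge_def)
qed

text \<open>A block consists of a potential gap of length \<open>k\<close> between two margins of
  length \<open>R\<close>. A trajectory without any gap of length \<open>R\<close> meets both
  margins of every block, which is what keeps the price \<open>\<kappa>\<close> of forced contacts
  local; the other trajectories are put into the first term.\<close>

lemma sum_no_gap_upper:
  fixes k R J n :: nat
  assumes R: "R \<ge> 1" and k: "k \<ge> 1" and J: "J * (k + 2 * R) \<le> n" and \<kappa>0: "\<kappa> \<ge> 0"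
    and \<kappa>: "\<And>c i l. c \<le> n \<Longrightarrow> i < c \<Longrightarrow> c < l \<Longrightarrow> l - i \<le> k + 2 * R \<Longrightarrow> p (l - i) \<le> \<kappa> * (p (c - i) * v c * p (l - c))"
  shows "(\<Sum>S | S \<in> traj 0 n \<and> \<not> gap_ge k S. w S) \<le> (\<Sum>S | S \<in> traj 0 n \<and> gap_ge R S. w S)
    + Z 0 n / (1 + (\<Sum>j<J. p k / Zm (j * (k + 2 * R) + R) (j * (k + 2 * R) + R + k)) / (1 + \<kappa>)\<^sup>2)"
proof -
  define L where "L = k + 2 * R"
  define s where "s j = j * L" for j
  define a where "a j = j * L + R" for j
  define b where "b j = j * L + R + k" for j
  define t where "t j = (j + 1) * L" for j
  define F where "F j S \<longleftrightarrow> S \<inter> {s j..a j} \<noteq> {} \<and> S \<inter> {b j..t j} \<noteq> {} \<and> \<not> consecutive S (a j) (b j)" for j S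
  have tn: "t j \<le> n" if "j < J" for j
  proof -
    have "(j + 1) * L \<le> J * L" using that by (intro mult_right_mono) auto
    then show ?thesis using J by (simp add: t_def L_def)
  qed
  have ord: "s j \<le> a j \<and> a j < b j \<and> b j < t j \<and> t j \<le> n" if "j < J" for j
    using tn[OF that] k R by (auto simp: s_def a_def b_def t_def L_def)
  have sep: "t i \<le> s j" if "i < j" for i j
    using that unfolding t_def s_def by (intro mult_right_mono) auto
  have fin: "finite {S. S \<in> traj 0 n \<and> X S}" for X
    by (rule finite_subset[OF _ finite_traj[of 0 n]]) auto
  have main: "(1 + (\<Sum>j<J. p (b j - a j) / ((1 + \<kappa>)\<^sup>2 * Zm (a j) (b j)))) * (\<Sum>S | S \<in> traj 0 n \<and> (\<forall>j<J. F j S). w S) \<le> Z 0 n"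
    unfolding F_def
  proof (rule blocks_inequality[OF ord sep \<kappa>0])
    fix j c i l assume h: "j < J" "c \<in> {a j, b j}" "s j \<le> i" "i < c" "c < l" "l \<le> t j"
    show "p (l - i) \<le> \<kappa> * (p (c - i) * v c * p (l - c))"
    proof (rule \<kappa>)
      show "c \<le> n" using h ord[of j] by auto
      show "l - i \<le> k + 2 * R" using h by (auto simp: t_def s_def L_def)
    qed (use h in auto)
  qed
  have sum_eq: "(\<Sum>j<J. p (b j - a j) / ((1 + \<kappa>)\<^sup>2 * Zm (a j) (b j))) = (\<Sum>j<J. p k / Zm (a j) (b j)) / (1 + \<kappa>)\<^sup>2"
    by (simp add: sum_divide_distrib a_def b_def mult.commute)
  have nn: "0 \<le> (\<Sum>j<J. p k / Zm (a j) (b j)) / (1 + \<kappa>)\<^sup>2"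
    using k p_pos[of k] window_minus_pos ord by (intro divide_nonneg_nonneg sum_nonneg) (auto simp: less_imp_le)
  have "(\<Sum>S | S \<in> traj 0 n \<and> \<not> gap_ge k S. w S)
     \<le> (\<Sum>S\<in>{S. S \<in> traj 0 n \<and> gap_ge R S} \<union> {S. S \<in> traj 0 n \<and> (\<forall>j<J. F j S)}. w S)"
  proof (rule sum_mono2)
    show "{S. S \<in> traj 0 n \<and> \<not> gap_ge k S} \<subseteq> {S. S \<in> traj 0 n \<and> gap_ge R S} \<union> {S. S \<in> traj 0 n \<and> (\<forall>j<J. F j S)}"
    proof
      fix S assume S: "S \<in> {S. S \<in> traj 0 n \<and> \<not> gap_ge k S}"
      have "F j S" if nR: "\<not> gap_ge R S" and j: "j < J" for j
        unfolding F_def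
      proof (intro conjI notI)
        assume "S \<inter> {s j..a j} = {}"
        then have "gap_ge R S" using S ord[OF j] by (intro gap_ge_if_empty) (auto simp: s_def a_def)
        then show False using nR by simp
      next
        assume "S \<inter> {b j..t j} = {}"
        then have "gap_ge R S" using S ord[OF j] by (intro gap_ge_if_empty) (auto simp: b_def t_def L_def)
        then show False using nR by simp
      next
        assume "consecutive S (a j) (b j)"
        then have "gap_ge k S" unfolding gap_ge_def by (intro exI[of _ "a j"] exI[of _ "b j"]) (auto simp: a_def b_def)
        then show False using S by simp
      qed
      then show "S \<in> {S. S \<in> traj 0 n \<and> gap_ge R S} \<union> {S. S \<in> traj 0 n \<and> (\<forall>j<J. F j S)}" using S by auto
    qed
  qed (auto intro: fin weight_nonneg)
  also have "\<dots> \<le> (\<Sum>S | S \<in> traj 0 n \<and> gap_ge R S. w S) + (\<Sum>S | S \<in> traj 0 n \<and> (\<forall>j<J. F j S). w S)"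
    by (subst sum.union_inter[symmetric]) (auto intro!: fin sum_nonneg weight_nonneg)
  also have "(\<Sum>S | S \<in> traj 0 n \<and> (\<forall>j<J. F j S). w S) \<le> Z 0 n / (1 + (\<Sum>j<J. p k / Zm (a j) (b j)) / (1 + \<kappa>)\<^sup>2)"
    using main nn unfolding sum_eq by (subst pos_le_divide_eq) (auto simp: mult.commute)
  finally show ?thesis by (simp add: a_def b_def L_def add.assoc)
qed

end

section \<open>Translation and dependence on the disorder\<close>

abbreviation boltzmann :: "real \<Rightarrow> (nat \<Rightarrow> real) \<Rightarrow> nat \<Rightarrow> real" where
  "boltzmann h \<omega> \<equiv> \<lambda>c. exp (h + \<omega> c)"

lemma prev_shift:
  assumes "finite S" "b \<in> S - {Min S}"
  shows "prev ((\<lambda>c. c + m) ` S) (b + m) = prev S b + m"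
proof -
  have eq: "{a \<in> (\<lambda>c. c + m) ` S. a < b + m} = (\<lambda>c. c + m) ` {a \<in> S. a < b}" by auto
  have "Min S \<in> S" "Min S \<le> b" using assms by (auto intro: Min_in Min_le)
  then have "Min S \<in> {a \<in> S. a < b}" using assms(2) by (auto simp: le_less)
  then have ne: "{a \<in> S. a < b} \<noteq> {}" by blast
  have "Max ((\<lambda>c. c + m) ` {a \<in> S. a < b}) = Max {a \<in> S. a < b} + m"
    by (rule mono_Max_commute[symmetric]) (use assms(1) ne in \<open>auto simp: mono_def\<close>)
  then show ?thesis unfolding prev_def eq .
qed

lemma weight_shift:
  assumes "finite S" "S \<noteq> {}"
  shows "weight p v ((\<lambda>c. c + m) ` S) = weight p (\<lambda>c. v (c + m)) S"
proof -
  have Mn: "Min ((\<lambda>c. c + m) ` S) = Min S + m"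
    by (rule mono_Min_commute[symmetric]) (use assms in \<open>auto simp: mono_def\<close>)
  have eq: "(\<lambda>c. c + m) ` S - {Min S + m} = (\<lambda>c. c + m) ` (S - {Min S})" by auto
  have "weight p v ((\<lambda>c. c + m) ` S) = (\<Prod>b\<in>S - {Min S}. p (b + m - prev ((\<lambda>c. c + m) ` S) (b + m)) * v (b + m))"
    unfolding weight_def Mn eq by (subst prod.reindex) (auto intro: inj_onI)
  also have "\<dots> = weight p (\<lambda>c. v (c + m)) S"
    unfolding weight_def using prev_shift[OF assms(1), of _ m] by (intro prod.cong refl) simp
  finally show ?thesis .
qed

lemma traj_shift: "traj (a + m) (b + m) = image (\<lambda>c. c + m) ` traj a b"
proof (intro equalityI subsetI)
  fix S assume S: "S \<in> traj (a + m) (b + m)"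
  have "S = (\<lambda>c. c + m) ` ((\<lambda>c. c - m) ` S)"
    using S unfolding image_image traj_def by (force simp: image_iff)
  moreover have "(\<lambda>c. c - m) ` S \<in> traj a b"
    using S unfolding traj_def by (force simp: image_iff)
  ultimately show "S \<in> image (\<lambda>c. c + m) ` traj a b" by blast
qed (auto simp: traj_def)

lemma window_shift: "window p v (a + m) (b + m) = window p (\<lambda>c. v (c + m)) a b"
proof -
  have inj: "inj_on (image (\<lambda>c. c + m)) (traj a b)"
    by (intro inj_onI) (simp add: inj_image_eq_iff inj_def)
  show ?thesis
    unfolding window_def traj_shift sum.reindex[OF inj] comp_def
    by (intro sum.cong refl weight_shift) (auto simp: traj_def intro: finite_subset)
qed

lemma window_minus_shift: "window_minus p v (a + m) (b + m) = window_minus p (\<lambda>c. v (c + m)) a b"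
  by (simp add: window_minus_def window_shift)

lemma window_boltzmann:
  "window p (boltzmann h \<omega>) a b = (\<Sum>S\<in>traj a b. weight p (\<lambda>_. 1) S * exp (\<Sum>c\<in>S - {a}. h + \<omega> c))"
  unfolding window_def
proof (rule sum.cong[OF refl])
  fix S assume S: "S \<in> traj a b"
  then show "weight p (boltzmann h \<omega>) S = weight p (\<lambda>_. 1) S * exp (\<Sum>c\<in>S - {a}. h + \<omega> c)"
    using traj_finite[OF S] by (simp add: weight_def traj_Min[OF S] prod.distrib exp_sum)
qed

text \<open>The case \<open>a = b\<close> is different: there the only trajectory has no factor at
  \<open>b\<close>, and the division would not cancel anything.\<close>

lemma window_minus_boltzmann:
  assumes ab: "a < b"
  shows "window_minus p (boltzmann h \<omega>) a b = (\<Sum>S\<in>traj a b. weight p (\<lambda>_. 1) S * exp (\<Sum>c\<in>S - {a, b}. h + \<omega> c))"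
  unfolding window_minus_def window_boltzmann sum_divide_distrib
proof (rule sum.cong[OF refl])
  fix S assume S: "S \<in> traj a b"
  then have "S - {a} = insert b (S - {a, b})" using ab by (auto simp: traj_def)
  then have "(\<Sum>c\<in>S - {a}. h + \<omega> c) = (h + \<omega> b) + (\<Sum>c\<in>S - {a, b}. h + \<omega> c)"
    using traj_finite[OF S] by simp
  then have "exp (\<Sum>c\<in>S - {a}. h + \<omega> c) = exp (h + \<omega> b) * exp (\<Sum>c\<in>S - {a, b}. h + \<omega> c)" by (simp only: exp_add)
  then show "weight p (\<lambda>_. 1) S * exp (\<Sum>c\<in>S - {a}. h + \<omega> c) / exp (h + \<omega> b)
      = weight p (\<lambda>_. 1) S * exp (\<Sum>c\<in>S - {a, b}. h + \<omega> c)" by simp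
qed

sublocale renewal_weights \<subseteq> B: pinning_weights p "boltzmann h \<omega>" for h \<omega>
  by standard simp

sublocale renewal_weights \<subseteq> U: pinning_weights p "\<lambda>_. 1"
  by standard simp

context renewal_weights
begin

lemma weight_unit_bounds: "S \<in> traj a b \<Longrightarrow> 0 < weight p (\<lambda>_. 1) S \<and> weight p (\<lambda>_. 1) S \<le> 1"
proof
  assume S: "S \<in> traj a b"
  show "0 < weight p (\<lambda>_. 1) S" by (rule U.weight_pos[OF traj_finite[OF S]])
  show "weight p (\<lambda>_. 1) S \<le> 1" unfolding weight_def
  proof (rule prod_le_1)
    fix c assume c: "c \<in> S - {Min S}"
    have fS: "finite S" by (rule traj_finite[OF S])
    have "Min S \<in> S" "Min S \<le> c" using c fS by (auto intro: Min_in Min_le)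
    then have "Min S \<in> {a \<in> S. a < c}" using c by (auto simp: le_less)
    then have "{a \<in> S. a < c} \<noteq> {}" by blast
    then have "prev S c < c" unfolding prev_def using Max_in[of "{a \<in> S. a < c}"] fS by auto
    then have "1 \<le> c - prev S c" by simp
    then show "0 \<le> p (c - prev S c) * 1 \<and> p (c - prev S c) * 1 \<le> 1"
      using p_pos[of "c - prev S c"] p_le_1[of "c - prev S c"] by simp
  qed
qed

lemma window_minus_mono:
  assumes "h \<le> h'" and ab: "a < b"
  shows "window_minus p (boltzmann h \<omega>) a b \<le> window_minus p (boltzmann h' \<omega>) a b"
  unfolding window_minus_boltzmann[OF ab]
  using assms weight_unit_bounds by (intro sum_mono mult_left_mono) (auto intro!: sum_mono simp: less_imp_le)

lemma window_mono:
  assumes "h \<le> h'"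
  shows "window p (boltzmann h \<omega>) a b \<le> window p (boltzmann h' \<omega>) a b"
  unfolding window_boltzmann
  using assms weight_unit_bounds by (intro sum_mono mult_left_mono) (auto intro!: sum_mono simp: less_imp_le)

text \<open>A trajectory has at most \<open>b - a\<close> contacts in the window, and each of them
  gains a factor \<open>exp (h' - h)\<close>.\<close>

lemma window_minus_lipschitz:
  assumes h: "h \<le> h'" and ab: "a < b"
  shows "window_minus p (boltzmann h' \<omega>) a b \<le> exp (real (b - a) * (h' - h)) * window_minus p (boltzmann h \<omega>) a b"
  unfolding window_minus_boltzmann[OF ab] sum_distrib_left
proof (rule sum_mono)
  fix S assume S: "S \<in> traj a b"
  have "card (S - {a, b}) \<le> card {a<..b}"
    by (rule card_mono) (use S in \<open>auto simp: traj_def\<close>)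
  then have "real (card (S - {a, b})) * (h' - h) \<le> real (b - a) * (h' - h)"
    using h by (intro mult_right_mono) auto
  moreover have "(\<Sum>c\<in>S - {a, b}. h' + \<omega> c) = real (card (S - {a, b})) * (h' - h) + (\<Sum>c\<in>S - {a, b}. h + \<omega> c)"
    by (simp add: sum.distrib algebra_simps)
  ultimately have "exp (\<Sum>c\<in>S - {a, b}. h' + \<omega> c) \<le> exp (real (b - a) * (h' - h) + (\<Sum>c\<in>S - {a, b}. h + \<omega> c))"
    by simp
  then have "weight p (\<lambda>_. 1) S * exp (\<Sum>c\<in>S - {a, b}. h' + \<omega> c)
     \<le> weight p (\<lambda>_. 1) S * exp (real (b - a) * (h' - h) + (\<Sum>c\<in>S - {a, b}. h + \<omega> c))"
    using weight_unit_bounds[OF S] by (intro mult_left_mono) auto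
  then show "weight p (\<lambda>_. 1) S * exp (\<Sum>c\<in>S - {a, b}. h' + \<omega> c)
     \<le> exp (real (b - a) * (h' - h)) * (weight p (\<lambda>_. 1) S * exp (\<Sum>c\<in>S - {a, b}. h + \<omega> c))"
    by (simp add: exp_add mult_ac)
qed

lemma card_traj_le: "card (traj 0 n) \<le> 2 ^ (n + 1)"
proof -
  have "card (traj 0 n) \<le> card (Pow {0..n})" by (rule card_mono) (auto simp: traj_def)
  then show ?thesis by (simp add: card_Pow)
qed

lemma ln_window_minus_le:
  assumes n: "n \<ge> 1"
  shows "ln (window_minus p (boltzmann h \<omega>) 0 n) \<le> real (n + 1) * ln 2 + real n * \<bar>h\<bar> + (\<Sum>c\<in>{1..n}. \<bar>\<omega> c\<bar>)"
proof -
  define E where "E = exp (real n * \<bar>h\<bar> + (\<Sum>c\<in>{1..n}. \<bar>\<omega> c\<bar>))"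
  have "window_minus p (boltzmann h \<omega>) 0 n \<le> (\<Sum>S\<in>traj 0 n. 1 * E)"
    unfolding window_minus_boltzmann[of 0 n p h \<omega>, OF less_le_trans[OF zero_less_one n]]
  proof (intro sum_mono mult_mono)
    fix S assume S: "S \<in> traj 0 n"
    have "(\<Sum>c\<in>S - {0, n}. h + \<omega> c) \<le> (\<Sum>c\<in>S - {0, n}. \<bar>h\<bar> + \<bar>\<omega> c\<bar>)" by (rule sum_mono) auto
    also have "\<dots> \<le> (\<Sum>c\<in>{1..n}. \<bar>h\<bar> + \<bar>\<omega> c\<bar>)"
      by (rule sum_mono2) (use S in \<open>auto simp: traj_def Suc_le_eq\<close>)
    also have "\<dots> = real n * \<bar>h\<bar> + (\<Sum>c\<in>{1..n}. \<bar>\<omega> c\<bar>)" by (simp add: sum.distrib)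
    finally show "exp (\<Sum>c\<in>S - {0, n}. h + \<omega> c) \<le> E" by (simp add: E_def)
  qed (use weight_unit_bounds in \<open>auto simp: less_imp_le\<close>)
  also have "\<dots> \<le> 2 ^ (n + 1) * E"
  proof -
    have "real (card (traj 0 n)) \<le> real (2 ^ (n + 1))" using card_traj_le by (rule of_nat_mono)
    then have "real (card (traj 0 n)) * E \<le> 2 ^ (n + 1) * E" by (intro mult_right_mono) (auto simp: E_def)
    then show ?thesis by simp
  qed
  finally have "ln (window_minus p (boltzmann h \<omega>) 0 n) \<le> ln (2 ^ (n + 1) * E)"
    using B.window_minus_pos[of 0 n h \<omega>] by (subst ln_le_cancel_iff) (auto simp: E_def)
  also have "\<dots> = real (n + 1) * ln 2 + ln E" by (simp add: ln_mult ln_realpow E_def del: power_Suc)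
  finally show ?thesis by (simp add: E_def)
qed

end

subsection \<open>The renewal process\<close>

locale renewal_process = prob_space M for M :: "'a measure" +
  fixes T :: "nat \<Rightarrow> 'a \<Rightarrow> nat" and p :: "nat \<Rightarrow> real"
  assumes iid: "iid_positive_times M T p"
    and p_positive: "\<And>t. t \<ge> 1 \<Longrightarrow> p t > 0"
begin

lemma T_ge_1: "i \<ge> 1 \<Longrightarrow> x \<in> space M \<Longrightarrow> T i x \<ge> 1"
  using iid by (auto simp: iid_positive_times_def)

lemma T_law: "i \<ge> 1 \<Longrightarrow> t \<ge> 1 \<Longrightarrow> prob {x \<in> space M. T i x = t} = p t"
  using iid by (auto simp: iid_positive_times_def)

lemma T_indep: "indep_vars (\<lambda>_. count_space UNIV) T {1..}"
  using iid by (auto simp: iid_positive_times_def)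

lemma T_measurable: "i \<ge> 1 \<Longrightarrow> T i \<in> measurable M (count_space UNIV)"
  using T_indep by (auto simp: indep_vars_def2)

lemma law_le_1: "t \<ge> 1 \<Longrightarrow> p t \<le> 1"
  using T_law[of 1 t] prob_le_1 by (metis order_refl)

lemma renewal_0 [simp]: "renewal T 0 x = 0"
  by (simp add: renewal_def)

lemma renewal_Suc [simp]: "renewal T (Suc i) x = renewal T i x + T (Suc i) x"
  by (simp add: renewal_def)

lemma renewal_strict_mono: "x \<in> space M \<Longrightarrow> strict_mono (\<lambda>i. renewal T i x)"
  unfolding strict_mono_Suc_iff
proof
  fix i assume "x \<in> space M"
  then show "renewal T i x < renewal T (Suc i) x" using T_ge_1[of "Suc i" x] by simp
qed

definition config :: "nat \<Rightarrow> 'a \<Rightarrow> nat set" where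
  "config n x = range (\<lambda>i. renewal T i x) \<inter> {..n}"

text \<open>Positive inter-arrival times make this set of indices finite and downward closed, and it
  contains 0, so the \<open>Sup\<close> in \<open>num_contacts\<close> is an attained
  maximum.\<close>

lemma renewal_le_atMost:
  assumes x: "x \<in> space M"
  shows "{i. renewal T i x \<le> n} = {..num_contacts T n x}"
proof -
  note sm = renewal_strict_mono[OF x]
  have inc: "i \<le> renewal T i x" for i using strict_mono_imp_increasing[OF sm] by simp
  have "{i. renewal T i x \<le> n} \<subseteq> {..n}"
    using le_trans[OF inc] by blast
  then have fin: "finite {i. renewal T i x \<le> n}" by (rule finite_subset) simp
  have ne: "{i. renewal T i x \<le> n} \<noteq> {}" by (auto intro: exI[of _ 0])
  have N: "num_contacts T n x = Max {i. renewal T i x \<le> n}"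
    unfolding num_contacts_def by (rule cSup_eq_Max[OF fin ne])
  have K: "renewal T (num_contacts T n x) x \<le> n" using Max_in[OF fin ne] unfolding N by blast
  show ?thesis
  proof (intro equalityI subsetI)
    fix i assume "i \<in> {i. renewal T i x \<le> n}"
    then show "i \<in> {..num_contacts T n x}" unfolding N using Max_ge[OF fin] by simp
  next
    fix i assume "i \<in> {..num_contacts T n x}"
    then have "renewal T i x \<le> renewal T (num_contacts T n x) x" using strict_mono_less_eq[OF sm] by simp
    then show "i \<in> {i. renewal T i x \<le> n}" using K by simp
  qed
qed

lemma config_eq_image:
  assumes "x \<in> space M"
  shows "config n x = (\<lambda>i. renewal T i x) ` {..num_contacts T n x}"
  unfolding renewal_le_atMost[OF assms, symmetric] config_def by auto

lemma config_traj: "x \<in> space M \<Longrightarrow> n \<in> config n x \<Longrightarrow> config n x \<in> traj 0 n"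
  by (auto simp: config_def traj_def intro: range_eqI[of _ _ 0])

text \<open>Strict monotonicity identifies consecutive contacts with consecutive renewal times. For
  \<open>m = 0\<close> the right side always holds, whereas a configuration with 0 as its only
  contact has no gap at all.\<close>

lemma gap_ge_config_iff:
  assumes x: "x \<in> space M" and m: "m \<ge> 1"
  shows "gap_ge m (config n x) \<longleftrightarrow> max_gap T n x \<ge> m"
proof -
  note sm = renewal_strict_mono[OF x]
  let ?K = "num_contacts T n x"
  let ?G = "{T i x | i. 1 \<le> i \<and> i \<le> ?K}"
  have fin: "finite ?G" by (rule finite_subset[of _ "(\<lambda>i. T i x) ` {..?K}"]) auto
  show ?thesis
  proof
    assume "gap_ge m (config n x)"
    then obtain a b where ab: "consecutive (config n x) a b" "b - a \<ge> m" by (auto simp: gap_ge_def)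
    then obtain i j where ij: "i \<le> ?K" "j \<le> ?K" "a = renewal T i x" "b = renewal T j x"
      unfolding consecutive_def config_eq_image[OF x] by auto
    have "i < j" using ab ij strict_mono_less[OF sm] by (auto simp: consecutive_def)
    have "\<not> Suc i < j"
    proof
      assume "Suc i < j"
      then have "renewal T (Suc i) x \<in> config n x \<inter> {a<..<b}"
        unfolding config_eq_image[OF x] using ij strict_mono_less[OF sm]
        by (auto simp del: renewal_Suc intro!: imageI)
      then show False using ab by (auto simp: consecutive_def)
    qed
    then have "j = Suc i" using \<open>i < j\<close> by simp
    then have "T j x \<in> ?G" "m \<le> T j x" using ij ab by auto
    then show "m \<le> max_gap T n x" unfolding max_gap_def using cSup_upper[of "T j x" ?G] fin by force
  next
    assume mg: "m \<le> max_gap T n x"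
    have ne: "?G \<noteq> {}"
    proof
      assume "?G = {}"
      then have "max_gap T n x = 0" unfolding max_gap_def by (simp only: Sup_nat_empty)
      then show False using mg m by simp
    qed
    have "max_gap T n x \<in> ?G" unfolding max_gap_def cSup_eq_Max[OF fin ne] by (rule Max_in[OF fin ne])
    then obtain i where i: "1 \<le> i" "i \<le> ?K" "T i x = max_gap T n x" by auto
    then obtain i' where i': "i = Suc i'" by (cases i) auto
    have "consecutive (config n x) (renewal T i' x) (renewal T i x)"
      unfolding consecutive_def
    proof (intro conjI equals0I)
      show "renewal T i' x \<in> config n x" "renewal T i x \<in> config n x"
        unfolding config_eq_image[OF x] using i i' by (auto simp del: renewal_Suc)
      show "renewal T i' x < renewal T i x" using strict_mono_less[OF sm] i' by (auto simp del: renewal_Suc)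
      fix y assume "y \<in> config n x \<inter> {renewal T i' x<..<renewal T i x}"
      then obtain l where "renewal T i' x < renewal T l x" "renewal T l x < renewal T i x" by (auto simp: config_def)
      then have "i' < l" "l < Suc i'" using strict_mono_less[OF sm] i' by (auto simp del: renewal_Suc)
      then show False by simp
    qed
    moreover have "renewal T i x - renewal T i' x \<ge> m" using i i' mg by simp
    ultimately show "gap_ge m (config n x)" by (auto simp: gap_ge_def)
  qed
qed

text \<open>The event prescribes precisely the increments of \<open>S\<close>: as \<open>n\<close>
  belongs to \<open>S\<close>, the following renewal exceeds \<open>n\<close> by itself.
  Independence turns the prescription into the product in \<open>weight\<close>.\<close>

lemma prob_config:
  assumes S: "S \<in> traj 0 n" and n: "n \<ge> 1"
  shows "{x \<in> space M. config n x = S} \<in> events"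
    and "prob {x \<in> space M. config n x = S} = weight p (\<lambda>_. 1) S"
proof -
  define xs where "xs = sorted_list_of_set S"
  have fS: "finite S" using S by (rule traj_finite)
  have xs: "set xs = S" "sorted xs" "distinct xs" "length xs = card S" unfolding xs_def using fS by auto
  have S0: "0 \<in> S" "n \<in> S" "S \<subseteq> {..n}" using S by (auto simp: traj_def)
  have "card {0, n} \<le> card S" by (rule card_mono[OF fS]) (use S0 in auto)
  then have cS: "card S \<ge> 2" using n by simp
  define k where "k = card S - 1"
  have k: "length xs = Suc k" "k \<ge> 1" using xs cS by (auto simp: k_def)
  have mono: "xs ! i < xs ! j" if "i < j" "j \<le> k" for i j
    using xs that k sorted_wrt_nth_less[of "(<)" xs i j] by (auto simp: strict_sorted_iff)
  have xs0: "xs ! 0 = 0"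
  proof -
    obtain i where "i \<le> k" "xs ! i = 0" using S0 xs k by (metis in_set_conv_nth less_Suc_eq_le)
    then show ?thesis using mono[of 0 i] by (cases i) auto
  qed
  have xsk: "xs ! k = n"
  proof -
    obtain i where i: "i \<le> k" "xs ! i = n" using S0 xs k by (metis in_set_conv_nth less_Suc_eq_le)
    have "xs ! k \<in> S" using xs k by (metis lessI nth_mem)
    then have "xs ! k \<le> n" using S0 by auto
    then show ?thesis using mono[of i k] i by (cases "i = k") auto
  qed
  define t where "t i = xs ! i - xs ! (i - 1)" for i
  have t1: "t i \<ge> 1" if "i \<in> {1..k}" for i using mono[of "i - 1" i] that by (simp add: t_def)
  have iff: "config n x = S \<longleftrightarrow> (\<forall>i\<in>{1..k}. T i x = t i)" if x: "x \<in> space M" for x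
  proof
    note sm = renewal_strict_mono[OF x]
    assume eq: "config n x = S"
    define ys where "ys = map (\<lambda>i. renewal T i x) [0..<Suc (num_contacts T n x)]"
    have "set ys = S"
      using eq unfolding config_eq_image[OF x] ys_def by (simp add: atLeast0LessThan lessThan_Suc_atMost del: upt_Suc)
    moreover have "sorted_wrt (<) ys"
      unfolding ys_def sorted_wrt_map using sm
      by (auto simp: strict_mono_def sorted_wrt_iff_nth_less simp del: upt_Suc)
    ultimately have "xs = ys"
      using xs by (intro sorted_distinct_set_unique) (auto simp: strict_sorted_iff)
    then have nth: "renewal T i x = xs ! i" if "i \<le> k" for i
      using that k unfolding ys_def by (simp del: upt_Suc)
    show "\<forall>i\<in>{1..k}. T i x = t i"
    proof
      fix i assume i: "i \<in> {1..k}"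
      then obtain j where j: "i = Suc j" by (cases i) auto
      show "T i x = t i" using nth[of i] nth[of j] i unfolding j t_def by simp
    qed
  next
    note sm = renewal_strict_mono[OF x]
    assume *: "\<forall>i\<in>{1..k}. T i x = t i"
    have nth: "renewal T i x = xs ! i" if "i \<le> k" for i
      using that
    proof (induction i)
      case 0
      then show ?case using xs0 by simp
    next
      case (Suc i)
      then show ?case using * mono[of i "Suc i"] by (simp add: t_def)
    qed
    have "{i. renewal T i x \<le> n} = {..k}"
      using strict_mono_less_eq[OF sm, of _ k] nth[of k] xsk by auto
    then have "config n x = (\<lambda>i. renewal T i x) ` {..k}"
      unfolding config_eq_image[OF x] using renewal_le_atMost[OF x, of n] by simp
    also have "\<dots> = (\<lambda>i. xs ! i) ` {..k}" using nth by (intro image_cong) auto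
    also have "\<dots> = S" using xs(1) k by (auto simp: set_conv_nth less_Suc_eq_le)
    finally show "config n x = S" .
  qed
  have ev: "{x \<in> space M. config n x = S} = (\<Inter>i\<in>{1..k}. T i -` {t i} \<inter> space M)"
    using iff k by auto
  have meas: "T i -` {t i} \<inter> space M \<in> events" if "i \<in> {1..k}" for i
    using T_measurable[of i] that by (intro measurable_sets[of _ _ "count_space UNIV"]) auto
  show "{x \<in> space M. config n x = S} \<in> events"
    unfolding ev using k meas by (intro sets.finite_INT) auto
  have Mn: "Min S = 0" using S by (rule traj_Min)
  have bij: "bij_betw (\<lambda>i. xs ! i) {1..k} (S - {Min S})"
      unfolding bij_betw_def
    proof
      show "inj_on (\<lambda>i. xs ! i) {1..k}" using xs k by (intro inj_on_nth) auto
      show "(\<lambda>i. xs ! i) ` {1..k} = S - {Min S}"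
      proof -
        have "S = (\<lambda>i. xs ! i) ` {0..k}" using xs(1) k by (auto simp: set_conv_nth less_Suc_eq_le)
        also have "{0..k} = insert 0 {1..k}" by auto
        finally have "S = insert 0 ((\<lambda>i. xs ! i) ` {1..k})" using xs0 by simp
        moreover have "0 \<notin> (\<lambda>i. xs ! i) ` {1..k}" 
        proof
          assume "0 \<in> (\<lambda>i. xs ! i) ` {1..k}"
          then obtain i where "i \<in> {1..k}" "xs ! i = 0" by auto
          then show False using mono[of 0 i] by simp
        qed
        ultimately show ?thesis unfolding Mn by blast
      qed
    qed
  have "prob (\<Inter>i\<in>{1..k}. T i -` {t i} \<inter> space M) = (\<Prod>i\<in>{1..k}. prob (T i -` {t i} \<inter> space M))"
    using k by (intro indep_varsD[OF T_indep]) auto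
  also have "\<dots> = (\<Prod>i\<in>{1..k}. p (t i))"
  proof (rule prod.cong[OF refl])
    fix i assume i: "i \<in> {1..k}"
    have "T i -` {t i} \<inter> space M = {x \<in> space M. T i x = t i}" by auto
    then show "prob (T i -` {t i} \<inter> space M) = p (t i)" using T_law[of i "t i"] t1[OF i] i by simp
  qed
  also have "(\<Prod>i\<in>{1..k}. p (t i)) = (\<Prod>i\<in>{1..k}. p (xs ! i - prev S (xs ! i)))"
    proof (rule prod.cong[OF refl])
      fix i assume i: "i \<in> {1..k}"
      have "prev S (xs ! i) = xs ! (i - 1)"
        unfolding prev_def
      proof (rule Max_eqI)
        show "finite {a \<in> S. a < xs ! i}" using fS by auto
        show "xs ! (i - 1) \<in> {a \<in> S. a < xs ! i}" using mono[of "i - 1" i] xs(1) i k by auto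
        fix a assume "a \<in> {a \<in> S. a < xs ! i}"
        then obtain j where j: "j \<le> k" "a = xs ! j" "xs ! j < xs ! i"
          using xs(1) k by (auto simp: set_conv_nth less_Suc_eq_le)
        then have "j < i" using mono[of i j] i by (cases j i rule: linorder_cases) auto
        then show "a \<le> xs ! (i - 1)" using mono[of j "i - 1"] i j by (cases "j = i - 1") (auto simp: less_imp_le)
      qed
      then show "p (t i) = p (xs ! i - prev S (xs ! i))" by (simp add: t_def)
    qed
  also have "\<dots> = (\<Prod>b\<in>S - {Min S}. p (b - prev S b))"
    by (rule prod.reindex_bij_betw[OF bij])
  finally show "prob {x \<in> space M. config n x = S} = weight p (\<lambda>_. 1) S"
    unfolding ev weight_def by simp
qed

lemma weight_factor: "weight p v S = weight p (\<lambda>_. 1) S * (\<Prod>b\<in>S - {Min S}. v b)"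
  by (simp add: weight_def prod.distrib)

lemma pinning_weight_eq:
  assumes x: "x \<in> space M"
  shows "pinning_weight T n h \<omega> x
    = (\<Sum>S\<in>traj 0 n. (\<Prod>b\<in>S - {Min S}. boltzmann h \<omega> b) * indicator {x \<in> space M. config n x = S} x)"
proof (cases "n \<in> config n x")
  case True
  note S = config_traj[OF x True]
  have c: "contact T a x = indicator (config n x) a" if "a \<le> n" for a
    using that by (simp add: contact_def config_def indicator_def)
  have "(\<Sum>a\<in>{1..n}. (h + \<omega> a) * contact T a x) = (\<Sum>a\<in>{1..n}. (h + \<omega> a) * indicator (config n x) a)"
    by (intro sum.cong) (auto simp: c)
  also have "\<dots> = (\<Sum>a\<in>config n x - {Min (config n x)}. h + \<omega> a)"
    unfolding traj_Min[OF S]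
    by (rule sum.mono_neutral_cong_right) (use S in \<open>auto simp: traj_def indicator_def\<close>)
  finally have "pinning_weight T n h \<omega> x = (\<Prod>b\<in>config n x - {Min (config n x)}. boltzmann h \<omega> b)"
    using c[of n] True traj_finite[OF S] by (simp add: pinning_weight_def exp_sum)
  also have "\<dots> = (\<Sum>S\<in>traj 0 n. if S = config n x then (\<Prod>b\<in>S - {Min S}. boltzmann h \<omega> b) else 0)"
    using S by simp
  also have "\<dots> = (\<Sum>S\<in>traj 0 n. (\<Prod>b\<in>S - {Min S}. boltzmann h \<omega> b) * indicator {x \<in> space M. config n x = S} x)"
    by (intro sum.cong refl) (use x in \<open>auto simp: indicator_def\<close>)
  finally show ?thesis .
next
  case False
  then have "contact T n x = 0" by (auto simp: contact_def config_def indicator_def)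
  moreover have "indicator {x \<in> space M. config n x = S} x = (0::real)" if "S \<in> traj 0 n" for S
    using False that by (auto simp: traj_def indicator_def)
  ultimately show ?thesis by (simp add: pinning_weight_def)
qed

lemma partition_function_eq:
  assumes n: "n \<ge> 1"
  shows "partition_function M T n h \<omega> = window p (boltzmann h \<omega>) 0 n"
proof -
  have "partition_function M T n h \<omega> = (\<integral>x. (\<Sum>S\<in>traj 0 n. (\<Prod>b\<in>S - {Min S}. boltzmann h \<omega> b) * indicator {x \<in> space M. config n x = S} x) \<partial>M)"
    unfolding partition_function_def by (intro Bochner_Integration.integral_cong refl pinning_weight_eq)
  also have "\<dots> = (\<Sum>S\<in>traj 0 n. (\<Prod>b\<in>S - {Min S}. boltzmann h \<omega> b) * weight p (\<lambda>_. 1) S)"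
    using prob_config[OF _ n] by (subst Bochner_Integration.integral_sum) (auto simp: less_top[symmetric])
  finally show ?thesis unfolding window_def weight_factor[of "boltzmann h \<omega>"] by (simp add: mult.commute)
qed

lemma gibbs_measure_upper:
  assumes n: "n \<ge> 1" and PE: "\<And>x. x \<in> space M \<Longrightarrow> P x \<Longrightarrow> E (config n x)"
  shows "measure (gibbs_measure M T n h \<omega>) {x \<in> space (gibbs_measure M T n h \<omega>). P x}
    \<le> (\<Sum>S | S \<in> traj 0 n \<and> E S. weight p (boltzmann h \<omega>) S) / window p (boltzmann h \<omega>) 0 n"
proof -
  let ?Z = "window p (boltzmann h \<omega>) 0 n"
  let ?v = "\<lambda>S. \<Prod>b\<in>S - {Min S}. boltzmann h \<omega> b"
  interpret pinning_weights p "boltzmann h \<omega>"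
    by standard (auto intro: p_positive law_le_1)
  have Z: "?Z > 0" by (rule window_pos) simp
  let ?A = "{x \<in> space M. P x}"
  let ?D = "gibbs_measure M T n h \<omega>"
  have fin: "finite {S. S \<in> traj 0 n \<and> E S}" by (rule finite_subset[OF _ finite_traj[of 0 n]]) auto
  have v0: "?v S \<ge> 0" for S by (intro prod_nonneg) auto
  have Sum0: "0 \<le> (\<Sum>S | S \<in> traj 0 n \<and> E S. weight p (boltzmann h \<omega>) S) / ?Z"
    using Z by (intro divide_nonneg_pos sum_nonneg) (auto intro: weight_nonneg)
  have pw: "(\<lambda>x. ennreal (pinning_weight T n h \<omega> x / partition_function M T n h \<omega>)) \<in> borel_measurable M"
  proof -
    have "(\<lambda>x. \<Sum>S\<in>traj 0 n. ?v S * indicator {x \<in> space M. config n x = S} x) \<in> borel_measurable M"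
      using prob_config(1)[OF _ n] by (intro borel_measurable_sum borel_measurable_times) auto
    then have [measurable]: "pinning_weight T n h \<omega> \<in> borel_measurable M"
      using pinning_weight_eq by (subst measurable_cong) auto
    show ?thesis by measurable
  qed
  show ?thesis
  proof (cases "?A \<in> events")
    \<comment> \<open>\<open>measure\<close> is 0 outside the sigma-algebra, so the bound is its
      right side being nonnegative.\<close>
    case False
    then have "measure ?D ?A = 0" by (intro measure_notin_sets) (simp add: gibbs_measure_def)
    then show ?thesis using Sum0 by (simp add: gibbs_measure_def)
  next
    case True
    have "emeasure ?D ?A = (\<integral>\<^sup>+x. ennreal (pinning_weight T n h \<omega> x / partition_function M T n h \<omega>) * indicator ?A x \<partial>M)"
      unfolding gibbs_measure_def by (rule emeasure_density[OF pw True])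
    also have "\<dots> \<le> (\<integral>\<^sup>+x. (\<Sum>S | S \<in> traj 0 n \<and> E S. ennreal (?v S / ?Z) * indicator {x \<in> space M. config n x = S} x) \<partial>M)"
    proof (rule nn_integral_mono)
      fix x assume x: "x \<in> space M"
      show "ennreal (pinning_weight T n h \<omega> x / partition_function M T n h \<omega>) * indicator ?A x
        \<le> (\<Sum>S | S \<in> traj 0 n \<and> E S. ennreal (?v S / ?Z) * indicator {x \<in> space M. config n x = S} x)"
      proof (cases "x \<in> ?A")
        case True
        have pw_eq: "pinning_weight T n h \<omega> x / ?Z = (\<Sum>S | S \<in> traj 0 n \<and> E S. ?v S / ?Z * indicator {x \<in> space M. config n x = S} x)"
          unfolding pinning_weight_eq[OF x] sum_divide_distrib
          by (rule sum.mono_neutral_cong_right) (use PE[OF x] True in \<open>auto simp: indicator_def\<close>)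
        have "ennreal (pinning_weight T n h \<omega> x / ?Z) = (\<Sum>S | S \<in> traj 0 n \<and> E S. ennreal (?v S / ?Z * indicator {x \<in> space M. config n x = S} x))"
          unfolding pw_eq
          by (rule sum_ennreal[symmetric], rule mult_nonneg_nonneg, rule divide_nonneg_pos[OF v0 Z]) simp
        also have "\<dots> = (\<Sum>S | S \<in> traj 0 n \<and> E S. ennreal (?v S / ?Z) * indicator {x \<in> space M. config n x = S} x)"
        proof (rule sum.cong[OF refl])
          show "ennreal (?v S / ?Z * indicator {x \<in> space M. config n x = S} x) = ennreal (?v S / ?Z) * indicator {x \<in> space M. config n x = S} x" for S
            by (cases "x \<in> {x \<in> space M. config n x = S}") (simp_all only: indicator_def simp_thms of_bool_eq mult_1_right mult_zero_right ennreal_0)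
        qed
        finally show ?thesis using True by (simp add: partition_function_eq[OF n])
      qed simp
    qed
    also have "\<dots> = (\<Sum>S | S \<in> traj 0 n \<and> E S. ennreal (?v S / ?Z) * emeasure M {x \<in> space M. config n x = S})"
      using prob_config(1)[OF _ n] by (subst nn_integral_sum) (auto simp: nn_integral_cmult_indicator intro!: sum.cong)
    also have "\<dots> = (\<Sum>S | S \<in> traj 0 n \<and> E S. ennreal (weight p (boltzmann h \<omega>) S / ?Z))"
    proof (rule sum.cong[OF refl])
      fix S assume "S \<in> {S. S \<in> traj 0 n \<and> E S}"
      then have "emeasure M {x \<in> space M. config n x = S} = ennreal (weight p (\<lambda>_. 1) S)"
        using prob_config(2)[OF _ n, of S] by (simp add: emeasure_eq_measure)
      moreover have "weight p (boltzmann h \<omega>) S / ?Z = ?v S / ?Z * weight p (\<lambda>_. 1) S"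
        by (simp add: weight_factor[of "boltzmann h \<omega>"])
      moreover have "ennreal (?v S / ?Z * weight p (\<lambda>_. 1) S) = ennreal (?v S / ?Z) * ennreal (weight p (\<lambda>_. 1) S)"
        by (rule ennreal_mult'[OF divide_nonneg_pos[OF v0 Z]])
      ultimately show "ennreal (?v S / ?Z) * emeasure M {x \<in> space M. config n x = S} = ennreal (weight p (boltzmann h \<omega>) S / ?Z)"
        by (simp only:)
    qed
    also have "\<dots> = ennreal ((\<Sum>S | S \<in> traj 0 n \<and> E S. weight p (boltzmann h \<omega>) S) / ?Z)"
      unfolding sum_divide_distrib using Z by (intro sum_ennreal divide_nonneg_pos) (auto intro: weight_nonneg)
    finally have "measure ?D ?A \<le> (\<Sum>S | S \<in> traj 0 n \<and> E S. weight p (boltzmann h \<omega>) S) / ?Z"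
      unfolding measure_def by (rule enn2real_leI[OF Sum0])
    then show ?thesis by (simp add: gibbs_measure_def)
  qed
qed

end

subsection \<open>Free energies\<close>

lemma integrable_if_nn_integral_le:
  fixes f :: "'a \<Rightarrow> real"
  assumes "f \<in> borel_measurable M" "\<And>x. f x \<ge> 0" "(\<integral>\<^sup>+x. ennreal (f x) \<partial>M) \<le> ennreal c" "c \<ge> 0"
  shows "integrable M f" "(\<integral>x. f x \<partial>M) \<le> c"
proof -
  show i: "integrable M f"
    using assms(1,2,3) by (intro integrableI_nonneg) (auto intro: le_less_trans)
  have "ennreal (\<integral>x. f x \<partial>M) \<le> ennreal c"
    using nn_integral_eq_integral[OF i] assms(2,3) by simp
  then show "(\<integral>x. f x \<partial>M) \<le> c" using assms(4) by simp
qed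

context gaussian_environment
begin

text \<open>The powers are passed as functions with defining equations, so that negative powers of
  \<open>Zm\<close>, of \<open>Zw\<close> and of a single reward can be inserted under their own
  names.\<close>

lemma decoupling_integrable:
  fixes cA :: "'i \<Rightarrow> real" and cB :: "'j \<Rightarrow> real"
  assumes A: "finite A" and B: "finite B" and AB: "A \<inter> B = {}"
    and IA: "finite IA" "IA \<noteq> {}" "\<And>i. i \<in> IA \<Longrightarrow> cA i > 0" "\<And>i. i \<in> IA \<Longrightarrow> sA i \<subseteq> A"
    and IB: "finite IB" "IB \<noteq> {}" "\<And>i. i \<in> IB \<Longrightarrow> cB i > 0" "\<And>i. i \<in> IB \<Longrightarrow> sB i \<subseteq> B"
    and \<theta>: "0 < \<theta>" "\<theta> \<le> 1"
    and FA: "\<And>\<omega>. FA \<omega> = expsum IA cA sA \<omega> powr - \<theta>" and FB: "\<And>\<omega>. FB \<omega> = expsum IB cB sB \<omega> powr - \<theta>"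
    and iA: "integrable Q FA" and iB: "integrable Q FB"
  shows "integrable Q (\<lambda>\<omega>. FA \<omega> * FB \<omega>)"
    and "(\<integral>\<omega>. FA \<omega> * FB \<omega> \<partial>Q) \<le> exp (3 * \<theta> * coupling A B) * (\<integral>\<omega>. FA \<omega> \<partial>Q) * (\<integral>\<omega>. FB \<omega> \<partial>Q)"
proof -
  have nn: "FA \<omega> \<ge> 0" "FB \<omega> \<ge> 0" for \<omega> by (simp_all add: FA FB)
  have [measurable]: "FA \<in> borel_measurable Q" "FB \<in> borel_measurable Q" using iA iB by auto
  have c0: "0 \<le> exp (3 * \<theta> * coupling A B) * (\<integral>\<omega>. FA \<omega> \<partial>Q) * (\<integral>\<omega>. FB \<omega> \<partial>Q)"
    using nn by (intro mult_nonneg_nonneg integral_nonneg_AE) auto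
  have "(\<integral>\<^sup>+\<omega>. ennreal (FA \<omega> * FB \<omega>) \<partial>Q)
      \<le> ennreal (exp (3 * \<theta> * coupling A B)) * (\<integral>\<^sup>+\<omega>. ennreal (FA \<omega>) \<partial>Q) * (\<integral>\<^sup>+\<omega>. ennreal (FB \<omega>) \<partial>Q)"
    unfolding FA FB by (rule decoupling[OF A B AB IA IB \<theta>])
  also have "\<dots> = ennreal (exp (3 * \<theta> * coupling A B) * (\<integral>\<omega>. FA \<omega> \<partial>Q) * (\<integral>\<omega>. FB \<omega> \<partial>Q))"
    using nn by (simp add: nn_integral_eq_integral[OF iA] nn_integral_eq_integral[OF iB] ennreal_mult integral_nonneg_AE)
  finally have *: "(\<integral>\<^sup>+\<omega>. ennreal (FA \<omega> * FB \<omega>) \<partial>Q) \<le> ennreal (exp (3 * \<theta> * coupling A B) * (\<integral>\<omega>. FA \<omega> \<partial>Q) * (\<integral>\<omega>. FB \<omega> \<partial>Q))" .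
  show "integrable Q (\<lambda>\<omega>. FA \<omega> * FB \<omega>)"
    and "(\<integral>\<omega>. FA \<omega> * FB \<omega> \<partial>Q) \<le> exp (3 * \<theta> * coupling A B) * (\<integral>\<omega>. FA \<omega> \<partial>Q) * (\<integral>\<omega>. FB \<omega> \<partial>Q)"
    by (rule integrable_if_nn_integral_le[OF _ _ * c0]; use nn in simp)+
qed

section \<open>Sums of covariances\<close>

definition cov_tail :: "nat \<Rightarrow> real" where
  "cov_tail r = (\<Sum>d. \<bar>covariance Q (d + r)\<bar>)"

abbreviation cov_sum :: real where "cov_sum \<equiv> cov_tail 0"

lemma cov_tail_nonneg: "cov_tail r \<ge> 0"
  unfolding cov_tail_def by (intro suminf_nonneg) (use summable_ignore_initial_segment[OF summ] in auto)

lemma cov_tail_tendsto: "cov_tail \<longlonglongrightarrow> 0"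
proof -
  have "cov_tail = (\<lambda>r. (\<Sum>d. \<bar>covariance Q d\<bar>) - (\<Sum>d<r. \<bar>covariance Q d\<bar>))"
    unfolding cov_tail_def using suminf_minus_initial_segment[OF summ] by (intro ext)
  moreover have "(\<lambda>r. (\<Sum>d. \<bar>covariance Q d\<bar>) - (\<Sum>d<r. \<bar>covariance Q d\<bar>)) \<longlonglongrightarrow> (\<Sum>d. \<bar>covariance Q d\<bar>) - (\<Sum>d. \<bar>covariance Q d\<bar>)"
    by (intro tendsto_intros summable_LIMSEQ summ)
  ultimately show ?thesis by simp
qed

lemma cv_sum_right:
  assumes B: "finite B" and r: "\<And>b. b \<in> B \<Longrightarrow> b \<ge> a + r"
  shows "(\<Sum>b\<in>B. \<bar>cv a b\<bar>) \<le> cov_tail r"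
proof -
  have "(\<Sum>b\<in>B. \<bar>cv a b\<bar>) = (\<Sum>b\<in>B. \<bar>covariance Q ((b - a - r) + r)\<bar>)"
    using r by (intro sum.cong refl) (auto simp: cv_covariance dest!: r)
  also have "\<dots> = (\<Sum>d\<in>(\<lambda>b. b - a - r) ` B. \<bar>covariance Q (d + r)\<bar>)"
  proof (rule sum.reindex[symmetric, unfolded comp_def])
    show "inj_on (\<lambda>b. b - a - r) B"
    proof (rule inj_onI)
      fix x y assume "x \<in> B" "y \<in> B" "x - a - r = y - a - r"
      then show "x = y" using r[of x] r[of y] by linarith
    qed
  qed
  also have "\<dots> \<le> cov_tail r"
    unfolding cov_tail_def by (rule sum_le_suminf) (use summable_ignore_initial_segment[OF summ] B in auto)
  finally show ?thesis .
qed

lemma cv_sum_row: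
  assumes B: "finite B"
  shows "(\<Sum>b\<in>B. \<bar>cv a b\<bar>) \<le> 2 * cov_sum"
proof -
  have "(\<Sum>b\<in>B. \<bar>cv a b\<bar>) = (\<Sum>b\<in>B \<inter> {a..}. \<bar>cv a b\<bar>) + (\<Sum>b\<in>B \<inter> {..<a}. \<bar>cv a b\<bar>)"
    using B by (subst sum.union_disjoint[symmetric]) (auto intro!: sum.cong)
  also have "(\<Sum>b\<in>B \<inter> {a..}. \<bar>cv a b\<bar>) \<le> cov_sum" by (rule cv_sum_right) (use B in auto)
  also have "(\<Sum>b\<in>B \<inter> {..<a}. \<bar>cv a b\<bar>) \<le> cov_sum"
  proof -
    have "(\<Sum>b\<in>B \<inter> {..<a}. \<bar>cv a b\<bar>) = (\<Sum>b\<in>B \<inter> {..<a}. \<bar>covariance Q (a - b)\<bar>)"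
      by (intro sum.cong refl) (auto simp: cv_covariance)
    also have "\<dots> = (\<Sum>d\<in>(\<lambda>b. a - b) ` (B \<inter> {..<a}). \<bar>covariance Q d\<bar>)"
      by (rule sum.reindex[symmetric, unfolded comp_def]) (auto intro!: inj_onI)
    also have "\<dots> \<le> cov_sum"
      unfolding cov_tail_def using summ B by (simp add: sum_le_suminf)
    finally show ?thesis .
  qed
  finally show ?thesis by simp
qed

text \<open>A site at distance \<open>r\<close> from the right window has total covariance at most
  \<open>cov_tail r\<close> with it, however long that window is. The bound is free of
  \<open>n\<close>, and by Cesaro averaging it is sublinear in \<open>m\<close>.\<close>

lemma coupling_adjacent: "coupling {1..m} {m<..m + n} \<le> (\<Sum>r\<in>{1..m}. cov_tail r)"
proof -
  have "coupling {1..m} {m<..m + n} \<le> (\<Sum>a\<in>{1..m}. cov_tail (m + 1 - a))"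
    unfolding coupling_def by (intro sum_mono cv_sum_right) auto
  also have "\<dots> = (\<Sum>r\<in>{1..m}. cov_tail r)"
    by (rule sum.reindex_bij_witness[where i = "\<lambda>a. m + 1 - a" and j = "\<lambda>a. m + 1 - a"]) auto
  finally show ?thesis .
qed

lemma coupling_point: "finite A \<Longrightarrow> coupling A {m} \<le> 2 * cov_sum"
proof -
  assume A: "finite A"
  have "coupling A {m} = (\<Sum>b\<in>A. \<bar>cv m b\<bar>)"
    unfolding coupling_def cv_def by (simp add: mult.commute)
  also have "\<dots> \<le> 2 * cov_sum" by (rule cv_sum_row[OF A])
  finally show ?thesis .
qed

lemma integrable_exp_abs: "integrable Q (\<lambda>\<omega>. exp (r * \<bar>\<omega> a\<bar>))"
  and integral_exp_abs_le: "(\<integral>\<omega>. exp (r * \<bar>\<omega> a\<bar>) \<partial>Q) \<le> 2 * exp (r\<^sup>2 * covariance Q 0 / 2)"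
proof -
  have i: "integrable Q (\<lambda>\<omega>. exp (r * \<omega> a) + exp ((- r) * \<omega> a))"
    by (intro Bochner_Integration.integrable_add exp_coordinate(1))
  have le: "exp (r * \<bar>x\<bar>) \<le> exp (r * x) + exp ((- r) * x)" for x :: real
    by (cases "x \<ge> 0") (auto simp: abs_if)
  show int: "integrable Q (\<lambda>\<omega>. exp (r * \<bar>\<omega> a\<bar>))"
    by (rule Bochner_Integration.integrable_bound[OF i]) (use le in \<open>auto simp: abs_of_nonneg\<close>)
  have "(\<integral>\<omega>. exp (r * \<bar>\<omega> a\<bar>) \<partial>Q) \<le> (\<integral>\<omega>. exp (r * \<omega> a) + exp ((- r) * \<omega> a) \<partial>Q)"
    by (rule integral_mono[OF int i le])
  also have "\<dots> = 2 * exp (r\<^sup>2 * covariance Q 0 / 2)"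
    by (subst Bochner_Integration.integral_add[OF exp_coordinate(1) exp_coordinate(1)]) (simp only: exp_coordinate(2), simp)
  finally show "(\<integral>\<omega>. exp (r * \<bar>\<omega> a\<bar>) \<partial>Q) \<le> 2 * exp (r\<^sup>2 * covariance Q 0 / 2)" .
qed

text \<open>The exponent is at most \<open>card A\<close> times its largest term, so one-coordinate
  exponentials suffice as a majorant.\<close>

lemma integrable_exp_abs_sum:
  fixes r :: real
  assumes A: "finite A" and r: "r \<ge> 0"
  shows "integrable Q (\<lambda>\<omega>. exp (\<Sum>a\<in>A. r * \<bar>\<omega> a\<bar>))"
proof (cases "A = {}")
  case False
  have i: "integrable Q (\<lambda>\<omega>. \<Sum>a\<in>A. exp (real (card A) * r * \<bar>\<omega> a\<bar>))"
    by (intro Bochner_Integration.integrable_sum integrable_exp_abs)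
  have le: "exp (\<Sum>a\<in>A. r * \<bar>x a\<bar>) \<le> (\<Sum>a\<in>A. exp (real (card A) * r * \<bar>x a\<bar>))" for x :: "nat \<Rightarrow> real"
  proof -
    have "Max ((\<lambda>a. \<bar>x a\<bar>) ` A) \<in> (\<lambda>a. \<bar>x a\<bar>) ` A" by (rule Max_in) (use A False in auto)
    then obtain b where b: "b \<in> A" "Max ((\<lambda>a. \<bar>x a\<bar>) ` A) = \<bar>x b\<bar>" by auto
    have bmax: "r * \<bar>x a\<bar> \<le> r * \<bar>x b\<bar>" if "a \<in> A" for a
      unfolding b(2)[symmetric] by (intro mult_left_mono Max_ge) (use A that r in auto)
    have "(\<Sum>a\<in>A. r * \<bar>x a\<bar>) \<le> real (card A) * (r * \<bar>x b\<bar>)" by (rule sum_bounded_above) (rule bmax)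
    then have "exp (\<Sum>a\<in>A. r * \<bar>x a\<bar>) \<le> exp (real (card A) * r * \<bar>x b\<bar>)" by (simp add: mult.assoc)
    also have "\<dots> \<le> (\<Sum>a\<in>A. exp (real (card A) * r * \<bar>x a\<bar>))" by (rule member_le_sum) (use b A in auto)
    finally show ?thesis .
  qed
  show ?thesis
  proof (rule Bochner_Integration.integrable_bound[OF i])
    show "AE \<omega> in Q. norm (exp (\<Sum>a\<in>A. r * \<bar>\<omega> a\<bar>)) \<le> norm (\<Sum>a\<in>A. exp (real (card A) * r * \<bar>\<omega> a\<bar>))"
      by (intro AE_I2) (simp only: real_norm_def abs_exp_cancel order_trans[OF le abs_ge_self])
  qed simp
qed simp

end

section \<open>Negative moments of the partition functions\<close>

locale disordered_renewal = gaussian_environment Q + renewal_weights p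
  for Q :: "(nat \<Rightarrow> real) measure" and p :: "nat \<Rightarrow> real" +
  assumes p_subexponential: "\<And>\<delta>. \<delta> > 0 \<Longrightarrow> \<exists>c>0. \<forall>t\<ge>1. p t \<ge> c * exp (- \<delta> * real t)"
begin

abbreviation Zw :: "real \<Rightarrow> (nat \<Rightarrow> real) \<Rightarrow> nat \<Rightarrow> nat \<Rightarrow> real" where
  "Zw h \<omega> \<equiv> window p (boltzmann h \<omega>)"

abbreviation Zm :: "real \<Rightarrow> (nat \<Rightarrow> real) \<Rightarrow> nat \<Rightarrow> nat \<Rightarrow> real" where
  "Zm h \<omega> \<equiv> window_minus p (boltzmann h \<omega>)"

abbreviation unitw :: "nat set \<Rightarrow> real" where "unitw \<equiv> weight p (\<lambda>_. 1)"

lemma Zw_expsum: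
  "Zw h \<omega> a b = expsum (traj a b) (\<lambda>S. unitw S * exp (real (card (S - {a})) * h)) (\<lambda>S. S - {a}) \<omega>"
  unfolding window_boltzmann expsum_def by (intro sum.cong refl) (simp add: sum.distrib exp_add)

lemma Zm_expsum:
  "a < b \<Longrightarrow> Zm h \<omega> a b = expsum (traj a b) (\<lambda>S. unitw S * exp (real (card (S - {a, b})) * h)) (\<lambda>S. S - {a, b}) \<omega>"
  unfolding window_minus_boltzmann expsum_def by (intro sum.cong refl) (simp add: sum.distrib exp_add)

lemma Zw_measurable [measurable]: "(\<lambda>\<omega>. Zw h \<omega> a b) \<in> borel_measurable Q"
  unfolding window_boltzmann by measurable

lemma Zm_measurable [measurable]: "(\<lambda>\<omega>. Zm h \<omega> a b) \<in> borel_measurable Q"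
  unfolding window_minus_def by measurable

lemma Zw_shift: "Zw h \<omega> (a + m) (b + m) = Zw h (\<lambda>c. \<omega> (c + m)) a b"
  by (rule window_shift)

lemma Zm_shift: "Zm h \<omega> (a + m) (b + m) = Zm h (\<lambda>c. \<omega> (c + m)) a b"
  by (rule window_minus_shift)

lemma Zm_powr_le:
  assumes "a < b" "\<theta> > 0"
  shows "Zm h \<omega> a b powr - \<theta> \<le> p (b - a) powr - \<theta>"
  using B.window_minus_ge[OF assms(1)] p_pos[of "b - a"] assms by (intro powr_mono2') auto

lemma Zm_powr_integrable:
  assumes "a < b" "\<theta> > 0"
  shows "integrable Q (\<lambda>\<omega>. Zm h \<omega> a b powr - \<theta>)"
  by (rule integrable_const_bound[where B = "p (b - a) powr - \<theta>"]) (use Zm_powr_le[OF assms] in auto)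

lemma Zm_shift_integral:
  fixes F :: "real \<Rightarrow> real"
  assumes [measurable]: "F \<in> borel_measurable borel"
  shows "(\<integral>\<omega>. F (Zm h \<omega> a (a + n)) \<partial>Q) = (\<integral>\<omega>. F (Zm h \<omega> 0 n) \<partial>Q)"
  using integral_shift[of "\<lambda>\<omega>. F (Zm h \<omega> 0 n)" a] Zm_shift[of h _ 0 a n] by (simp add: add.commute)

lemma traj_interval: "a \<le> b \<Longrightarrow> traj a b \<noteq> {}"
  by (auto simp: traj_def)

lemma coefficient_pos: "S \<in> traj a b \<Longrightarrow> unitw S * exp c > 0"
  using weight_unit_bounds[of S a b] by simp

lemma Zm_pos: "a < b \<Longrightarrow> Zm h \<omega> a b > 0"
  by (rule B.window_minus_pos) simp

lemma Zw_pos: "a \<le> b \<Longrightarrow> Zw h \<omega> a b > 0"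
  by (rule B.window_pos)

text \<open>With \<open>\<theta> = 1\<close> this is the mean of 1 / Z^- that defines the
  alternative free energy; exponents below 1 serve the positivity proof
  \<open>mu_pos\<close>.\<close>

definition moment :: "real \<Rightarrow> real \<Rightarrow> nat \<Rightarrow> real" where
  "moment \<theta> h n = (\<integral>\<omega>. Zm h \<omega> 0 n powr - \<theta> \<partial>Q)"

lemma moment_pos: "n \<ge> 1 \<Longrightarrow> \<theta> > 0 \<Longrightarrow> moment \<theta> h n > 0"
proof -
  assume n: "n \<ge> 1" and \<theta>: "\<theta> > 0"
  have i: "integrable Q (\<lambda>\<omega>. Zm h \<omega> 0 n powr - \<theta>)" by (rule Zm_powr_integrable) (use n \<theta> in auto)
  have "Zm h \<omega> 0 n powr - \<theta> > 0" for \<omega> using Zm_pos[of 0 n h \<omega>] n by simp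
  then show ?thesis unfolding moment_def
    using integral_less_AE_space[of "\<lambda>_. 0" "\<lambda>\<omega>. Zm h \<omega> 0 n powr - \<theta>"] i by (simp add: emeasure_space_1 flip: space_Q)
qed

text \<open>The sum pays for the coupling of adjacent windows and the bracket for putting the reward
  back at the cut point: \<open>6 * cov_sum\<close> decouples that site from the interior of the
  window, and the rest bounds the moment of the reward.\<close>

definition err :: "real \<Rightarrow> nat \<Rightarrow> real" where
  "err h m = 3 * (\<Sum>r\<in>{1..m}. cov_tail r) + (6 * cov_sum + \<bar>h\<bar> + covariance Q 0)"

lemma err_nonneg: "err h m \<ge> 0"
  unfolding err_def using covariance_0_nonneg by (intro add_nonneg_nonneg mult_nonneg_nonneg sum_nonneg cov_tail_nonneg) auto

lemma err_tendsto: "(\<lambda>m. err h m / real m) \<longlonglongrightarrow> 0"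
proof -
  have "(\<lambda>m. (\<Sum>r\<in>{1..m}. cov_tail r) / real m) \<longlonglongrightarrow> 0" by (rule cesaro_null[OF cov_tail_tendsto])
  moreover have "(\<lambda>m. (6 * cov_sum + \<bar>h\<bar> + covariance Q 0) / real m) \<longlonglongrightarrow> 0"
    by (rule tendsto_divide_0[OF tendsto_const]) (rule filterlim_at_top_imp_at_infinity[OF filterlim_real_sequentially])
  ultimately have "(\<lambda>m. 3 * ((\<Sum>r\<in>{1..m}. cov_tail r) / real m) + (6 * cov_sum + \<bar>h\<bar> + covariance Q 0) / real m) \<longlonglongrightarrow> 3 * 0 + 0"
    by (intro tendsto_intros)
  then show ?thesis by (simp add: err_def add_divide_distrib)
qed

text \<open>The Gaussian exponent is quadratic in \<open>\<theta>\<close>. It is weakened to a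
  linear one so that, after taking logarithms, all errors have the common factor
  \<open>\<theta>\<close>.\<close>

lemma reward_moment:
  assumes \<theta>: "0 < \<theta>" "\<theta> \<le> 1"
  shows "integrable Q (\<lambda>\<omega>. exp (h + \<omega> m) powr - \<theta>)"
    and "(\<integral>\<omega>. exp (h + \<omega> m) powr - \<theta> \<partial>Q) \<le> exp (\<theta> * (\<bar>h\<bar> + covariance Q 0))"
proof -
  have e: "exp (h + x) powr - \<theta> = exp (- \<theta> * h) * exp (- \<theta> * x)" for x
    by (simp add: powr_def algebra_simps flip: exp_add)
  show "integrable Q (\<lambda>\<omega>. exp (h + \<omega> m) powr - \<theta>)"
    unfolding e by (intro integrable_mult_right exp_coordinate(1))
  have "(\<integral>\<omega>. exp (h + \<omega> m) powr - \<theta> \<partial>Q) = exp (- \<theta> * h) * exp ((- \<theta>)\<^sup>2 * covariance Q 0 / 2)"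
    unfolding e by (simp only: integral_mult_right_zero exp_coordinate(2))
  also have "\<dots> = exp (- \<theta> * h + \<theta>\<^sup>2 * covariance Q 0 / 2)" by (simp add: exp_add[symmetric])
  also have "\<dots> \<le> exp (\<theta> * (\<bar>h\<bar> + covariance Q 0))"
  proof -
    have "\<theta>\<^sup>2 * covariance Q 0 / 2 \<le> \<theta> * covariance Q 0"
    proof -
      have "\<theta>\<^sup>2 \<le> \<theta> * 1" unfolding power2_eq_square using \<theta> by (intro mult_left_mono) auto
      then have "\<theta>\<^sup>2 * covariance Q 0 \<le> \<theta> * covariance Q 0" using covariance_0_nonneg by (intro mult_right_mono) auto
      moreover have "0 \<le> \<theta>\<^sup>2 * covariance Q 0" using covariance_0_nonneg by simp
      ultimately show ?thesis by linarith
    qed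
    moreover have "- \<theta> * h \<le> \<theta> * \<bar>h\<bar>" using \<theta> mult_left_mono[of "- h" "\<bar>h\<bar>" \<theta>] by simp
    ultimately show ?thesis by (simp add: distrib_left)
  qed
  finally show "(\<integral>\<omega>. exp (h + \<omega> m) powr - \<theta> \<partial>Q) \<le> exp (\<theta> * (\<bar>h\<bar> + covariance Q 0))" .
qed

text \<open>A single reward is an exponential sum with one term, living on the site
  \<open>m\<close>, so decoupling separates it from the interior of the window.\<close>

lemma Zw_moment:
  assumes m: "m \<ge> 1" and \<theta>: "0 < \<theta>" "\<theta> \<le> 1"
  shows "integrable Q (\<lambda>\<omega>. Zw h \<omega> 0 m powr - \<theta>)"
    and "(\<integral>\<omega>. Zw h \<omega> 0 m powr - \<theta> \<partial>Q) \<le> exp (\<theta> * (6 * cov_sum + \<bar>h\<bar> + covariance Q 0)) * moment \<theta> h m"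
proof -
  have e: "Zw h \<omega> 0 m powr - \<theta> = Zm h \<omega> 0 m powr - \<theta> * exp (h + \<omega> m) powr - \<theta>" for \<omega>
    unfolding B.window_eq[of h \<omega> 0 m] using Zm_pos[of 0 m h \<omega>] m by (subst powr_mult) auto
  have sub: "S - {0, m} \<subseteq> {1..<m}" if "S \<in> traj 0 m" for S
    using that by (auto simp: traj_def Suc_le_eq le_less)
  have F1: "Zm h \<omega> 0 m powr - \<theta>
      = expsum (traj 0 m) (\<lambda>S. unitw S * exp (real (card (S - {0, m})) * h)) (\<lambda>S. S - {0, m}) \<omega> powr - \<theta>" for \<omega>
    using m by (subst Zm_expsum) auto
  have F2: "exp (h + \<omega> m) powr - \<theta> = expsum {()} (\<lambda>_. exp h) (\<lambda>_. {m}) \<omega> powr - \<theta>" for \<omega>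
    by (simp add: expsum_def exp_add)
  have i1: "integrable Q (\<lambda>\<omega>. Zm h \<omega> 0 m powr - \<theta>)" by (rule Zm_powr_integrable) (use m \<theta> in auto)
  note dec = decoupling_integrable[OF finite_atLeastLessThan[of 1 m] finite.insertI[OF finite.emptyI, of m] _
      finite_traj traj_interval[of 0 m] coefficient_pos sub finite.insertI[OF finite.emptyI] insert_not_empty exp_gt_zero _
      \<theta> F1 F2 i1 reward_moment(1)[OF \<theta>], simplified subset_refl]
  show "integrable Q (\<lambda>\<omega>. Zw h \<omega> 0 m powr - \<theta>)" unfolding e by (rule dec(1)) auto
  have "(\<integral>\<omega>. Zw h \<omega> 0 m powr - \<theta> \<partial>Q) \<le> exp (3 * \<theta> * coupling {1..<m} {m}) * moment \<theta> h m * (\<integral>\<omega>. exp (h + \<omega> m) powr - \<theta> \<partial>Q)"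
    unfolding e moment_def by (rule dec(2)) auto
  also have "\<dots> \<le> exp (3 * \<theta> * coupling {1..<m} {m}) * moment \<theta> h m * exp (\<theta> * (\<bar>h\<bar> + covariance Q 0))"
    using moment_pos[OF m \<theta>(1), of h] by (intro mult_left_mono reward_moment(2) \<theta>) auto
  also have "\<dots> \<le> exp (3 * \<theta> * (2 * cov_sum)) * moment \<theta> h m * exp (\<theta> * (\<bar>h\<bar> + covariance Q 0))"
    using moment_pos[OF m \<theta>(1), of h] coupling_point[of "{1..<m}" m] \<theta> by (intro mult_right_mono) auto
  also have "\<dots> = exp (\<theta> * (6 * cov_sum + \<bar>h\<bar> + covariance Q 0)) * moment \<theta> h m"
    by (simp add: algebra_simps flip: exp_add)
  finally show "(\<integral>\<omega>. Zw h \<omega> 0 m powr - \<theta> \<partial>Q) \<le> exp (\<theta> * (6 * cov_sum + \<bar>h\<bar> + covariance Q 0)) * moment \<theta> h m" .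
qed

text \<open>Superadditivity cuts the trajectories at \<open>m\<close>, with the reward at
  \<open>m\<close> given to the left window, and decoupling separates \<open>{1..m}\<close> from the
  rest. The factor \<open>\<theta>\<close> in front of the error is essential in
  \<open>mu_pos\<close>, where \<open>\<theta>\<close> is chosen small.\<close>

lemma ln_moment_subadditive:
  assumes m: "m \<ge> 1" and n: "n \<ge> 1" and \<theta>: "0 < \<theta>" "\<theta> \<le> 1"
  shows "ln (moment \<theta> h (m + n)) \<le> ln (moment \<theta> h m) + ln (moment \<theta> h n) + \<theta> * err h m"
proof -
  have shift: "integrable Q (\<lambda>\<omega>. Zm h \<omega> m (m + n) powr - \<theta>)" "(\<integral>\<omega>. Zm h \<omega> m (m + n) powr - \<theta> \<partial>Q) = moment \<theta> h n"
    using Zm_powr_integrable[of m "m + n" \<theta> h] Zm_shift_integral[of "\<lambda>z. z powr - \<theta>" h m n] n \<theta>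
    by (auto simp: moment_def)
  have sub1: "S - {0} \<subseteq> {1..m}" if "S \<in> traj 0 m" for S
    using that by (auto simp: traj_def Suc_le_eq)
  have sub2: "S - {m, m + n} \<subseteq> {m<..m + n}" if "S \<in> traj m (m + n)" for S
    using that by (auto simp: traj_def le_less)
  have F1: "Zw h \<omega> 0 m powr - \<theta>
      = expsum (traj 0 m) (\<lambda>S. unitw S * exp (real (card (S - {0})) * h)) (\<lambda>S. S - {0}) \<omega> powr - \<theta>" for \<omega>
    by (subst Zw_expsum) simp
  have F2: "Zm h \<omega> m (m + n) powr - \<theta>
      = expsum (traj m (m + n)) (\<lambda>S. unitw S * exp (real (card (S - {m, m + n})) * h)) (\<lambda>S. S - {m, m + n}) \<omega> powr - \<theta>" for \<omega>
    using n by (subst Zm_expsum) auto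
  have disj: "{1..m} \<inter> {m<..m + n} = {}" by auto
  note dec = decoupling_integrable[OF finite_atLeastAtMost finite_greaterThanAtMost disj
      finite_traj traj_interval[OF le0] coefficient_pos sub1 finite_traj traj_interval[OF le_add1] coefficient_pos sub2
      \<theta> F1 F2 Zw_moment(1)[OF m \<theta>] shift(1)]
  have "moment \<theta> h (m + n) \<le> (\<integral>\<omega>. Zw h \<omega> 0 m powr - \<theta> * Zm h \<omega> m (m + n) powr - \<theta> \<partial>Q)"
    unfolding moment_def
  proof (rule integral_mono[OF Zm_powr_integrable dec(1)])
    fix \<omega>
    have "Zw h \<omega> 0 m * Zm h \<omega> m (m + n) \<le> Zm h \<omega> 0 (m + n)"
      using B.window_superadditive[of 0 m "m + n" h \<omega>] by (simp add: window_minus_def divide_right_mono)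
    moreover have "Zw h \<omega> 0 m > 0" "Zm h \<omega> m (m + n) > 0" using Zw_pos Zm_pos n by auto
    ultimately show "Zm h \<omega> 0 (m + n) powr - \<theta> \<le> Zw h \<omega> 0 m powr - \<theta> * Zm h \<omega> m (m + n) powr - \<theta>"
      using \<theta> by (simp flip: powr_mult add: powr_mono2')
  qed (use m n \<theta> in auto)
  also have "\<dots> \<le> exp (3 * \<theta> * coupling {1..m} {m<..m + n}) * (\<integral>\<omega>. Zw h \<omega> 0 m powr - \<theta> \<partial>Q) * moment \<theta> h n"
    using dec(2) unfolding shift(2) .
  also have "\<dots> \<le> exp (3 * \<theta> * (\<Sum>r\<in>{1..m}. cov_tail r)) * (exp (\<theta> * (6 * cov_sum + \<bar>h\<bar> + covariance Q 0)) * moment \<theta> h m) * moment \<theta> h n"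
    using moment_pos[OF n \<theta>(1), of h] coupling_adjacent[of m n] Zw_moment(2)[OF m \<theta>, of h] \<theta>
    by (intro mult_right_mono mult_mono) (auto intro!: integral_nonneg_AE)
  also have "\<dots> = exp (\<theta> * err h m) * moment \<theta> h m * moment \<theta> h n"
    unfolding err_def by (simp add: algebra_simps flip: exp_add)
  finally have "ln (moment \<theta> h (m + n)) \<le> ln (exp (\<theta> * err h m) * moment \<theta> h m * moment \<theta> h n)"
    using moment_pos[of "m + n" \<theta> h] moment_pos[OF m \<theta>(1), of h] moment_pos[OF n \<theta>(1), of h] m \<theta>
    by (subst ln_le_cancel_iff) auto
  also have "\<dots> = \<theta> * err h m + ln (moment \<theta> h m) + ln (moment \<theta> h n)"
    using moment_pos[OF m \<theta>(1), of h] moment_pos[OF n \<theta>(1), of h] by (simp add: ln_mult)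
  finally show ?thesis by simp
qed

end

lemma (in gaussian_environment) prob_UNIV [simp]: "prob UNIV = 1"
  using prob_space by simp

context disordered_renewal
begin

section \<open>Logarithmic moments and the free energy\<close>

definition mean_abs :: real where "mean_abs = (\<integral>\<omega>. \<bar>\<omega> 0\<bar> \<partial>Q)"

lemma integral_abs_coordinate: "(\<integral>\<omega>. \<bar>\<omega> a\<bar> \<partial>Q) = mean_abs"
  using integral_shift[of "\<lambda>\<omega>. \<bar>\<omega> 0\<bar>" a] by (simp add: mean_abs_def)

lemma ln_p_le_0: "n \<ge> 1 \<Longrightarrow> ln (p n) \<le> 0"
  using p_pos[of n] p_le_1[of n] by simp

definition log_bound :: "real \<Rightarrow> nat \<Rightarrow> real" where
  "log_bound h n = - ln (p n) + real (n + 1) * ln 2 + real n * \<bar>h\<bar>"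

lemma abs_ln_Zm_le:
  assumes n: "n \<ge> 1"
  shows "\<bar>ln (Zm h \<omega> 0 n)\<bar> \<le> log_bound h n + (\<Sum>c\<in>{1..n}. \<bar>\<omega> c\<bar>)"
proof -
  have "ln (p n) \<le> ln (Zm h \<omega> 0 n)"
    using B.window_minus_ge[of 0 n h \<omega>] p_pos[of n] n by (subst ln_le_cancel_iff) auto
  moreover have "0 \<le> real (n + 1) * ln 2 + real n * \<bar>h\<bar>" "0 \<le> (\<Sum>c\<in>{1..n}. \<bar>\<omega> c\<bar>)"
    by (auto intro: sum_nonneg)
  ultimately show ?thesis
    using ln_window_minus_le[OF n, of h \<omega>] ln_p_le_0[OF n] unfolding log_bound_def by (intro abs_leI) linarith+
qed

lemma integrable_abs_sum: "integrable Q (\<lambda>\<omega>. \<Sum>c\<in>A. \<bar>\<omega> c\<bar>)"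
  by (intro Bochner_Integration.integrable_sum integrable_abs integrable_coordinate)

lemma integrable_ln_Zm:
  assumes n: "n \<ge> 1"
  shows "integrable Q (\<lambda>\<omega>. ln (Zm h \<omega> 0 n))"
proof (rule Bochner_Integration.integrable_bound)
  show "integrable Q (\<lambda>\<omega>. log_bound h n + (\<Sum>c\<in>{1..n}. \<bar>\<omega> c\<bar>))"
    by (intro Bochner_Integration.integrable_add integrable_const integrable_abs_sum)
  show "AE \<omega> in Q. norm (ln (Zm h \<omega> 0 n)) \<le> norm (log_bound h n + (\<Sum>c\<in>{1..n}. \<bar>\<omega> c\<bar>))"
    using abs_ln_Zm_le[OF n] by (auto intro!: AE_I2 order_trans[OF abs_ln_Zm_le[OF n]] abs_ge_self)
qed simp

lemma ln_Zw: "n \<ge> 1 \<Longrightarrow> ln (Zw h \<omega> 0 n) = ln (Zm h \<omega> 0 n) + (h + \<omega> n)"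
  unfolding B.window_eq[of h \<omega> 0 n] using Zm_pos[of 0 n h \<omega>] by (subst ln_mult) auto

lemma integrable_ln_Zw: "n \<ge> 1 \<Longrightarrow> integrable Q (\<lambda>\<omega>. ln (Zw h \<omega> 0 n))"
  unfolding ln_Zw by (intro Bochner_Integration.integrable_add integrable_ln_Zm integrable_const integrable_coordinate)

definition expected_log :: "real \<Rightarrow> nat \<Rightarrow> real" where
  "expected_log h n = (\<integral>\<omega>. ln (Zw h \<omega> 0 n) \<partial>Q)"

lemma expected_log_eq: "n \<ge> 1 \<Longrightarrow> expected_log h n = (\<integral>\<omega>. ln (Zm h \<omega> 0 n) \<partial>Q) + h"
  unfolding expected_log_def ln_Zw using integrable_ln_Zm[of n h] by (simp add: prob_space)

lemma expected_ln_Zm_le: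
  assumes n: "n \<ge> 1"
  shows "(\<integral>\<omega>. ln (Zm h \<omega> 0 n) \<partial>Q) \<le> (2 * ln 2 + \<bar>h\<bar> + mean_abs) * real n"
proof -
  have "(\<integral>\<omega>. ln (Zm h \<omega> 0 n) \<partial>Q) \<le> (\<integral>\<omega>. real (n + 1) * ln 2 + real n * \<bar>h\<bar> + (\<Sum>c\<in>{1..n}. \<bar>\<omega> c\<bar>) \<partial>Q)"
    by (intro integral_mono integrable_ln_Zm n Bochner_Integration.integrable_add integrable_const integrable_abs_sum
        ln_window_minus_le)
  also have "\<dots> = real (n + 1) * ln 2 + real n * \<bar>h\<bar> + real n * mean_abs"
    using integrable_abs_sum[of "{1..n}"]
    by (simp add: prob_space integral_abs_coordinate Bochner_Integration.integral_sum)
  also have "\<dots> \<le> real (2 * n) * ln 2 + real n * \<bar>h\<bar> + real n * mean_abs"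
    using n by (intro add_right_mono mult_right_mono) auto
  finally show ?thesis by (simp add: algebra_simps)
qed

lemma expected_log_superadditive:
  assumes m: "m \<ge> 1" and n: "n \<ge> 1"
  shows "expected_log h (m + n) \<ge> expected_log h m + expected_log h n"
proof -
  have meas: "(\<lambda>\<omega>. ln (Zw h \<omega> 0 n)) \<in> borel_measurable Q" by simp
  have e: "ln (Zw h \<omega> m (m + n)) = ln (Zw h (\<lambda>c. \<omega> (c + m)) 0 n)" for \<omega>
    using Zw_shift[of h \<omega> 0 m n] by (simp add: add.commute)
  have i: "integrable Q (\<lambda>\<omega>. ln (Zw h \<omega> m (m + n)))" unfolding e by (rule integrable_shift[OF integrable_ln_Zw[OF n]])
  have "expected_log h m + expected_log h n = (\<integral>\<omega>. ln (Zw h \<omega> 0 m) \<partial>Q) + (\<integral>\<omega>. ln (Zw h \<omega> m (m + n)) \<partial>Q)"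
    unfolding expected_log_def e integral_shift[OF meas] ..
  also have "\<dots> = (\<integral>\<omega>. ln (Zw h \<omega> 0 m) + ln (Zw h \<omega> m (m + n)) \<partial>Q)"
    by (rule Bochner_Integration.integral_add[symmetric, OF integrable_ln_Zw[OF m] i])
  also have "\<dots> \<le> expected_log h (m + n)" unfolding expected_log_def
  proof (rule integral_mono)
    fix \<omega>
    have "Zw h \<omega> 0 m > 0" "Zw h \<omega> m (m + n) > 0" by (auto intro: Zw_pos)
    then have "ln (Zw h \<omega> 0 m) + ln (Zw h \<omega> m (m + n)) = ln (Zw h \<omega> 0 m * Zw h \<omega> m (m + n))" by (simp add: ln_mult)
    also have "\<dots> \<le> ln (Zw h \<omega> 0 (m + n))"
      using B.window_superadditive[of 0 m "m + n" h \<omega>] \<open>Zw h \<omega> 0 m > 0\<close> \<open>Zw h \<omega> m (m + n) > 0\<close>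
      by (subst ln_le_cancel_iff) (auto intro: Zw_pos)
    finally show "ln (Zw h \<omega> 0 m) + ln (Zw h \<omega> m (m + n)) \<le> ln (Zw h \<omega> 0 (m + n))" .
  qed (use m n i integrable_ln_Zw in auto)
  finally show ?thesis .
qed

definition fe :: "real \<Rightarrow> real" where "fe h = lim (\<lambda>n. expected_log h n / real n)"

lemma fe_tendsto: "(\<lambda>n. expected_log h n / real n) \<longlonglongrightarrow> fe h"
proof -
  have "convergent (\<lambda>n. - expected_log h n / real n)"
  \<comment> \<open>The second \<open>\<bar>h\<bar>\<close> pays for the final reward, by which
    \<open>expected_log\<close> differs from the mean of
    \<open>ln (Zm h \<omega> 0 n)\<close>.\<close>
  proof (rule almost_subadditive_convergent[where e = "\<lambda>_. 0" and C = "2 * ln 2 + \<bar>h\<bar> + mean_abs + \<bar>h\<bar>"])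
    show "- expected_log h (m + n) \<le> - expected_log h m + - expected_log h n + 0" if "m \<ge> 1" "n \<ge> 1" for m n
      using expected_log_superadditive[OF that, of h] by simp
    show "- (2 * ln 2 + \<bar>h\<bar> + mean_abs + \<bar>h\<bar>) * real n \<le> - expected_log h n" if n: "n \<ge> 1" for n
    proof -
      have "h \<le> \<bar>h\<bar> * real n" using n by (metis abs_ge_self abs_ge_zero mult_left_mono mult.right_neutral of_nat_1 of_nat_mono order_trans)
      then show ?thesis using expected_ln_Zm_le[OF n, of h] expected_log_eq[OF n, of h] by (simp add: algebra_simps)
    qed
  qed auto
  then have "convergent (\<lambda>n. - (- expected_log h n / real n))" by (simp only: convergent_minus_iff[symmetric])
  then show ?thesis unfolding fe_def by (simp add: convergent_LIMSEQ_iff)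
qed

text \<open>Makes the free energy positive for large \<open>h\<close>, so that the critical point is
  the infimum of a nonempty set. The bound comes from iterating superadditivity with windows of
  length one.\<close>

lemma fe_lower: "fe h \<ge> ln (p 1) + h"
proof (rule LIMSEQ_le_const[OF fe_tendsto])
  have 1: "expected_log h 1 \<ge> ln (p 1) + h"
  proof -
    have "(\<integral>\<omega>. ln (p 1) \<partial>Q) \<le> (\<integral>\<omega>. ln (Zm h \<omega> 0 1) \<partial>Q)"
    proof (rule integral_mono)
      show "ln (p 1) \<le> ln (Zm h \<omega> 0 1)" for \<omega>
        using B.window_minus_ge[of 0 1 h \<omega>] p_pos[of 1] by (subst ln_le_cancel_iff) auto
    qed (auto intro: integrable_ln_Zm)
    then show ?thesis using expected_log_eq[of 1 h] by (simp add: prob_space)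
  qed
  have "expected_log h (Suc n) \<ge> real (Suc n) * (ln (p 1) + h)" for n
  proof (induction n)
    case 0
    then show ?case using 1 by simp
  next
    case (Suc n)
    then show ?case using expected_log_superadditive[of "Suc n" 1 h] 1 by (simp add: algebra_simps)
  qed
  then have "ln (p 1) + h \<le> expected_log h n / real n" if "n \<ge> 1" for n
    using that by (cases n) (auto simp: le_divide_eq mult.commute)
  then show "\<exists>N. \<forall>n\<ge>N. ln (p 1) + h \<le> expected_log h n / real n" by blast
qed

lemma fe_mono:
  assumes "h \<le> h'"
  shows "fe h \<le> fe h'"
proof (rule LIMSEQ_le[OF fe_tendsto fe_tendsto], intro exI allI impI)
  fix n :: nat assume n: "n \<ge> 1"
  show "expected_log h n / real n \<le> expected_log h' n / real n"
    unfolding expected_log_def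
  proof (intro divide_right_mono integral_mono)
    show "ln (Zw h \<omega> 0 n) \<le> ln (Zw h' \<omega> 0 n)" for \<omega>
      using window_mono[OF assms, of \<omega> 0 n] Zw_pos[of 0 n] by (subst ln_le_cancel_iff) auto
  qed (use n integrable_ln_Zw in auto)
qed

section \<open>The alternative free energy: existence, regularity, positivity\<close>

definition mu :: "real \<Rightarrow> real" where "mu h = lim (\<lambda>n. - ln (moment 1 h n) / real n)"

text \<open>Jensen's inequality for the exponential, in tangent form at the mean \<open>e\<close>.
  It provides the linear lower bound needed for convergence.\<close>

lemma ln_moment_lower:
  assumes n: "n \<ge> 1"
  shows "ln (moment 1 h n) \<ge> - (2 * ln 2 + \<bar>h\<bar> + mean_abs) * real n"
proof -
  define X where "X \<omega> = ln (Zm h \<omega> 0 n)" for \<omega>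
  define e where "e = (\<integral>\<omega>. X \<omega> \<partial>Q)"
  have iX: "integrable Q X" unfolding X_def by (rule integrable_ln_Zm[OF n])
  have "exp (- e) = (\<integral>\<omega>. exp (- e) * (1 + (e - X \<omega>)) \<partial>Q)"
    using iX by (simp add: prob_space e_def)
  also have "\<dots> \<le> moment 1 h n" unfolding moment_def
  proof (rule integral_mono)
    show "integrable Q (\<lambda>\<omega>. Zm h \<omega> 0 n powr - 1)" by (rule Zm_powr_integrable) (use n in auto)
    show "exp (- e) * (1 + (e - X \<omega>)) \<le> Zm h \<omega> 0 n powr - 1" for \<omega>
    proof -
      have "exp (- e) * (1 + (e - X \<omega>)) \<le> exp (- e) * exp (e - X \<omega>)"
        by (intro mult_left_mono exp_ge_add_one_self) auto
      also have "\<dots> = exp (- X \<omega>)" by (simp flip: exp_add)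
      also have "\<dots> = Zm h \<omega> 0 n powr - 1" using Zm_pos[of 0 n h \<omega>] n by (simp add: powr_def X_def)
      finally show ?thesis .
    qed
  qed (use iX in simp)
  finally have "- e \<le> ln (moment 1 h n)" using moment_pos[OF n, of 1 h] by (simp add: ln_ge_iff)
  then show ?thesis using expected_ln_Zm_le[OF n, of h] unfolding e_def X_def mult_minus_left by linarith
qed

lemma mu_tendsto: "(\<lambda>n. - ln (moment 1 h n) / real n) \<longlonglongrightarrow> mu h"
proof -
  have "convergent (\<lambda>n. ln (moment 1 h n) / real n)"
  proof (rule almost_subadditive_convergent)
    show "ln (moment 1 h (m + n)) \<le> ln (moment 1 h m) + ln (moment 1 h n) + err h m" if "m \<ge> 1" "n \<ge> 1" for m n
      using ln_moment_subadditive[OF that, of 1 h] by simp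
  qed (rule err_nonneg err_tendsto ln_moment_lower)+
  then have "convergent (\<lambda>n. - (ln (moment 1 h n) / real n))" by (simp only: convergent_minus_iff[symmetric])
  then show ?thesis unfolding mu_def by (simp add: convergent_LIMSEQ_iff)
qed

lemma
  assumes h: "h \<le> h'" and n: "n \<ge> 1"
  shows moment_antimono: "moment 1 h' n \<le> moment 1 h n"
    and moment_lipschitz: "moment 1 h n \<le> exp (real n * (h' - h)) * moment 1 h' n"
proof -
  have i: "integrable Q (\<lambda>\<omega>. Zm h \<omega> 0 n powr - 1)" for h by (rule Zm_powr_integrable) (use n in auto)
  have pos: "Zm h \<omega> 0 n > 0" for h \<omega> by (rule Zm_pos) (use n in auto)
  show "moment 1 h' n \<le> moment 1 h n"
    unfolding moment_def
  proof (rule integral_mono[OF i i])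
    show "Zm h' \<omega> 0 n powr - 1 \<le> Zm h \<omega> 0 n powr - 1" for \<omega>
      using window_minus_mono[OF h, of 0 n \<omega>] pos[of h \<omega>] n by (intro powr_mono2') auto
  qed
  have "moment 1 h n \<le> (\<integral>\<omega>. exp (real n * (h' - h)) * Zm h' \<omega> 0 n powr - 1 \<partial>Q)"
    unfolding moment_def
  proof (rule integral_mono[OF i integrable_mult_right[OF i]])
    fix \<omega>
    have "Zm h' \<omega> 0 n \<le> exp (real n * (h' - h)) * Zm h \<omega> 0 n"
      using window_minus_lipschitz[OF h, of 0 n \<omega>] n by simp
    then show "Zm h \<omega> 0 n powr - 1 \<le> exp (real n * (h' - h)) * Zm h' \<omega> 0 n powr - 1"
      using pos[of h \<omega>] pos[of h' \<omega>] by (simp add: powr_minus_divide field_simps)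
  qed
  then show "moment 1 h n \<le> exp (real n * (h' - h)) * moment 1 h' n"
    unfolding moment_def by (simp only: integral_mult_right_zero)
qed

lemma mu_mono_lipschitz:
  assumes h: "h \<le> h'"
  shows "mu h \<le> mu h'" "mu h' \<le> mu h + (h' - h)"
proof -
  show "mu h \<le> mu h'"
  proof (rule LIMSEQ_le[OF mu_tendsto mu_tendsto], intro exI allI impI)
    fix n :: nat assume n: "n \<ge> 1"
    have "ln (moment 1 h' n) \<le> ln (moment 1 h n)"
      using moment_antimono[OF h n] moment_pos[OF n, of 1] by (subst ln_le_cancel_iff) auto
    then show "- ln (moment 1 h n) / real n \<le> - ln (moment 1 h' n) / real n" by (intro divide_right_mono) auto
  qed
  have "(\<lambda>n. - ln (moment 1 h n) / real n + (h' - h)) \<longlonglongrightarrow> mu h + (h' - h)"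
    by (intro tendsto_intros mu_tendsto)
  then show "mu h' \<le> mu h + (h' - h)"
  proof (rule LIMSEQ_le[OF mu_tendsto], intro exI allI impI)
    fix n :: nat assume n: "n \<ge> 1"
    have "ln (moment 1 h n) \<le> ln (exp (real n * (h' - h)) * moment 1 h' n)"
      using moment_lipschitz[OF h n] moment_pos[OF n, of 1] by (subst ln_le_cancel_iff) auto
    also have "\<dots> = real n * (h' - h) + ln (moment 1 h' n)" using moment_pos[OF n, of 1 h'] by (simp add: ln_mult)
    finally have "- ln (moment 1 h' n) / real n \<le> (real n * (h' - h) - ln (moment 1 h n)) / real n"
      by (intro divide_right_mono) auto
    also have "\<dots> = - ln (moment 1 h n) / real n + (h' - h)" using n by (simp add: diff_divide_distrib)
    finally show "- ln (moment 1 h' n) / real n \<le> - ln (moment 1 h n) / real n + (h' - h)" .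
  qed
qed

text \<open>Second-order expansion of the mean of \<open>exp (- \<theta> * X)\<close> at
  \<open>\<theta> = 0\<close>, with \<open>X\<close> the logarithm of the window. The slope is minus
  the mean of \<open>X\<close>, and the remainder is uniform in \<open>\<theta>\<close> because
  \<open>X\<close> is bounded by a linear function of finitely many
  \<open>\<bar>\<omega> c\<bar>\<close> and thus has exponential moments.\<close>

lemma moment_small_exponent:
  assumes m: "m \<ge> 1"
  shows "\<exists>K>0. \<forall>\<theta>\<in>{0<..1}. ln (moment \<theta> h m) \<le> - \<theta> * (\<integral>\<omega>. ln (Zm h \<omega> 0 m) \<partial>Q) + \<theta>\<^sup>2 * K"
proof -
  define X where "X \<omega> = ln (Zm h \<omega> 0 m)" for \<omega>
  have iX: "integrable Q X" unfolding X_def by (rule integrable_ln_Zm[OF m])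
  \<comment> \<open>\<open>G\<close> dominates \<open>exp (2 * \<bar>X \<omega>\<bar>)\<close>: one
    factor \<open>exp \<bar>X \<omega>\<bar>\<close> bounds the intermediate point of Taylor's
    formula, the other bounds half the square.\<close>
  define G where "G \<omega> = 2 * exp (2 * log_bound h m) * exp (\<Sum>c\<in>{1..m}. 2 * \<bar>\<omega> c\<bar>)" for \<omega> :: "nat \<Rightarrow> real"
  have iG: "integrable Q G"
  proof -
    have "integrable Q (\<lambda>\<omega>. exp (\<Sum>c\<in>{1..m}. 2 * \<bar>\<omega> c\<bar>))"
      by (rule integrable_exp_abs_sum) simp_all
    then show ?thesis unfolding G_def by simp
  qed
  define K where "K = (\<integral>\<omega>. G \<omega> \<partial>Q) + 1"
  have G0: "G \<omega> \<ge> 0" for \<omega> unfolding G_def by simp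
  have K: "K > 0" unfolding K_def using integral_nonneg_AE[of G Q] G0 by (simp add: add_nonneg_pos)
  have ptw: "Zm h \<omega> 0 m powr - \<theta> \<le> 1 - \<theta> * X \<omega> + \<theta>\<^sup>2 * G \<omega>" if \<theta>: "\<theta> \<in> {0<..1}" for \<theta> \<omega>
  proof -
    have "Zm h \<omega> 0 m powr - \<theta> = exp (- \<theta> * X \<omega>)" using Zm_pos[of 0 m h \<omega>] m by (simp add: powr_def X_def)
    also have "\<dots> \<le> 1 - \<theta> * X \<omega> + \<theta>\<^sup>2 * G \<omega>"
    proof -
      obtain t where t: "\<bar>t\<bar> \<le> \<bar>- \<theta> * X \<omega>\<bar>" "exp (- \<theta> * X \<omega>) = (\<Sum>k<2. (- \<theta> * X \<omega>) ^ k / fact k) + exp t / fact 2 * (- \<theta> * X \<omega>) ^ 2"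
        using Maclaurin_exp_le[of "- \<theta> * X \<omega>" 2] by auto
      have tX: "t \<le> \<bar>X \<omega>\<bar>"
      proof -
        have "\<theta> * \<bar>X \<omega>\<bar> \<le> 1 * \<bar>X \<omega>\<bar>" using \<theta> by (intro mult_right_mono) auto
        then show ?thesis using t(1) \<theta> by (simp add: abs_mult)
      qed
      have sq: "(X \<omega>)\<^sup>2 / 2 \<le> exp \<bar>X \<omega>\<bar>" using exp_lower_Taylor_quadratic[of "\<bar>X \<omega>\<bar>"] by simp
      have "exp t / 2 * (X \<omega>)\<^sup>2 = exp t * ((X \<omega>)\<^sup>2 / 2)" by simp
      also have "\<dots> \<le> exp \<bar>X \<omega>\<bar> * exp \<bar>X \<omega>\<bar>" using tX sq by (intro mult_mono) auto
      also have "\<dots> = exp (2 * \<bar>X \<omega>\<bar>)" by (simp flip: exp_add)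
      also have "\<dots> \<le> exp (2 * (log_bound h m + (\<Sum>c\<in>{1..m}. \<bar>\<omega> c\<bar>)))"
        using abs_ln_Zm_le[OF m, of h \<omega>] by (simp add: X_def)
      also have "\<dots> = exp (2 * log_bound h m) * exp (\<Sum>c\<in>{1..m}. 2 * \<bar>\<omega> c\<bar>)"
        by (simp add: exp_add[symmetric] distrib_left sum_distrib_left)
      also have "\<dots> \<le> G \<omega>" unfolding G_def by simp
      finally have "\<theta>\<^sup>2 * (exp t / 2 * (X \<omega>)\<^sup>2) \<le> \<theta>\<^sup>2 * G \<omega>" by (intro mult_left_mono) auto
      then show ?thesis using t(2) by (simp add: numeral_2_eq_2 power_mult_distrib mult_ac)
    qed
    finally show ?thesis .
  qed
  have "ln (moment \<theta> h m) \<le> - \<theta> * (\<integral>\<omega>. ln (Zm h \<omega> 0 m) \<partial>Q) + \<theta>\<^sup>2 * K" if \<theta>: "\<theta> \<in> {0<..1}" for \<theta>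
  proof -
    have "moment \<theta> h m \<le> (\<integral>\<omega>. 1 - \<theta> * X \<omega> + \<theta>\<^sup>2 * G \<omega> \<partial>Q)"
      unfolding moment_def
      by (rule integral_mono[OF Zm_powr_integrable _ ptw[OF \<theta>]]) (use m \<theta> iX iG in auto)
    also have "\<dots> = 1 - \<theta> * (\<integral>\<omega>. X \<omega> \<partial>Q) + \<theta>\<^sup>2 * (K - 1)"
      using iX iG by (simp add: prob_space K_def)
    finally have "moment \<theta> h m - 1 \<le> - \<theta> * (\<integral>\<omega>. X \<omega> \<partial>Q) + \<theta>\<^sup>2 * (K - 1)" by simp
    moreover have "ln (moment \<theta> h m) \<le> moment \<theta> h m - 1" using moment_pos[OF m, of \<theta> h] \<theta> by (intro ln_le_minus_one) auto
    moreover have "\<theta>\<^sup>2 * (K - 1) \<le> \<theta>\<^sup>2 * K" by (intro mult_left_mono) auto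
    ultimately show ?thesis unfolding X_def by linarith
  qed
  then show ?thesis using K by blast
qed

text \<open>As \<open>err h m\<close> is sublinear, some \<open>m\<close> has mean log-window
  exceeding \<open>err h m\<close>. In \<open>ln (moment \<theta> h m) + \<theta> * err h m\<close>
  both terms are of first order in \<open>\<theta>\<close> with a negative total slope, so for small
  \<open>\<theta>\<close> the sum is negative and subadditivity gives exponential decay of the
  moments of order \<open>- \<theta>\<close>. The remaining power \<open>- (1 - \<theta>)\<close> is
  bounded through \<open>p n\<close>, whose decay is slower than any exponential.\<close>

lemma mu_pos:
  assumes f: "fe h > 0"
  shows "mu h > 0"
proof -
  have "(\<lambda>m. expected_log h m / real m - (h / real m + err h m / real m)) \<longlonglongrightarrow> fe h - (0 + 0)"
    by (intro tendsto_intros fe_tendsto err_tendsto tendsto_divide_0[OF tendsto_const]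
        filterlim_at_top_imp_at_infinity[OF filterlim_real_sequentially])
  then have "eventually (\<lambda>m. expected_log h m / real m - (h / real m + err h m / real m) > 0) sequentially"
    using f by (intro order_tendstoD(1)) auto
  then obtain N where N: "\<And>m. m \<ge> N \<Longrightarrow> expected_log h m / real m - (h / real m + err h m / real m) > 0"
    by (auto simp: eventually_sequentially)
  define m where "m = max 1 N"
  have m: "m \<ge> 1" by (simp add: m_def)
  define e where "e = (\<integral>\<omega>. ln (Zm h \<omega> 0 m) \<partial>Q)"
  define D where "D = e - err h m"
  have "(expected_log h m - h - err h m) / real m > 0"
    using N[of m] by (simp add: m_def diff_divide_distrib)
  then have D: "D > 0" using m expected_log_eq[OF m, of h] by (simp add: D_def e_def zero_less_divide_iff)
  obtain K where K: "K > 0" "\<And>\<theta>. \<theta> \<in> {0<..1} \<Longrightarrow> ln (moment \<theta> h m) \<le> - \<theta> * e + \<theta>\<^sup>2 * K"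
    using moment_small_exponent[OF m, of h] unfolding e_def by blast
  \<comment> \<open>Chosen so that the quadratic term \<open>\<theta>\<^sup>2 * K\<close> uses up at
    most half of the gain \<open>\<theta> * D\<close>.\<close>
  define \<theta> where "\<theta> = min 1 (D / (2 * K))"
  have \<theta>: "0 < \<theta>" "\<theta> \<le> 1" unfolding \<theta>_def using D K by auto
  have "ln (moment \<theta> h m) + \<theta> * err h m \<le> - \<theta> * D + \<theta>\<^sup>2 * K"
    using K(2)[of \<theta>] \<theta> by (simp add: D_def algebra_simps)
  also have "\<dots> \<le> - \<theta> * D + \<theta> * (D / 2)"
  proof -
    have "\<theta> * K \<le> D / (2 * K) * K" using K by (intro mult_right_mono) (auto simp: \<theta>_def)
    then have "\<theta> * (\<theta> * K) \<le> \<theta> * (D / 2)" using K \<theta> by (intro mult_left_mono) auto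
    then show ?thesis by (simp only: power2_eq_square mult.assoc)
  qed
  finally have neg: "ln (moment \<theta> h m) + \<theta> * err h m \<le> - \<theta> * D / 2" by (simp add: mult.commute[of D \<theta>])
  define \<beta> where "\<beta> = \<theta> * D / (2 * real m)"
  have \<beta>: "\<beta> > 0" unfolding \<beta>_def using \<theta> D m by simp
  have "eventually (\<lambda>n. ln (moment \<theta> h n) / real n \<le> (ln (moment \<theta> h m) + \<theta> * err h m) / real m + \<beta> / 2) sequentially"
    using ln_moment_subadditive[OF _ _ \<theta>, of _ _ h] m \<beta> by (intro almost_subadditive_upper) auto
  moreover have "(ln (moment \<theta> h m) + \<theta> * err h m) / real m \<le> (- \<theta> * D / 2) / real m"
    using neg by (intro divide_right_mono) auto
  then have "(ln (moment \<theta> h m) + \<theta> * err h m) / real m \<le> - \<beta>" by (simp add: \<beta>_def)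
  ultimately have up: "eventually (\<lambda>n. ln (moment \<theta> h n) / real n \<le> - \<beta> / 2) sequentially"
    by (auto elim!: eventually_mono)
  \<comment> \<open>The moments of order \<open>- \<theta>\<close> decay at rate
    \<open>\<beta> / 2\<close>; spending \<open>\<beta> / 4\<close> on the lower bound for
    \<open>p\<close> leaves \<open>\<beta> / 4\<close>.\<close>
  obtain c where c: "c > 0" "\<And>t. t \<ge> 1 \<Longrightarrow> p t \<ge> c * exp (- (\<beta> / 4) * real t)"
    using p_subexponential[of "\<beta> / 4"] \<beta> by auto
  have "eventually (\<lambda>n. \<beta> / 4 + ln c / real n \<le> - ln (moment 1 h n) / real n) sequentially"
    using up eventually_ge_at_top[of 1]
  proof eventually_elim
    case (elim n)
    have Zn: "Zm h \<omega> 0 n > 0" for \<omega> using Zm_pos elim by auto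
    have pn: "p n > 0" "p n \<le> 1" using p_pos[of n] p_le_1[of n] elim by auto
    have "moment 1 h n \<le> (\<integral>\<omega>. (1 / p n) * Zm h \<omega> 0 n powr - \<theta> \<partial>Q)"
      unfolding moment_def
    proof (rule integral_mono[OF Zm_powr_integrable integrable_mult_right[OF Zm_powr_integrable]])
      fix \<omega>
      have "Zm h \<omega> 0 n powr - 1 = Zm h \<omega> 0 n powr - (1 - \<theta>) * Zm h \<omega> 0 n powr - \<theta>"
        by (simp flip: powr_add)
      also have "\<dots> \<le> p n powr - (1 - \<theta>) * Zm h \<omega> 0 n powr - \<theta>"
        using B.window_minus_ge[of 0 n h \<omega>] pn \<theta> elim by (intro mult_right_mono powr_mono2') auto
      also have "\<dots> \<le> (1 / p n) * Zm h \<omega> 0 n powr - \<theta>"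
      proof (rule mult_right_mono)
        have "p n powr - (1 - \<theta>) \<le> p n powr - 1" using pn \<theta> by (intro powr_mono') auto
        then show "p n powr - (1 - \<theta>) \<le> 1 / p n" using pn by (simp add: powr_minus_divide)
      qed simp
      finally show "Zm h \<omega> 0 n powr - 1 \<le> (1 / p n) * Zm h \<omega> 0 n powr - \<theta>" .
    qed (use elim \<theta> in auto)
    also have "\<dots> = (1 / p n) * moment \<theta> h n" unfolding moment_def by simp
    finally have "ln (moment 1 h n) \<le> ln ((1 / p n) * moment \<theta> h n)"
      using moment_pos[of n 1 h] moment_pos[of n \<theta> h] elim \<theta> pn by (subst ln_le_cancel_iff) auto
    also have "\<dots> = - ln (p n) + ln (moment \<theta> h n)"
      using moment_pos[of n \<theta> h] elim \<theta> pn by (simp add: ln_mult ln_div)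
    finally have "ln (moment 1 h n) \<le> - ln (p n) + ln (moment \<theta> h n)" .
    moreover have "ln (moment \<theta> h n) \<le> - (\<beta> / 2) * real n" using elim by (simp add: divide_le_eq)
    moreover have "ln (c * exp (- (\<beta> / 4) * real n)) \<le> ln (p n)"
      using c(2)[of n] c(1) elim pn by (subst ln_le_cancel_iff) auto
    then have "ln c - (\<beta> / 4) * real n \<le> ln (p n)" using c(1) by (simp add: ln_mult)
    ultimately have "(\<beta> / 4) * real n + ln c \<le> - ln (moment 1 h n)" by (simp add: algebra_simps)
    then have "((\<beta> / 4) * real n + ln c) / real n \<le> - ln (moment 1 h n) / real n" by (rule divide_right_mono) simp
    then show ?case using elim by (simp add: add_divide_distrib)
  qed
  moreover have "(\<lambda>n. \<beta> / 4 + ln c / real n) \<longlonglongrightarrow> \<beta> / 4 + 0"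
    by (intro tendsto_intros tendsto_divide_0[OF tendsto_const] filterlim_at_top_imp_at_infinity[OF filterlim_real_sequentially])
  ultimately have "\<beta> / 4 + 0 \<le> mu h"
    using mu_tendsto by (intro tendsto_le[OF sequentially_bot])
  then show ?thesis using \<beta> by simp
qed

end

subsection \<open>Almost sure estimates\<close>

text \<open>Borel--Cantelli together with Markov's inequality, in the shape of monotone convergence:
  the sum of all \<open>f n\<close> has finite mean, so it is finite almost everywhere.\<close>

lemma AE_tendsto_zero_of_summable_integrals:
  fixes f :: "nat \<Rightarrow> 'a \<Rightarrow> real"
  assumes i: "\<And>n. integrable M (f n)" and nn: "\<And>n x. f n x \<ge> 0" and s: "summable (\<lambda>n. \<integral>x. f n x \<partial>M)"
  shows "AE x in M. (\<lambda>n. f n x) \<longlonglongrightarrow> 0"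
proof -
  have [measurable]: "f n \<in> borel_measurable M" for n using i by auto
  have "(\<integral>\<^sup>+x. (\<Sum>n. ennreal (f n x)) \<partial>M) = (\<Sum>n. \<integral>\<^sup>+x. ennreal (f n x) \<partial>M)"
    by (rule nn_integral_suminf) measurable
  also have "\<dots> = (\<Sum>n. ennreal (\<integral>x. f n x \<partial>M))"
    using nn_integral_eq_integral[OF i] nn by simp
  also have "\<dots> \<noteq> \<infinity>"
    using s nn by (subst suminf_ennreal2) (auto intro!: integral_nonneg_AE)
  finally have "AE x in M. (\<Sum>n. ennreal (f n x)) \<noteq> \<infinity>"
    by (intro nn_integral_noteq_infinite) measurable
  then show ?thesis
  proof (rule AE_mp, intro AE_I2 impI)
    fix x assume "(\<Sum>n. ennreal (f n x)) \<noteq> \<infinity>"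
    then have "summable (\<lambda>n. f n x)" using nn by (intro summable_suminf_not_top) auto
    then show "(\<lambda>n. f n x) \<longlonglongrightarrow> 0" by (rule summable_LIMSEQ_zero)
  qed
qed

lemma eventually_bounded_imp_bounded:
  fixes f :: "nat \<Rightarrow> real"
  assumes "eventually (\<lambda>n. f n \<le> K) sequentially"
  shows "\<exists>C>0. \<forall>n. f n \<le> C"
proof -
  obtain N where N: "\<And>n. n \<ge> N \<Longrightarrow> f n \<le> K" using assms by (auto simp: eventually_sequentially)
  define C where "C = Max (insert 1 (insert K (f ` {..N})))"
  have fin: "finite (insert 1 (insert K (f ` {..N})))" by simp
  have "C \<ge> 1" "C \<ge> K" unfolding C_def by (rule Max_ge[OF fin]; simp)+
  moreover have "f n \<le> C" for n
  proof (cases "n \<le> N")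
    case True
    then show ?thesis unfolding C_def by (intro Max_ge[OF fin]) auto
  next
    case False
    then show ?thesis using N[of n] \<open>C \<ge> K\<close> by simp
  qed
  ultimately show ?thesis by (intro exI[of _ C]) auto
qed

lemma geometric_tail_sum:
  fixes r :: real
  assumes r: "0 < r" "r < 1"
  shows "(\<Sum>a\<in>{a. a + m \<le> b}. r ^ (b - a)) \<le> r ^ m / (1 - r)"
proof (cases "m \<le> b")
  case True
  have "(\<Sum>a\<in>{a. a + m \<le> b}. r ^ (b - a)) = (\<Sum>j\<le>b - m. r ^ m * r ^ j)"
    by (rule sum.reindex_bij_witness[where i = "\<lambda>j. b - m - j" and j = "\<lambda>a. b - m - a"])
       (use True in \<open>auto simp flip: power_add\<close>)
  also have "\<dots> = r ^ m * (\<Sum>j\<le>b - m. r ^ j)" by (simp add: sum_distrib_left)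
  also have "\<dots> \<le> r ^ m * (\<Sum>j. r ^ j)"
    using r by (intro mult_left_mono sum_le_suminf summable_geometric) auto
  also have "\<dots> = r ^ m / (1 - r)" using r by (simp add: suminf_geometric)
  finally show ?thesis .
next
  case False
  then have "{a. a + m \<le> b} = {}" by auto
  then show ?thesis using r by simp
qed

text \<open>The ceiling of \<open>c * ln (2 ^ i)\<close>: the length c log n at the dyadic scale n =
  2^i.\<close>

definition log_scale :: "real \<Rightarrow> nat \<Rightarrow> nat" where
  "log_scale c i = nat \<lceil>c * (real i * ln 2)\<rceil>"

lemma log_scale_ge: "real (log_scale c i) \<ge> c * (real i * ln 2)"
  unfolding log_scale_def by (metis of_nat_ceiling)

lemma log_scale_le: "c \<ge> 0 \<Longrightarrow> real (log_scale c i) \<le> c * (real i * ln 2) + 1"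
  unfolding log_scale_def by (simp add: of_nat_nat)

lemma log_scale_pos: "c > 0 \<Longrightarrow> i \<ge> 1 \<Longrightarrow> log_scale c i \<ge> 1"
proof -
  assume "c > 0" "i \<ge> 1"
  then have "c * (real i * ln 2) > 0" by simp
  then show ?thesis using log_scale_ge[of c i] by linarith
qed

lemma log_scale_at_top: "c > 0 \<Longrightarrow> filterlim (log_scale c) at_top sequentially"
proof -
  assume c: "c > 0"
  have "filterlim (\<lambda>i. real (log_scale c i)) at_top sequentially"
  proof (rule filterlim_at_top_mono)
    show "filterlim (\<lambda>i. c * (real i * ln 2)) at_top sequentially" using c by real_asymp
  qed (intro always_eventually allI log_scale_ge)
  then have "eventually (\<lambda>i. real Z \<le> real (log_scale c i)) sequentially" for Z
    unfolding filterlim_at_top by blast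
  then show ?thesis unfolding filterlim_at_top by simp
qed

context disordered_renewal
begin

section \<open>Long gaps: almost sure smallness\<close>

lemma inverse_Zm: "a < b \<Longrightarrow> 1 / Zm h \<omega> a b = Zm h \<omega> a b powr - 1"
  using Zm_pos[of a b h \<omega>] by (simp add: powr_minus_divide)

lemma integrable_inverse_Zm: "a < b \<Longrightarrow> integrable Q (\<lambda>\<omega>. 1 / Zm h \<omega> a b)"
  unfolding inverse_Zm by (rule Zm_powr_integrable) auto

lemma integral_inverse_Zm:
  assumes "a < b"
  shows "(\<integral>\<omega>. 1 / Zm h \<omega> a b \<partial>Q) = moment 1 h (b - a)"
  using Zm_shift_integral[of "\<lambda>z. z powr - 1" h a "b - a"] assms
  unfolding inverse_Zm[OF assms] moment_def by simp

lemma moment_upper: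
  assumes "\<beta> < mu h"
  shows "\<exists>C>0. \<forall>k\<ge>1. moment 1 h k \<le> C * exp (- \<beta>) ^ k"
proof -
  have "eventually (\<lambda>k. - ln (moment 1 h k) / real k > \<beta>) sequentially"
    using mu_tendsto assms by (rule order_tendstoD(1))
  then have ev: "eventually (\<lambda>k. (if k \<ge> 1 then moment 1 h k * exp \<beta> ^ k else 0) \<le> 1) sequentially"
    using eventually_ge_at_top[of 1]
  proof eventually_elim
    case (elim k)
    then have "\<beta> * real k < - ln (moment 1 h k)" by (subst (asm) pos_less_divide_eq) auto
    then have "exp (\<beta> * real k + ln (moment 1 h k)) \<le> exp 0" by (subst exp_le_cancel_iff) linarith
    then show ?case using moment_pos[of k 1 h] elim by (simp add: exp_add mult.commute flip: exp_of_nat_mult)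
  qed
  then obtain C where C: "C > 0" "\<And>k. (if k \<ge> 1 then moment 1 h k * exp \<beta> ^ k else 0) \<le> C"
    using eventually_bounded_imp_bounded[OF ev] by blast
  have "moment 1 h k \<le> C * exp (- \<beta>) ^ k" if "k \<ge> 1" for k
  proof -
    have "moment 1 h k * exp \<beta> ^ k * exp (- \<beta>) ^ k \<le> C * exp (- \<beta>) ^ k"
      using C(2)[of k] that by (intro mult_right_mono) auto
    then show ?thesis by (simp add: mult.assoc exp_minus flip: power_mult_distrib)
  qed
  then show ?thesis using C(1) by blast
qed

definition up_sum :: "real \<Rightarrow> nat \<Rightarrow> nat \<Rightarrow> (nat \<Rightarrow> real) \<Rightarrow> real" where
  "up_sum h m N \<omega> = (\<Sum>b\<in>{..N}. \<Sum>a\<in>{a. a + m \<le> b}. 1 / Zm h \<omega> a b)"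

lemma finite_gap_starts: "finite {a. a + m \<le> (b::nat)}"
  by (rule finite_subset[of _ "{..b}"]) auto

lemma up_sum_nonneg: "m \<ge> 1 \<Longrightarrow> up_sum h m N \<omega> \<ge> 0"
  unfolding up_sum_def by (intro sum_nonneg) (auto intro!: less_imp_le[OF Zm_pos])

text \<open>Monotonicity in all parameters lets one bound at a dyadic scale and a rational
  \<open>h\<close> serve all \<open>n\<close> of that scale and all larger \<open>h\<close>.\<close>

lemma up_sum_mono:
  assumes "1 \<le> m" "m \<le> m'" "N' \<le> N" and h: "h \<le> h'"
  shows "up_sum h' m' N' \<omega> \<le> up_sum h m N \<omega>"
proof -
  have nn: "1 / Zm h \<omega> a b \<ge> 0" if "a + m \<le> b" for a b
    using Zm_pos[of a b h \<omega>] that assms by auto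
  have "up_sum h' m' N' \<omega> \<le> up_sum h m' N' \<omega>"
    unfolding up_sum_def
  proof (intro sum_mono)
    fix a b assume "a \<in> {a. a + m' \<le> b}"
    then have ab: "a < b" using assms by auto
    show "1 / Zm h' \<omega> a b \<le> 1 / Zm h \<omega> a b"
      using window_minus_mono[OF h ab, of \<omega>] Zm_pos[OF ab, of h \<omega>] by (intro divide_left_mono) auto
  qed
  also have "\<dots> \<le> up_sum h m N' \<omega>"
    unfolding up_sum_def
    by (intro sum_mono sum_mono2 finite_gap_starts) (use assms nn in auto)
  also have "\<dots> \<le> up_sum h m N \<omega>"
    unfolding up_sum_def
    by (intro sum_mono2) (use assms nn in \<open>auto intro!: sum_nonneg\<close>)
  finally show ?thesis .
qed

text \<open>Prepared for 2^(i+1) \<le> n < 2^(i+2): the gap length is taken at the lower end of this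
  range and the set of gap ends at the upper end. There are about 2^(i+2) right ends
  \<open>b\<close>, each with mean contribution of order 2^(-\<beta> c (i+1)), and \<beta> c > 1
  makes the means summable.\<close>

lemma up_sum_AE:
  assumes mu: "mu h > 0" and c: "c * mu h > 1"
  shows "AE \<omega> in Q. (\<lambda>i. up_sum h (log_scale c (i + 1)) (2 ^ (i + 2)) \<omega>) \<longlonglongrightarrow> 0"
proof (rule AE_tendsto_zero_of_summable_integrals)
  have c0: "c > 0" using c mu by (metis less_trans zero_less_one zero_less_mult_pos2)
  \<comment> \<open>The midpoint of \<open>1 / c\<close> and \<open>mu h\<close>: small enough for
    \<open>moment_upper\<close>, large enough for \<open>\<beta> * c > 1\<close>.\<close>
  define \<beta> where "\<beta> = (1 / c + mu h) / 2"
  have "1 / c < mu h" using c c0 by (simp add: divide_less_eq mult.commute)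
  then have \<beta>: "\<beta> < mu h" "1 / c < \<beta>" by (auto simp: \<beta>_def)
  then have \<beta>0: "\<beta> > 0" using c0 by (auto intro: less_trans[rotated])
  have \<beta>c: "\<beta> * c > 1" using \<beta>(2) c0 by (simp add: divide_less_eq)
  obtain C where C: "C > 0" "\<And>k. k \<ge> 1 \<Longrightarrow> moment 1 h k \<le> C * exp (- \<beta>) ^ k"
    using moment_upper[OF \<beta>(1)] by blast
  define r where "r = exp (- \<beta>)"
  have r: "0 < r" "r < 1" using \<beta>0 by (auto simp: r_def)
  define m where "m i = log_scale c (i + 1)" for i
  have m1: "m i \<ge> 1" for i unfolding m_def using c0 by (intro log_scale_pos) auto
  show "integrable Q (up_sum h (log_scale c (i + 1)) (2 ^ (i + 2)))" for i
    unfolding up_sum_def[abs_def]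
    using m1[of i] by (intro Bochner_Integration.integrable_sum integrable_inverse_Zm) (auto simp: m_def)
  show "0 \<le> up_sum h (log_scale c (i + 1)) (2 ^ (i + 2)) \<omega>" for i \<omega>
    using m1[of i] by (intro up_sum_nonneg) (simp add: m_def)
  \<comment> \<open>\<open>s\<close> is 2 to the power \<open>1 - \<beta> * c\<close>: per scale the
    number of right ends doubles while the bound for each tail shrinks by 2 to the power
    \<open>- \<beta> * c\<close>.\<close>
  define s where "s = exp ((1 - \<beta> * c) * ln 2)"
  have s: "0 < s" "s < 1" using \<beta>c by (auto simp: s_def mult_neg_pos)
  have bound: "(\<integral>\<omega>. up_sum h (m i) (2 ^ (i + 2)) \<omega> \<partial>Q) \<le> (4 * C / (1 - r)) * s ^ (i + 1)" for i
  proof -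
    have int: "integrable Q (\<lambda>\<omega>. 1 / Zm h \<omega> a b)" if "a \<in> {a. a + m i \<le> b}" for a b
      using that m1[of i] by (intro integrable_inverse_Zm) auto
    have "(\<integral>\<omega>. up_sum h (m i) (2 ^ (i + 2)) \<omega> \<partial>Q)
        = (\<Sum>b\<in>{..2 ^ (i + 2)}. \<Sum>a\<in>{a. a + m i \<le> b}. (\<integral>\<omega>. 1 / Zm h \<omega> a b \<partial>Q))"
      unfolding up_sum_def
      by (subst Bochner_Integration.integral_sum, intro Bochner_Integration.integrable_sum int, assumption,
          intro sum.cong refl Bochner_Integration.integral_sum int)
    also have "\<dots> \<le> (\<Sum>b\<in>{..2 ^ (i + 2)}. \<Sum>a\<in>{a. a + m i \<le> b}. C * r ^ (b - a))"
    proof (intro sum_mono)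
      fix b a assume "a \<in> {a. a + m i \<le> b}"
      then have "a < b" using m1[of i] by auto
      then show "(\<integral>\<omega>. 1 / Zm h \<omega> a b \<partial>Q) \<le> C * r ^ (b - a)"
        using C(2)[of "b - a"] by (simp add: integral_inverse_Zm r_def)
    qed
    also have "\<dots> \<le> (\<Sum>b\<in>{..(2::nat) ^ (i + 2)}. C * (r ^ m i / (1 - r)))"
      unfolding sum_distrib_left[symmetric]
      using C(1) by (intro sum_mono mult_left_mono geometric_tail_sum r) auto
    also have "\<dots> = (2 ^ (i + 2) + 1) * (C * (r ^ m i / (1 - r)))" by simp
    also have "\<dots> \<le> (4 * 2 ^ (i + 1)) * (C * (exp (- \<beta> * c * (real (i + 1) * ln 2)) / (1 - r)))"
    proof (rule mult_mono)
      have "(1::real) \<le> 2 ^ (i + 2)" by (rule one_le_power) simp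
      then show "(2::real) ^ (i + 2) + 1 \<le> 4 * 2 ^ (i + 1)" by simp
      have "r ^ m i = exp (- \<beta> * real (m i))" by (simp add: r_def mult.commute flip: exp_of_nat_mult)
      also have "\<dots> \<le> exp (- \<beta> * c * (real (i + 1) * ln 2))"
        using mult_left_mono[OF log_scale_ge[of c "i + 1"], of \<beta>] \<beta>0 by (simp add: m_def mult.assoc)
      finally show "C * (r ^ m i / (1 - r)) \<le> C * (exp (- \<beta> * c * (real (i + 1) * ln 2)) / (1 - r))"
        using C r by (intro mult_left_mono divide_right_mono) auto
    qed (use C r in auto)
    also have "2 ^ (i + 1) = exp (real (i + 1) * ln 2)" by (simp only: exp_of_nat_mult) simp
    also have "(4 * exp (real (i + 1) * ln 2)) * (C * (exp (- \<beta> * c * (real (i + 1) * ln 2)) / (1 - r)))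
        = (4 * C / (1 - r)) * exp (real (i + 1) * ((1 - \<beta> * c) * ln 2))"
      by (simp add: algebra_simps exp_add exp_diff exp_minus field_simps)
    also have "exp (real (i + 1) * ((1 - \<beta> * c) * ln 2)) = s ^ (i + 1)" unfolding s_def by (rule exp_of_nat_mult)
    finally show ?thesis .
  qed
  show "summable (\<lambda>i. \<integral>\<omega>. up_sum h (log_scale c (i + 1)) (2 ^ (i + 2)) \<omega> \<partial>Q)"
  proof (rule summable_comparison_test')
    show "summable (\<lambda>i. (4 * C / (1 - r)) * s ^ (i + 1))"
      by (intro summable_mult summable_ignore_initial_segment summable_geometric) (use s in auto)
    show "norm (\<integral>\<omega>. up_sum h (log_scale c (i + 1)) (2 ^ (i + 2)) \<omega> \<partial>Q) \<le> (4 * C / (1 - r)) * s ^ (i + 1)" for i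
    proof -
      have "0 \<le> (\<integral>\<omega>. up_sum h (m i) (2 ^ (i + 2)) \<omega> \<partial>Q)"
        using m1[of i] by (intro integral_nonneg_AE AE_I2 up_sum_nonneg)
      then show ?thesis using bound[of i] by (simp add: m_def)
    qed
  qed
qed

text \<open>Gaussian variables have exponential moments of every order, bounded uniformly in the
  site, so division by (a+1)^2 gives summable means. The outcome is that a single reward on
  \<open>{1..n}\<close> is never smaller than an arbitrarily small negative power of
  \<open>n\<close>, up to a constant; this bounds the price of forcing a contact.\<close>

lemma disorder_growth_AE: "AE \<omega> in Q. \<forall>\<eta>>0. \<exists>C. \<forall>a. \<bar>\<omega> a\<bar> \<le> C + \<eta> * ln (real a + 1)"
proof -
  have "AE \<omega> in Q. (\<lambda>a. exp (real N * \<bar>\<omega> a\<bar>) / (real a + 1) ^ 2) \<longlonglongrightarrow> 0" for N :: nat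
  proof (rule AE_tendsto_zero_of_summable_integrals)
    show "integrable Q (\<lambda>\<omega>. exp (real N * \<bar>\<omega> a\<bar>) / (real a + 1) ^ 2)" for a
      by (intro integrable_divide integrable_exp_abs)
    show "summable (\<lambda>a. \<integral>\<omega>. exp (real N * \<bar>\<omega> a\<bar>) / (real a + 1) ^ 2 \<partial>Q)"
    proof (rule summable_comparison_test')
      have "summable (\<lambda>a. inverse ((real (a + 1)) ^ 2))"
        by (rule summable_ignore_initial_segment[OF inverse_power_summable]) simp
      then show "summable (\<lambda>a. 2 * exp ((real N)\<^sup>2 * covariance Q 0 / 2) * inverse ((real (a + 1)) ^ 2))"
        by (rule summable_mult)
      fix a :: nat
      have "norm (\<integral>\<omega>. exp (real N * \<bar>\<omega> a\<bar>) / (real a + 1) ^ 2 \<partial>Q) = (\<integral>\<omega>. exp (real N * \<bar>\<omega> a\<bar>) \<partial>Q) / (real a + 1) ^ 2"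
        by (simp add: abs_mult)
      also have "\<dots> \<le> 2 * exp ((real N)\<^sup>2 * covariance Q 0 / 2) / (real a + 1) ^ 2"
        by (intro divide_right_mono integral_exp_abs_le) auto
      finally show "norm (\<integral>\<omega>. exp (real N * \<bar>\<omega> a\<bar>) / (real a + 1) ^ 2 \<partial>Q)
          \<le> 2 * exp ((real N)\<^sup>2 * covariance Q 0 / 2) * inverse ((real (a + 1)) ^ 2)"
        by (simp only: divide_inverse of_nat_add of_nat_1)
    qed
  qed simp
  then have "AE \<omega> in Q. \<forall>N::nat. (\<lambda>a. exp (real N * \<bar>\<omega> a\<bar>) / (real a + 1) ^ 2) \<longlonglongrightarrow> 0"
    unfolding AE_all_countable by blast
  then show ?thesis
  proof (rule AE_mp, intro AE_I2 impI allI)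
    fix \<omega> :: "nat \<Rightarrow> real" and \<eta> :: real
    assume lim: "\<forall>N::nat. (\<lambda>a. exp (real N * \<bar>\<omega> a\<bar>) / (real a + 1) ^ 2) \<longlonglongrightarrow> 0" and \<eta>: "\<eta> > 0"
    \<comment> \<open>Taking logarithms turns the square into the slope \<open>2 / N\<close>, here
      below \<open>\<eta>\<close>; integer orders \<open>N\<close> keep the exceptional sets
      countable in number.\<close>
    obtain N :: nat where N: "2 / \<eta> < real N" using reals_Archimedean2 by blast
    then have N0: "real N > 0" using \<eta> by (meson divide_pos_pos less_trans zero_less_numeral)
    have "eventually (\<lambda>a. exp (real N * \<bar>\<omega> a\<bar>) / (real a + 1) ^ 2 < 1) sequentially"
      using lim by (intro order_tendstoD(2)) auto
    then have ev: "eventually (\<lambda>a. exp (real N * \<bar>\<omega> a\<bar>) / (real a + 1) ^ 2 \<le> 1) sequentially"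
      by (auto elim: eventually_mono)
    obtain C where C: "C > 0" "\<And>a. exp (real N * \<bar>\<omega> a\<bar>) / (real a + 1) ^ 2 \<le> C"
      using eventually_bounded_imp_bounded[OF ev] by blast
    have "\<bar>\<omega> a\<bar> \<le> ln C / real N + \<eta> * ln (real a + 1)" for a
    proof -
      have "exp (real N * \<bar>\<omega> a\<bar>) \<le> C * (real a + 1) ^ 2" using C(2)[of a] by (simp add: pos_divide_le_eq)
      then have "ln (exp (real N * \<bar>\<omega> a\<bar>)) \<le> ln (C * (real a + 1) ^ 2)" using C(1) by (subst ln_le_cancel_iff) auto
      also have "\<dots> = ln C + 2 * ln (real a + 1)" using C(1) by (simp add: ln_mult ln_realpow)
      finally have "\<bar>\<omega> a\<bar> \<le> (ln C + 2 * ln (real a + 1)) / real N" by (simp add: pos_le_divide_eq[OF N0] mult.commute)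
      also have "\<dots> = ln C / real N + (2 / real N) * ln (real a + 1)" by (simp add: add_divide_distrib)
      also have "\<dots> \<le> ln C / real N + \<eta> * ln (real a + 1)"
      proof -
        have "2 / real N \<le> \<eta>"
          using N by (simp add: pos_divide_le_eq[OF N0] pos_divide_less_eq[OF \<eta>] mult.commute)
        then show ?thesis by (intro add_left_mono mult_right_mono) auto
      qed
      finally show ?thesis .
    qed
    then show "\<exists>C. \<forall>a. \<bar>\<omega> a\<bar> \<le> C + \<eta> * ln (real a + 1)" by blast
  qed
qed

section \<open>Block sums: concentration around a diverging mean\<close>

definition gap_sum :: "real \<Rightarrow> nat \<Rightarrow> nat \<Rightarrow> nat \<Rightarrow> (nat \<Rightarrow> real) \<Rightarrow> real" where
  "gap_sum h k R J \<omega> = (\<Sum>j<J. p k / Zm h \<omega> (j * (k + 2 * R) + R) (j * (k + 2 * R) + R + k))"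

text \<open>Each summand lies between 0 and 1 because \<open>Zm\<close> is at least
  \<open>p k\<close>, hence its second moment is at most its mean \<open>q\<close>. Covariances of
  different blocks are at most \<open>6 * q\<close> times their coupling, and one window has total
  coupling at most \<open>2 * k * cov_sum\<close> with all the others together. The variance is
  therefore at most the mean \<open>J * q\<close> times a factor linear in \<open>k\<close>.\<close>

lemma gap_sum_variance:
  fixes h :: real and k R J :: nat
  assumes k: "k \<ge> 1"
  defines "q \<equiv> p k * moment 1 h k"
  shows "integrable Q (\<lambda>\<omega>. (gap_sum h k R J \<omega> - real J * q)\<^sup>2)"
    and "(\<integral>\<omega>. (gap_sum h k R J \<omega> - real J * q)\<^sup>2 \<partial>Q) \<le> real J * q * (1 + 12 * cov_sum * real k)"
proof -
  define L where "L = k + 2 * R"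
  define a where "a j = j * L + R" for j
  define X where "X j \<omega> = p k / Zm h \<omega> (a j) (a j + k)" for j \<omega>
  define W where "W j = {a j<..<a j + k}" for j
  have pk: "p k > 0" "p k \<le> 1" using p_pos p_le_1 k by auto
  have X01: "0 < X j \<omega>" "X j \<omega> \<le> 1" for j \<omega>
    using B.window_minus_ge[of "a j" "a j + k" h \<omega>] pk Zm_pos[of "a j" "a j + k" h \<omega>] k unfolding X_def by auto
  have [measurable]: "X j \<in> borel_measurable Q" for j unfolding X_def[abs_def] by measurable
  have iX: "integrable Q (X j)" for j
    by (rule integrable_const_bound[where B = 1]) (use X01 in \<open>auto simp: less_imp_le abs_of_pos\<close>)
  have iXX: "integrable Q (\<lambda>\<omega>. X i \<omega> * X j \<omega>)" for i j
    by (rule integrable_const_bound[where B = 1]) (use X01 in \<open>auto simp: less_imp_le abs_of_pos abs_mult intro!: mult_le_one\<close>)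
  have EX: "(\<integral>\<omega>. X j \<omega> \<partial>Q) = q" for j
    using integral_inverse_Zm[of "a j" "a j + k" h] k unfolding X_def q_def by (simp add: divide_inverse)
  have q: "0 < q" "q \<le> 1"
  proof -
    show "0 < q" unfolding q_def using pk moment_pos[OF k, of 1 h] by simp
    have "(\<integral>\<omega>. X 0 \<omega> \<partial>Q) \<le> (\<integral>\<omega>. 1 \<partial>Q)" using X01 by (intro integral_mono iX) auto
    then show "q \<le> 1" unfolding EX by simp
  qed
  have EXX1: "(\<integral>\<omega>. X i \<omega> * X j \<omega> \<partial>Q) \<le> q" for i j
  proof -
    have "(\<integral>\<omega>. X i \<omega> * X j \<omega> \<partial>Q) \<le> (\<integral>\<omega>. X i \<omega> \<partial>Q)"
    proof (rule integral_mono[OF iXX iX])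
      show "X i \<omega> * X j \<omega> \<le> X i \<omega>" for \<omega> using X01[of i \<omega>] X01[of j \<omega>] mult_left_mono[of "X j \<omega>" 1 "X i \<omega>"] by simp
    qed
    then show ?thesis by (simp add: EX)
  qed
  have sep: "a i + k \<le> a j" if "i < j" for i j
  proof -
    have "Suc i * L \<le> j * L" using that by (intro mult_right_mono) auto
    then show ?thesis by (simp add: a_def L_def)
  qed
  have disj: "W i \<inter> W j = {}" if "i \<noteq> j" for i j
    using that sep[of i j] sep[of j i] unfolding W_def by (cases i j rule: linorder_cases) auto
  have cov: "(\<integral>\<omega>. X i \<omega> * X j \<omega> \<partial>Q) - q\<^sup>2 \<le> 6 * coupling (W i) (W j) * q" if ij: "i \<noteq> j" for i j
  proof -
    define d where "d = coupling (W i) (W j)"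
    have d0: "d \<ge> 0" unfolding d_def coupling_def by (intro sum_nonneg) auto
    show ?thesis
    \<comment> \<open>Decoupling yields the factor \<open>exp (3 * d)\<close>, which is at most
      \<open>1 + 6 * d\<close> when \<open>3 * d \<le> 1\<close>. Otherwise \<open>6 * d\<close>
      exceeds 1 and the trivial bound \<open>q\<close> suffices.\<close>
    proof (cases "3 * d \<le> 1")
      case True
      have sub: "S - {a j, a j + k} \<subseteq> W j" if "S \<in> traj (a j) (a j + k)" for S j
        using that by (auto simp: traj_def W_def le_less)
      have F: "Zm h \<omega> (a j) (a j + k) powr - 1 = expsum (traj (a j) (a j + k))
          (\<lambda>S. unitw S * exp (real (card (S - {a j, a j + k})) * h)) (\<lambda>S. S - {a j, a j + k}) \<omega> powr - 1" for \<omega> j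
        using k by (subst Zm_expsum) auto
      have iF: "integrable Q (\<lambda>\<omega>. Zm h \<omega> (a j) (a j + k) powr - 1)" for j
        by (rule Zm_powr_integrable) (use k in auto)
      have fW: "finite (W j)" for j by (simp add: W_def)
      have dec: "(\<integral>\<omega>. Zm h \<omega> (a i) (a i + k) powr - 1 * Zm h \<omega> (a j) (a j + k) powr - 1 \<partial>Q)
          \<le> exp (3 * 1 * coupling (W i) (W j)) * (\<integral>\<omega>. Zm h \<omega> (a i) (a i + k) powr - 1 \<partial>Q) * (\<integral>\<omega>. Zm h \<omega> (a j) (a j + k) powr - 1 \<partial>Q)"
        by (rule decoupling_integrable(2)[OF fW fW disj[OF ij] finite_traj traj_interval[OF le_add1] coefficient_pos sub
            finite_traj traj_interval[OF le_add1] coefficient_pos sub zero_less_one order_refl F F iF iF])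
      have Xp: "X j \<omega> = p k * Zm h \<omega> (a j) (a j + k) powr - 1" for j \<omega>
        unfolding X_def using inverse_Zm[of "a j" "a j + k" h \<omega>] k by (simp add: divide_inverse)
      have "(\<integral>\<omega>. X i \<omega> * X j \<omega> \<partial>Q) = p k * p k * (\<integral>\<omega>. Zm h \<omega> (a i) (a i + k) powr - 1 * Zm h \<omega> (a j) (a j + k) powr - 1 \<partial>Q)"
        unfolding Xp by (simp add: mult_ac flip: integral_mult_right_zero)
      also have "\<dots> \<le> p k * p k * (exp (3 * d) * (\<integral>\<omega>. Zm h \<omega> (a i) (a i + k) powr - 1 \<partial>Q) * (\<integral>\<omega>. Zm h \<omega> (a j) (a j + k) powr - 1 \<partial>Q))"
        using dec pk by (intro mult_left_mono) (auto simp: d_def)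
      also have "\<dots> = exp (3 * d) * (\<integral>\<omega>. X i \<omega> \<partial>Q) * (\<integral>\<omega>. X j \<omega> \<partial>Q)"
        unfolding Xp by (simp only: integral_mult_right_zero mult_ac)
      also have "\<dots> = exp (3 * d) * q\<^sup>2" unfolding EX by (simp add: power2_eq_square)
      also have "\<dots> \<le> (1 + 6 * d) * q\<^sup>2"
      proof (rule mult_right_mono)
        have "exp (3 * d) \<le> 1 + 3 * d + (3 * d)\<^sup>2" by (rule exp_bound) (use d0 True in auto)
        moreover have "(3 * d)\<^sup>2 \<le> 3 * d * 1" unfolding power2_eq_square using True d0 by (intro mult_left_mono) auto
        ultimately show "exp (3 * d) \<le> 1 + 6 * d" by simp
      qed simp
      finally have "(\<integral>\<omega>. X i \<omega> * X j \<omega> \<partial>Q) - q\<^sup>2 \<le> 6 * d * q\<^sup>2" by (simp add: distrib_right)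
      also have "\<dots> \<le> 6 * d * q" using q d0 by (intro mult_left_mono) (auto simp: power2_eq_square)
      finally show ?thesis by (simp add: d_def)
    next
      case False
      have "(\<integral>\<omega>. X i \<omega> * X j \<omega> \<partial>Q) - q\<^sup>2 \<le> q" using EXX1[of i j] zero_le_power2[of q] by linarith
      also have "\<dots> \<le> 6 * d * q" using False q by (simp add: mult_le_cancel_right1)
      finally show ?thesis by (simp add: d_def)
    qed
  qed
  have gs: "gap_sum h k R J \<omega> = (\<Sum>j<J. X j \<omega>)" for \<omega> unfolding gap_sum_def X_def a_def L_def ..
  have sq: "(gap_sum h k R J \<omega> - real J * q)\<^sup>2 = (\<Sum>i<J. \<Sum>j<J. X i \<omega> * X j \<omega> - q * X i \<omega> - q * X j \<omega> + q\<^sup>2)" for \<omega>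
  proof -
    have "gap_sum h k R J \<omega> - real J * q = (\<Sum>j<J. X j \<omega> - q)" unfolding gs by (simp add: sum_subtractf)
    then have "(gap_sum h k R J \<omega> - real J * q)\<^sup>2 = (\<Sum>i<J. \<Sum>j<J. (X i \<omega> - q) * (X j \<omega> - q))"
      by (simp add: power2_eq_square sum_product)
    then show ?thesis by (simp add: algebra_simps power2_eq_square)
  qed
  have iterm: "integrable Q (\<lambda>\<omega>. X i \<omega> * X j \<omega> - q * X i \<omega> - q * X j \<omega> + q\<^sup>2)" for i j
    by (intro Bochner_Integration.integrable_add Bochner_Integration.integrable_diff iXX integrable_mult_right iX integrable_const)
  show "integrable Q (\<lambda>\<omega>. (gap_sum h k R J \<omega> - real J * q)\<^sup>2)"
    unfolding sq by (intro Bochner_Integration.integrable_sum iterm)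
  have eterm: "(\<integral>\<omega>. X i \<omega> * X j \<omega> - q * X i \<omega> - q * X j \<omega> + q\<^sup>2 \<partial>Q) = (\<integral>\<omega>. X i \<omega> * X j \<omega> \<partial>Q) - q\<^sup>2" for i j
    using iXX[of i j] iX[of i] iX[of j] by (simp add: EX power2_eq_square)
  have "(\<integral>\<omega>. (gap_sum h k R J \<omega> - real J * q)\<^sup>2 \<partial>Q) = (\<Sum>i<J. \<Sum>j<J. (\<integral>\<omega>. X i \<omega> * X j \<omega> \<partial>Q) - q\<^sup>2)"
    unfolding sq eterm[symmetric]
    by (subst Bochner_Integration.integral_sum, intro Bochner_Integration.integrable_sum iterm,
        intro sum.cong refl Bochner_Integration.integral_sum iterm)
  also have "\<dots> \<le> (\<Sum>i<J. q * (1 + 12 * cov_sum * real k))"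
  proof (rule sum_mono)
    fix i assume i: "i \<in> {..<J}"
    have "(\<Sum>j<J. (\<integral>\<omega>. X i \<omega> * X j \<omega> \<partial>Q) - q\<^sup>2)
        = ((\<integral>\<omega>. X i \<omega> * X i \<omega> \<partial>Q) - q\<^sup>2) + (\<Sum>j\<in>{..<J} - {i}. (\<integral>\<omega>. X i \<omega> * X j \<omega> \<partial>Q) - q\<^sup>2)"
      using i by (subst sum.remove[of _ i]) auto
    also have "\<dots> \<le> q + (\<Sum>j\<in>{..<J} - {i}. 6 * coupling (W i) (W j) * q)"
    proof (intro add_mono sum_mono)
      show "(\<integral>\<omega>. X i \<omega> * X i \<omega> \<partial>Q) - q\<^sup>2 \<le> q" using EXX1[of i i] zero_le_power2[of q] by linarith
    qed (use cov in auto)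
    also have "(\<Sum>j\<in>{..<J} - {i}. 6 * coupling (W i) (W j) * q) = 6 * q * (\<Sum>j\<in>{..<J} - {i}. coupling (W i) (W j))"
      by (simp add: sum_distrib_left mult_ac)
    also have "(\<Sum>j\<in>{..<J} - {i}. coupling (W i) (W j)) \<le> real k * (2 * cov_sum)"
    proof -
      \<comment> \<open>The windows are disjoint, so for a fixed site \<open>x\<close> the sum over
        all of them is a part of one row of the covariance matrix.\<close>
      have "(\<Sum>j\<in>{..<J} - {i}. coupling (W i) (W j)) = (\<Sum>x\<in>W i. \<Sum>j\<in>{..<J} - {i}. \<Sum>y\<in>W j. \<bar>cv x y\<bar>)"
        unfolding coupling_def by (rule sum.swap)
      also have "\<dots> = (\<Sum>x\<in>W i. \<Sum>y\<in>(\<Union>j\<in>{..<J} - {i}. W j). \<bar>cv x y\<bar>)"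
        by (intro sum.cong refl sum.UNION_disjoint[symmetric]) (use disj in \<open>auto simp: W_def\<close>)
      also have "\<dots> \<le> (\<Sum>x\<in>W i. 2 * cov_sum)"
        by (intro sum_mono cv_sum_row) (auto simp: W_def)
      also have "\<dots> \<le> real k * (2 * cov_sum)"
        using cov_tail_nonneg[of 0] by (auto simp: W_def intro!: mult_right_mono)
      finally show ?thesis .
    qed
    then have "q + 6 * q * (\<Sum>j\<in>{..<J} - {i}. coupling (W i) (W j)) \<le> q + 6 * q * (real k * (2 * cov_sum))"
      using q by (intro add_left_mono mult_left_mono) auto
    also have "\<dots> = q * (1 + 12 * cov_sum * real k)" by (simp add: algebra_simps)
    finally show "(\<Sum>j<J. (\<integral>\<omega>. X i \<omega> * X j \<omega> \<partial>Q) - q\<^sup>2) \<le> q * (1 + 12 * cov_sum * real k)" .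
  qed
  also have "\<dots> = real J * q * (1 + 12 * cov_sum * real k)" by simp
  finally show "(\<integral>\<omega>. (gap_sum h k R J \<omega> - real J * q)\<^sup>2 \<partial>Q) \<le> real J * q * (1 + 12 * cov_sum * real k)" .
qed

lemma moment_lower_eventually:
  assumes "\<beta> > mu h"
  shows "eventually (\<lambda>k. moment 1 h k \<ge> exp (- \<beta> * real k)) sequentially"
proof -
  have "eventually (\<lambda>k. - ln (moment 1 h k) / real k < \<beta>) sequentially"
    using mu_tendsto assms by (rule order_tendstoD(2))
  then show ?thesis
    using eventually_ge_at_top[of 1]
  proof eventually_elim
    case (elim k)
    then have "- ln (moment 1 h k) < \<beta> * real k" by (subst (asm) pos_divide_less_eq) auto
    then have "exp (- \<beta> * real k) \<le> exp (ln (moment 1 h k))" by (subst exp_le_cancel_iff) linarith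
    then show ?case using moment_pos[of k 1 h] elim by simp
  qed
qed

text \<open>These three parameters are valid for all n with 2^(i+1) \<le> n < 2^(i+2). The gap is
  scaled with the upper end, so that it is at least c log n; the margin is scaled with the lower
  end, as in \<open>up_sum_AE\<close>; and the number of blocks is what fits into 2^(i+1)
  sites.\<close>

definition block_gap :: "real \<Rightarrow> nat \<Rightarrow> nat" where
  "block_gap c i = log_scale c (i + 2)"

definition block_margin :: "real \<Rightarrow> nat \<Rightarrow> nat" where
  "block_margin c' i = log_scale c' (i + 1)"

definition block_count :: "real \<Rightarrow> real \<Rightarrow> nat \<Rightarrow> nat" where
  "block_count c c' i = 2 ^ (i + 1) div (block_gap c i + 2 * block_margin c' i)"

lemma block_length_le:
  assumes "c > 0" "c' > 0"
  shows "real (block_gap c i + 2 * block_margin c' i) \<le> (2 * c + 2 * c' + 3) * (real i + 1)"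
proof -
  have l2: "ln 2 \<le> (1::real)" using ln_2_less_1 by simp
  have "real (block_gap c i) \<le> c * (real (i + 2) * ln 2) + 1"
    unfolding block_gap_def by (rule log_scale_le) (use assms in auto)
  also have "c * (real (i + 2) * ln 2) \<le> c * (real (i + 2) * 1)"
    using l2 assms by (intro mult_left_mono) auto
  also have "c * (real (i + 2) * 1) \<le> c * (2 * (real i + 1))"
    using assms by (intro mult_left_mono) auto
  finally have 1: "real (block_gap c i) \<le> 2 * c * (real i + 1) + 1" by (simp add: algebra_simps)
  have "real (block_margin c' i) \<le> c' * (real (i + 1) * ln 2) + 1"
    unfolding block_margin_def by (rule log_scale_le) (use assms in auto)
  also have "c' * (real (i + 1) * ln 2) \<le> c' * (real (i + 1) * 1)"
    using l2 assms by (intro mult_left_mono) auto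
  finally have 2: "real (block_margin c' i) \<le> c' * (real i + 1) + 1" by (simp add: algebra_simps)
  have "real (block_gap c i + 2 * block_margin c' i) \<le> 2 * c * (real i + 1) + 2 * (c' * (real i + 1)) + 3"
    using 1 2 by simp
  also have "\<dots> \<le> 2 * c * (real i + 1) + 2 * (c' * (real i + 1)) + 3 * (real i + 1)" by simp
  finally show ?thesis by (simp add: algebra_simps)
qed

text \<open>There are of order 2^i / i blocks, each of mean at least of order 2^(-\<nu> c i) with
  \<nu> c < 1, so the mean of the block sum grows exponentially in \<open>i\<close>. The relative
  variance is at most \<open>V i / N i\<close>, which decays exponentially, and this gives almost
  sure concentration.\<close>

lemma gap_sum_AE:
  assumes mu: "mu h > 0" and c: "c > 0" "c' > 0" and cmu: "c * mu h < 1"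
  shows "\<exists>\<rho>>0. AE \<omega> in Q. eventually (\<lambda>i. gap_sum h (block_gap c i) (block_margin c' i) (block_count c c' i) \<omega> \<ge> exp (\<rho> * real i)) sequentially"
proof -
  \<comment> \<open>One \<open>\<delta>\<close> is lost when \<open>moment\<close> is replaced by
    its limiting rate and one when \<open>p\<close> is bounded below; \<open>\<nu>\<close>, the
    total rate, is then the midpoint of \<open>mu h\<close> and \<open>1 / c\<close>.\<close>
  define \<delta> where "\<delta> = (1 / c - mu h) / 4"
  have \<delta>: "\<delta> > 0" unfolding \<delta>_def using cmu c by (simp add: field_simps)
  define \<nu> where "\<nu> = mu h + 2 * \<delta>"
  have \<nu>: "\<nu> > 0" "\<nu> * c < 1"
  proof -
    show "\<nu> > 0" using mu \<delta> by (simp add: \<nu>_def)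
    have "\<nu> < 1 / c" unfolding \<nu>_def \<delta>_def using cmu c by (simp add: field_simps)
    then show "\<nu> * c < 1" using c by (simp add: less_divide_eq)
  qed
  define K where "K = (1 - \<nu> * c) * ln 2"
  have K: "K > 0" using \<nu> by (simp add: K_def)
  obtain c0 where c0: "c0 > 0" "\<And>t. t \<ge> 1 \<Longrightarrow> p t \<ge> c0 * exp (- \<delta> * real t)"
    using p_subexponential[OF \<delta>] by auto
  define k where "k i = block_gap c i" for i
  define J where "J i = block_count c c' i" for i
  define q where "q i = p (k i) * moment 1 h (k i)" for i
  define S where "S i = gap_sum h (k i) (block_margin c' i) (J i)" for i
  have k1: "k i \<ge> 1" for i unfolding k_def block_gap_def using c by (intro log_scale_pos) auto
  have q0: "q i > 0" for i unfolding q_def using p_pos[OF k1] moment_pos[OF k1, of 1 h] by simp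
  have kup: "real (k i) \<le> c * (real (i + 2) * ln 2) + 1" for i
    unfolding k_def block_gap_def by (rule log_scale_le) (use c in auto)
  define A where "A = 2 * c + 2 * c' + 3"
  have A: "A > 0" using c by (simp add: A_def)
  \<comment> \<open>\<open>exp (- \<nu>)\<close> accounts for the rounding up in
    \<open>log_scale\<close>, and the last factor for the shift from \<open>i\<close> to
    \<open>i + 2\<close> in \<open>block_gap\<close>.\<close>
  define D where "D = c0 * exp (- \<nu>) * exp (- 2 * (\<nu> * c * ln 2))"
  have D: "D > 0" using c0 by (simp add: D_def)
  have klim: "filterlim k at_top sequentially"
    unfolding k_def[abs_def] block_gap_def
    by (rule filterlim_compose[OF log_scale_at_top[OF c(1)]]) (rule filterlim_add_const_nat_at_top)
  have qlow: "eventually (\<lambda>i. q i \<ge> D * exp (- (\<nu> * c * ln 2) * real i)) sequentially"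
  proof -
    have "eventually (\<lambda>k. moment 1 h k \<ge> exp (- (mu h + \<delta>) * real k)) sequentially"
      by (rule moment_lower_eventually) (use \<delta> in auto)
    then have "eventually (\<lambda>i. moment 1 h (k i) \<ge> exp (- (mu h + \<delta>) * real (k i))) sequentially"
      by (rule eventually_compose_filterlim[OF _ klim])
    then show ?thesis
    proof eventually_elim
      case (elim i)
      have "D * exp (- (\<nu> * c * ln 2) * real i) = c0 * exp (- \<nu> * (c * (real (i + 2) * ln 2) + 1))"
      proof -
        have "D * exp (- (\<nu> * c * ln 2) * real i) = c0 * exp (- \<nu> + (- 2 * (\<nu> * c * ln 2)) + (- (\<nu> * c * ln 2) * real i))"
          unfolding D_def by (simp only: exp_add mult.assoc)
        also have "- \<nu> + (- 2 * (\<nu> * c * ln 2)) + (- (\<nu> * c * ln 2) * real i) = - \<nu> * (c * (real (i + 2) * ln 2) + 1)"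
          by (simp add: algebra_simps)
        finally show ?thesis .
      qed
      also have "\<dots> \<le> c0 * exp (- \<nu> * real (k i))"
        using mult_left_mono[OF kup[of i], of \<nu>] \<nu> c0 by (intro mult_left_mono) auto
      also have "\<dots> = (c0 * exp (- \<delta> * real (k i))) * exp (- (mu h + \<delta>) * real (k i))"
      proof -
        have "- \<nu> * real (k i) = - \<delta> * real (k i) + - (mu h + \<delta>) * real (k i)" unfolding \<nu>_def by (simp add: algebra_simps)
        then show ?thesis by (simp only: exp_add mult.assoc)
      qed
      also have "\<dots> \<le> q i" unfolding q_def
        using c0 elim k1[of i] p_pos[OF k1[of i]] by (intro mult_mono) auto
      finally show ?case .
    qed
  qed
  have Jlow: "real (J i) \<ge> exp (ln 2 * real i) / (A * (real i + 1)) - 1" for i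
  proof -
    define L where "L = block_gap c i + 2 * block_margin c' i"
    have L: "real L \<le> A * (real i + 1)" "L \<ge> 1"
      using block_length_le[OF c, of i] k1[of i] by (auto simp: L_def A_def k_def)
    have "exp (ln 2 * real i) = (2::real) ^ i" by (simp add: exp_of_nat2_mult)
    also have "\<dots> \<le> 2 ^ (i + 1)" by simp
    finally have "exp (ln 2 * real i) / (A * (real i + 1)) \<le> 2 ^ (i + 1) / real L"
      using L A by (intro frac_le) auto
    also have "\<dots> \<le> real (2 ^ (i + 1) div L) + 1"
    proof -
      have "2 ^ (i + 1) = (2 ^ (i + 1) div L) * L + 2 ^ (i + 1) mod L" by simp
      also have "\<dots> \<le> (2 ^ (i + 1) div L) * L + L" using L by (intro add_left_mono less_imp_le mod_less_divisor) auto
      finally have "real (2 ^ (i + 1)) \<le> real ((2 ^ (i + 1) div L) * L + L)" by (rule of_nat_mono)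
      then show ?thesis using L by (simp add: divide_le_eq distrib_right)
    qed
    finally show ?thesis unfolding J_def block_count_def L_def by simp
  qed
  \<comment> \<open>The mean grows at rate \<open>K\<close> up to polynomial factors. Half of the
    rate absorbs these and the factor \<open>V i\<close>; half of what is left absorbs the constant
    lost to concentration.\<close>
  define \<rho> where "\<rho> = K / 4"
  define V where "V i = 1 + 12 * cov_sum * real (k i)" for i
  have V1: "V i \<ge> 1" for i unfolding V_def using cov_tail_nonneg[of 0] by simp
  define B0 where "B0 = 1 + 12 * cov_sum * (2 * c * ln 2 + 1)"
  define B1 where "B1 = 12 * cov_sum * c * ln 2"
  have Vup: "V i \<le> B0 + B1 * real i" for i
    using mult_left_mono[OF kup[of i], of "12 * cov_sum"] cov_tail_nonneg[of 0]
    by (simp add: V_def B0_def B1_def algebra_simps)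
  have Nlow: "eventually (\<lambda>i. real (J i) * q i \<ge> V i * exp (2 * \<rho> * real i)) sequentially"
  proof -
    have "eventually (\<lambda>i::nat. (B0 + B1 * real i) * exp (K / 2 * real i) \<le> D * (exp (K * real i) / (A * (real i + 1)) - 1)) sequentially"
      using K A D by real_asymp
    moreover have "eventually (\<lambda>i::nat. exp (ln 2 * real i) / (A * (real i + 1)) - 1 \<ge> 0) sequentially"
      using A by real_asymp
    ultimately show ?thesis
      using qlow
    proof eventually_elim
      case (elim i)
      have "V i * exp (2 * \<rho> * real i) \<le> (B0 + B1 * real i) * exp (K / 2 * real i)"
        unfolding \<rho>_def using Vup[of i] by (simp add: mult_right_mono)
      also have "\<dots> \<le> D * (exp (K * real i) / (A * (real i + 1)) - 1)" by (rule elim(1))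
      also have "\<dots> \<le> D * ((exp (ln 2 * real i) / (A * (real i + 1)) - 1) * exp (- (\<nu> * c * ln 2) * real i))"
      proof (rule mult_left_mono)
        have "exp (K * real i) = exp (ln 2 * real i) * exp (- (\<nu> * c * ln 2) * real i)"
        proof -
          have "K * real i = ln 2 * real i + - (\<nu> * c * ln 2) * real i" unfolding K_def by (simp add: algebra_simps)
          then show ?thesis by (simp only: exp_add)
        qed
        moreover have "exp (- (\<nu> * c * ln 2) * real i) \<le> 1" using \<nu> c by (simp add: mult_nonneg_nonneg)
        ultimately show "exp (K * real i) / (A * (real i + 1)) - 1
            \<le> (exp (ln 2 * real i) / (A * (real i + 1)) - 1) * exp (- (\<nu> * c * ln 2) * real i)"
          by (simp only: left_diff_distrib times_divide_eq_left mult_1_left diff_left_mono)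
      qed (use D in simp)
      also have "\<dots> = (exp (ln 2 * real i) / (A * (real i + 1)) - 1) * (D * exp (- (\<nu> * c * ln 2) * real i))"
        by (simp only: mult_ac)
      also have "\<dots> \<le> real (J i) * q i"
        using Jlow[of i] elim D by (intro mult_mono) auto
      finally show ?case .
    qed
  qed
  define N where "N i = real (J i) * q i" for i
  \<comment> \<open>The relative squared deviation: as soon as it is below 1/4, the block sum is at
    least half its mean.\<close>
  define f where "f i \<omega> = (S i \<omega> - N i)\<^sup>2 / (N i)\<^sup>2" for i \<omega>
  have fi: "integrable Q (f i)" for i
    unfolding f_def[abs_def] S_def N_def q_def by (intro integrable_divide gap_sum_variance(1)[OF k1])
  have fle: "(\<integral>\<omega>. f i \<omega> \<partial>Q) \<le> V i / N i" for i
  proof -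
    have "(\<integral>\<omega>. f i \<omega> \<partial>Q) = (\<integral>\<omega>. (S i \<omega> - N i)\<^sup>2 \<partial>Q) / (N i)\<^sup>2" unfolding f_def by simp
    also have "\<dots> \<le> N i * V i / (N i)\<^sup>2"
      unfolding S_def N_def q_def V_def by (intro divide_right_mono gap_sum_variance(2)[OF k1] zero_le_power2)
    also have "\<dots> = V i / N i" by (simp add: power2_eq_square)
    finally show ?thesis .
  qed
  have "AE \<omega> in Q. (\<lambda>i. f i \<omega>) \<longlonglongrightarrow> 0"
  proof (rule AE_tendsto_zero_of_summable_integrals[OF fi])
    show "summable (\<lambda>i. \<integral>\<omega>. f i \<omega> \<partial>Q)"
    proof (rule summable_comparison_test_ev)
      show "summable (\<lambda>i. exp (- 2 * \<rho>) ^ i)" using K by (intro summable_geometric) (simp add: \<rho>_def)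
      show "eventually (\<lambda>i. norm (\<integral>\<omega>. f i \<omega> \<partial>Q) \<le> exp (- 2 * \<rho>) ^ i) sequentially"
        using Nlow
      proof eventually_elim
        case (elim i)
        have Npos: "N i > 0"
        proof -
          have "0 < V i * exp (2 * \<rho> * real i)" using V1[of i] by (intro mult_pos_pos) auto
          then show ?thesis using elim unfolding N_def by linarith
        qed
        have "norm (\<integral>\<omega>. f i \<omega> \<partial>Q) = (\<integral>\<omega>. f i \<omega> \<partial>Q)"
          by (simp add: f_def)
        also have "\<dots> \<le> V i / N i" by (rule fle)
        also have "\<dots> \<le> V i / (V i * exp (2 * \<rho> * real i))"
        proof (rule divide_left_mono)
          show "V i * exp (2 * \<rho> * real i) \<le> N i" using elim unfolding N_def .
          show "0 \<le> V i" using V1[of i] by linarith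
          have "V i > 0" using V1[of i] by linarith
          then show "0 < N i * (V i * exp (2 * \<rho> * real i))" using Npos by (intro mult_pos_pos exp_gt_zero)
        qed
        also have "\<dots> = exp (- (2 * \<rho> * real i))"
        proof -
          have "V i \<noteq> 0" using V1[of i] by linarith
          then show ?thesis by (simp add: exp_minus divide_inverse)
        qed
        also have "\<dots> = exp (- 2 * \<rho>) ^ i" by (simp add: mult_ac flip: exp_of_nat_mult)
        finally show ?case .
      qed
    qed
  qed (simp add: f_def)
  then have "AE \<omega> in Q. eventually (\<lambda>i. S i \<omega> \<ge> exp (\<rho> * real i)) sequentially"
  proof (rule AE_mp, intro AE_I2 impI)
    fix \<omega> assume "(\<lambda>i. f i \<omega>) \<longlonglongrightarrow> 0"
    then have e1: "eventually (\<lambda>i. f i \<omega> < 1 / 4) sequentially" by (rule order_tendstoD(2)) simp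
    have e2: "eventually (\<lambda>i::nat. exp (\<rho> * real i) \<le> exp (2 * \<rho> * real i) / 2) sequentially"
      using K unfolding \<rho>_def by real_asymp
    show "eventually (\<lambda>i. S i \<omega> \<ge> exp (\<rho> * real i)) sequentially"
      using e1 e2 Nlow
    proof eventually_elim
      case (elim i)
      have Nge: "N i \<ge> exp (2 * \<rho> * real i)"
      proof -
        have "1 * exp (2 * \<rho> * real i) \<le> V i * exp (2 * \<rho> * real i)" using V1[of i] by (intro mult_right_mono) auto
        then show ?thesis using elim(3) unfolding N_def by linarith
      qed
      then have Npos: "N i > 0" using exp_gt_zero[of "2 * \<rho> * real i"] by linarith
      have "(S i \<omega> - N i)\<^sup>2 < (N i / 2)\<^sup>2"
        using elim(1) Npos by (simp add: f_def divide_less_eq power_divide)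
      then have "\<bar>S i \<omega> - N i\<bar>\<^sup>2 < (N i / 2)\<^sup>2" by (simp only: power2_abs)
      then have "\<bar>S i \<omega> - N i\<bar> < N i / 2" by (rule power2_less_imp_less) (use Npos in linarith)
      then have "S i \<omega> \<ge> N i / 2" by linarith
      then show ?case using elim(2) Nge by linarith
    qed
  qed
  then show ?thesis unfolding S_def k_def J_def using K by (intro exI[of _ \<rho>]) (simp add: \<rho>_def)
qed

end

subsection \<open>The largest gap\<close>

lemma dyadic_index:
  obtains idx :: "nat \<Rightarrow> nat"
  where "\<And>n. n \<ge> 2 \<Longrightarrow> 2 ^ (idx n + 1) \<le> n" "\<And>n. n \<ge> 2 \<Longrightarrow> n < 2 ^ (idx n + 2)" "filterlim idx at_top sequentially"
proof -
  have "\<exists>i. 2 ^ (i + 1) \<le> n \<and> n < 2 ^ (i + 2)" if n: "n \<ge> 2" for n :: nat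
  proof -
    obtain j where j: "2 ^ j \<le> n" "n < 2 ^ (j + 1)" using ex_power_ivl1[of 2 n] n by auto
    then have "j \<noteq> 0" using n by (cases j) auto
    then obtain i where "j = i + 1" by (cases j) auto
    then show ?thesis using j by auto
  qed
  then obtain idx :: "nat \<Rightarrow> nat" where idx: "\<And>n. n \<ge> 2 \<Longrightarrow> 2 ^ (idx n + 1) \<le> n \<and> n < 2 ^ (idx n + 2)" by metis
  have "filterlim idx at_top sequentially"
    unfolding filterlim_at_top eventually_sequentially
  proof (intro allI exI impI)
    fix Z n :: nat assume n: "n \<ge> max 2 (2 ^ (Z + 2))"
    show "Z \<le> idx n"
    proof (rule ccontr)
      assume "\<not> Z \<le> idx n"
      then have "(2::nat) ^ (idx n + 2) \<le> 2 ^ (Z + 2)" by (intro power_increasing) auto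
      moreover have "2 \<le> n" "2 ^ (Z + 2) \<le> n"
        by (rule order_trans[OF max.cobounded1 n], rule order_trans[OF max.cobounded2 n])
      ultimately show False using idx[of n] by linarith
    qed
  qed
  then show ?thesis using idx that by blast
qed

context disordered_renewal
begin

text \<open>The Gibbs probability of a gap of length at least \<open>m\<close>, computed on
  trajectories. In this form it is a function of the disorder alone, detached from the space
  carrying the renewal process.\<close>

definition gap_ratio :: "real \<Rightarrow> (nat \<Rightarrow> real) \<Rightarrow> nat \<Rightarrow> nat \<Rightarrow> real" where
  "gap_ratio h \<omega> n m = (\<Sum>S | S \<in> traj 0 n \<and> gap_ge m S. weight p (boltzmann h \<omega>) S) / Zw h \<omega> 0 n"

definition no_gap_ratio :: "real \<Rightarrow> (nat \<Rightarrow> real) \<Rightarrow> nat \<Rightarrow> nat \<Rightarrow> real" where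
  "no_gap_ratio h \<omega> n m = (\<Sum>S | S \<in> traj 0 n \<and> \<not> gap_ge m S. weight p (boltzmann h \<omega>) S) / Zw h \<omega> 0 n"

lemma gap_ratio_nonneg: "gap_ratio h \<omega> n m \<ge> 0" "no_gap_ratio h \<omega> n m \<ge> 0"
  unfolding gap_ratio_def no_gap_ratio_def
  by (intro divide_nonneg_pos sum_nonneg Zw_pos; auto intro: B.weight_nonneg)+

lemma gap_ratio_le_up_sum: "m \<ge> 1 \<Longrightarrow> gap_ratio h \<omega> n m \<le> up_sum h m n \<omega>"
  unfolding gap_ratio_def up_sum_def
  using B.sum_gap_ge_upper[where m = m and n = n and h = h and \<omega> = \<omega>] Zw_pos[of 0 n h \<omega>] by (simp add: pos_divide_le_eq mult.commute)

text \<open>All that is asked of the disorder; what follows is deterministic for a typical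
  \<open>\<omega>\<close>. Restricting \<open>c\<close>, \<open>c'\<close> and \<open>h\<close> to
  rationals makes the first and last clauses countable intersections of almost sure events.\<close>

definition typical :: "(nat \<Rightarrow> real) \<Rightarrow> bool" where
  "typical \<omega> \<longleftrightarrow>
    (\<forall>c\<in>\<rat>. \<forall>h\<in>\<rat>. mu h > 0 \<longrightarrow> c * mu h > 1 \<longrightarrow> (\<lambda>i. up_sum h (log_scale c (i + 1)) (2 ^ (i + 2)) \<omega>) \<longlonglongrightarrow> 0) \<and>
    (\<forall>\<eta>>0. \<exists>C. \<forall>a. \<bar>\<omega> a\<bar> \<le> C + \<eta> * ln (real a + 1)) \<and>
    (\<forall>c\<in>\<rat>. \<forall>c'\<in>\<rat>. \<forall>h\<in>\<rat>. mu h > 0 \<longrightarrow> c > 0 \<longrightarrow> c' > 0 \<longrightarrow> c * mu h < 1 \<longrightarrow>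
      (\<exists>\<rho>>0. eventually (\<lambda>i. gap_sum h (block_gap c i) (block_margin c' i) (block_count c c' i) \<omega> \<ge> exp (\<rho> * real i)) sequentially))"

lemma typical_AE: "AE \<omega> in Q. typical \<omega>"
proof -
  have 1: "AE \<omega> in Q. \<forall>c\<in>\<rat>. \<forall>h\<in>\<rat>. mu h > 0 \<longrightarrow> c * mu h > 1 \<longrightarrow> (\<lambda>i. up_sum h (log_scale c (i + 1)) (2 ^ (i + 2)) \<omega>) \<longlonglongrightarrow> 0"
    by (intro AE_ball_countable' countable_rat AE_impI up_sum_AE)
  have 3: "AE \<omega> in Q. \<forall>c\<in>\<rat>. \<forall>c'\<in>\<rat>. \<forall>h\<in>\<rat>. mu h > 0 \<longrightarrow> c > 0 \<longrightarrow> c' > 0 \<longrightarrow> c * mu h < 1 \<longrightarrow>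
      (\<exists>\<rho>>0. eventually (\<lambda>i. gap_sum h (block_gap c i) (block_margin c' i) (block_count c c' i) \<omega> \<ge> exp (\<rho> * real i)) sequentially)"
  proof (intro AE_ball_countable' countable_rat AE_impI)
    fix c c' h :: real assume "mu h > 0" "c > 0" "c' > 0" "c * mu h < 1"
    from gap_sum_AE[OF this] obtain \<rho> where "\<rho> > 0"
      "AE \<omega> in Q. eventually (\<lambda>i. gap_sum h (block_gap c i) (block_margin c' i) (block_count c c' i) \<omega> \<ge> exp (\<rho> * real i)) sequentially"
      by blast
    then show "AE \<omega> in Q. \<exists>\<rho>>0. eventually (\<lambda>i. gap_sum h (block_gap c i) (block_margin c' i) (block_count c c' i) \<omega> \<ge> exp (\<rho> * real i)) sequentially"
      by (auto elim!: eventually_mono)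
  qed
  show ?thesis using 1 disorder_growth_AE 3 unfolding typical_def by eventually_elim blast
qed

text \<open>A rational \<open>h0\<close> slightly below \<open>h\<close> is used: the sums over gaps
  decrease in \<open>h\<close>, and by Lipschitz continuity \<open>mu h0\<close> is close enough to
  \<open>mu h\<close> to preserve \<open>c * mu h0 > 1\<close>.\<close>

lemma gap_ratio_tendsto:
  assumes gen: "typical \<omega>" and mu: "mu h > 0" and c: "c \<in> \<rat>" "c * mu h > 1"
    and idx: "\<And>n. n \<ge> 2 \<Longrightarrow> n < 2 ^ (idx n + 2)" "filterlim idx at_top sequentially"
  shows "(\<lambda>n. gap_ratio h \<omega> n (log_scale c (idx n + 1))) \<longlonglongrightarrow> 0"
proof -
  have c0: "c > 0" using c mu by (metis less_trans zero_less_one zero_less_mult_pos2)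
  have "1 / c < mu h" using c c0 by (simp add: pos_divide_less_eq mult.commute)
  \<comment> \<open>The first bound on \<open>h0\<close> guarantees \<open>mu h0 > 0\<close>, the
    second one \<open>mu h0 > 1 / c\<close>.\<close>
  then have "max (h - mu h) (h - (mu h - 1 / c)) < h" using mu by simp
  then obtain h0 where h0: "h0 \<in> \<rat>" "max (h - mu h) (h - (mu h - 1 / c)) < h0" "h0 < h"
    using Rats_dense_in_real by blast
  have "mu h \<le> mu h0 + (h - h0)" using mu_mono_lipschitz(2)[of h0 h] h0 by simp
  then have mu0: "mu h0 > 0" "mu h0 > 1 / c" using h0 by auto
  then have "c * mu h0 > 1" using c0 by (simp add: pos_divide_less_eq mult.commute)
  then have lim: "(\<lambda>i. up_sum h0 (log_scale c (i + 1)) (2 ^ (i + 2)) \<omega>) \<longlonglongrightarrow> 0"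
    using gen h0(1) c(1) mu0 unfolding typical_def by blast
  have "(\<lambda>n. up_sum h0 (log_scale c (idx n + 1)) (2 ^ (idx n + 2)) \<omega>) \<longlonglongrightarrow> 0"
    by (rule filterlim_compose[OF lim idx(2)])
  then show ?thesis
  proof (rule tendsto_sandwich[OF _ _ tendsto_const, rotated -1])
    show "eventually (\<lambda>n. 0 \<le> gap_ratio h \<omega> n (log_scale c (idx n + 1))) sequentially"
      by (intro always_eventually allI gap_ratio_nonneg)
    show "eventually (\<lambda>n. gap_ratio h \<omega> n (log_scale c (idx n + 1)) \<le> up_sum h0 (log_scale c (idx n + 1)) (2 ^ (idx n + 2)) \<omega>) sequentially"
      using eventually_ge_at_top[of 2]
    proof eventually_elim
      case (elim n)
      have m: "log_scale c (idx n + 1) \<ge> 1" using c0 by (intro log_scale_pos) auto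
      have "gap_ratio h \<omega> n (log_scale c (idx n + 1)) \<le> up_sum h (log_scale c (idx n + 1)) n \<omega>"
        by (rule gap_ratio_le_up_sum[OF m])
      also have "\<dots> \<le> up_sum h0 (log_scale c (idx n + 1)) (2 ^ (idx n + 2)) \<omega>"
        by (rule up_sum_mono) (use m idx(1)[OF elim] h0 in auto)
      finally show ?case .
    qed
  qed
qed

text \<open>The numerator \<open>p (l - i)\<close> is at most 1, the two shorter jumps together lose
  at most \<open>exp (\<delta> * L) / c0\<^sup>2\<close>, and the reward at \<open>c\<close> is
  bounded below by the growth bound on the disorder. For \<open>L\<close> of order log n, the price
  is a power of \<open>n\<close> whose exponent is small with \<open>\<delta>\<close> and
  \<open>\<eta>\<close>.\<close>

lemma forcing_cost:
  assumes c0: "c0 > 0" "\<And>t. t \<ge> 1 \<Longrightarrow> p t \<ge> c0 * exp (- \<delta> * real t)" and \<delta>: "\<delta> \<ge> 0"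
    and C: "\<And>a. \<bar>\<omega> a\<bar> \<le> C + \<eta> * ln (real a + 1)" and \<eta>: "\<eta> \<ge> 0"
    and "c \<le> n" "i < c" "c < l" "l - i \<le> L"
  shows "p (l - i) \<le> exp (\<delta> * real L + \<bar>h\<bar> + C + \<eta> * ln (real n + 1)) / c0\<^sup>2
      * (p (c - i) * exp (h + \<omega> c) * p (l - c))"
proof -
  have p1: "p (c - i) > 0" "p (l - c) > 0" using assms by (auto intro!: p_pos)
  have "- (\<bar>h\<bar> + (C + \<eta> * ln (real n + 1))) \<le> h + \<omega> c"
  proof -
    have "\<eta> * ln (real c + 1) \<le> \<eta> * ln (real n + 1)" using assms by (intro mult_left_mono) auto
    then show ?thesis using C[of c] by linarith
  qed
  then have v: "exp (- (\<bar>h\<bar> + (C + \<eta> * ln (real n + 1)))) \<le> exp (h + \<omega> c)" by simp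
  have "c0 * exp (- \<delta> * real (c - i)) * (c0 * exp (- \<delta> * real (l - c))) \<le> p (c - i) * p (l - c)"
    using c0 assms p1 by (intro mult_mono c0(2)) auto
  moreover have "c0\<^sup>2 * exp (- \<delta> * real L) \<le> c0 * exp (- \<delta> * real (c - i)) * (c0 * exp (- \<delta> * real (l - c)))"
  proof -
    have "real (c - i) + real (l - c) \<le> real L" using assms by simp
    then have "\<delta> * (real (c - i) + real (l - c)) \<le> \<delta> * real L" using \<delta> by (intro mult_left_mono) auto
    then have "exp (- \<delta> * real L) \<le> exp (- \<delta> * real (c - i) + - \<delta> * real (l - c))" by (simp add: distrib_left)
    then have "c0\<^sup>2 * exp (- \<delta> * real L) \<le> c0\<^sup>2 * exp (- \<delta> * real (c - i) + - \<delta> * real (l - c))"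
      by (intro mult_left_mono) auto
    then show ?thesis by (simp only: exp_add power2_eq_square mult_ac)
  qed
  ultimately have pp: "c0\<^sup>2 * exp (- \<delta> * real L) \<le> p (c - i) * p (l - c)" by linarith
  have "(c0\<^sup>2 * exp (- \<delta> * real L)) * exp (- (\<bar>h\<bar> + (C + \<eta> * ln (real n + 1)))) \<le> (p (c - i) * p (l - c)) * exp (h + \<omega> c)"
    by (rule mult_mono[OF pp v]) (use p1 in auto)
  then have "exp (\<delta> * real L + \<bar>h\<bar> + C + \<eta> * ln (real n + 1)) / c0\<^sup>2 * ((c0\<^sup>2 * exp (- \<delta> * real L)) * exp (- (\<bar>h\<bar> + (C + \<eta> * ln (real n + 1)))))
     \<le> exp (\<delta> * real L + \<bar>h\<bar> + C + \<eta> * ln (real n + 1)) / c0\<^sup>2 * ((p (c - i) * p (l - c)) * exp (h + \<omega> c))"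
    by (intro mult_left_mono) auto
  moreover have "exp (\<delta> * real L + \<bar>h\<bar> + C + \<eta> * ln (real n + 1)) / c0\<^sup>2 * ((c0\<^sup>2 * exp (- \<delta> * real L)) * exp (- (\<bar>h\<bar> + (C + \<eta> * ln (real n + 1))))) = 1"
  proof -
    define E where "E = \<bar>h\<bar> + C + \<eta> * ln (real n + 1)"
    have "exp (\<delta> * real L + \<bar>h\<bar> + C + \<eta> * ln (real n + 1)) * (exp (- \<delta> * real L) * exp (- (\<bar>h\<bar> + (C + \<eta> * ln (real n + 1))))) = 1"
      by (simp flip: exp_add)
    then show ?thesis using c0(1) by (simp add: mult_ac)
  qed
  moreover have "p (l - i) \<le> 1" using assms by (intro p_le_1) auto
  ultimately show ?thesis by (simp add: mult_ac)
qed

text \<open>\<open>sum_no_gap_upper\<close> leaves two terms: gaps as long as a margin, which are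
  improbable by the upper bound, and a quotient in which the exponentially large block sum must
  outweigh \<open>(1 + \<kappa>)\<^sup>2\<close>.\<close>

lemma no_gap_ratio_tendsto:
  assumes gen: "typical \<omega>" and mu: "mu h > 0" and c: "c \<in> \<rat>" "c > 0" "c * mu h < 1"
    and idx: "\<And>n. n \<ge> 2 \<Longrightarrow> 2 ^ (idx n + 1) \<le> n" "\<And>n. n \<ge> 2 \<Longrightarrow> n < 2 ^ (idx n + 2)" "filterlim idx at_top sequentially"
  shows "(\<lambda>n. no_gap_ratio h \<omega> n (block_gap c (idx n))) \<longlonglongrightarrow> 0"
proof -
  \<comment> \<open>The margin constant exceeds \<open>1 / mu h\<close>, so that
    \<open>gap_ratio_tendsto\<close> makes gaps as long as a margin negligible.\<close>
  obtain c' where c': "c' \<in> \<rat>" "1 / mu h < c'" using Rats_dense_in_real[of "1 / mu h" "1 / mu h + 1"] by auto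
  have c'0: "c' > 0" using c'(2) mu by (meson less_trans zero_less_divide_1_iff)
  have c'mu: "c' * mu h > 1" using c'(2) mu by (simp add: pos_divide_less_eq)
  have "mu h < 1 / c" using c by (simp add: pos_less_divide_eq mult.commute)
  \<comment> \<open>Here the rational approximation lies above \<open>h\<close>: block sums decrease
    in \<open>h\<close>, so a lower bound at \<open>h1\<close> is one at \<open>h\<close>, and
    closeness preserves \<open>c * mu h1 < 1\<close>.\<close>
  then obtain h1 where h1: "h1 \<in> \<rat>" "h < h1" "h1 < h + (1 / c - mu h)"
    using Rats_dense_in_real[of h "h + (1 / c - mu h)"] by auto
  have "mu h1 < 1 / c" "mu h1 > 0" using mu_mono_lipschitz[of h h1] h1 mu by auto
  then have "c * mu h1 < 1" "mu h1 > 0" using c by (auto simp: pos_less_divide_eq mult.commute)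
  then obtain \<rho> where \<rho>: "\<rho> > 0"
    and gs: "eventually (\<lambda>i. gap_sum h1 (block_gap c i) (block_margin c' i) (block_count c c' i) \<omega> \<ge> exp (\<rho> * real i)) sequentially"
    using gen h1(1) c(1,2) c'(1) c'0 unfolding typical_def by blast
  define A where "A = 2 * c + 2 * c' + 3"
  have A: "A > 0" using c c'0 by (simp add: A_def)
  \<comment> \<open>The jump part and the reward part of the forcing price each grow like
    \<open>exp (\<rho> / 16 * i)\<close>, up to constants. Thus \<open>\<kappa>\<close> grows like
    \<open>exp (\<rho> / 8 * i)\<close> and its square like \<open>exp (\<rho> / 4 * i)\<close>,
    well below the block sum \<open>exp (\<rho> * i)\<close>.\<close>
  define \<delta> where "\<delta> = \<rho> / (16 * A)"
  have \<delta>: "\<delta> > 0" "\<delta> * A = \<rho> / 16" using \<rho> A by (auto simp: \<delta>_def)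
  define \<eta> where "\<eta> = \<rho> / 16"
  have \<eta>: "\<eta> > 0" using \<rho> by (simp add: \<eta>_def)
  obtain c0 where c0: "c0 > 0" "\<And>t. t \<ge> 1 \<Longrightarrow> p t \<ge> c0 * exp (- \<delta> * real t)"
    using p_subexponential[OF \<delta>(1)] by auto
  obtain C where C: "\<And>a. \<bar>\<omega> a\<bar> \<le> C + \<eta> * ln (real a + 1)"
    using gen \<eta> unfolding typical_def by blast
  define k where "k i = block_gap c i" for i
  define R where "R i = block_margin c' i" for i
  define J where "J i = block_count c c' i" for i
  define K0 where "K0 = exp (\<rho> / 4 + \<bar>h\<bar> + C) / c0\<^sup>2"
  define \<kappa> where "\<kappa> i = K0 * exp (\<rho> / 8 * real i)" for i
  have K0: "K0 > 0" using c0(1) by (simp add: K0_def)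
  have kR: "k i \<ge> 1" "R i \<ge> 1" for i
    unfolding k_def R_def block_gap_def block_margin_def by (rule log_scale_pos; use c c'0 in simp)+
  have bound: "no_gap_ratio h \<omega> n (k (idx n)) \<le> gap_ratio h \<omega> n (R (idx n)) + (1 + K0)\<^sup>2 * exp (- (\<rho> / 2) * real (idx n))"
    if n: "n \<ge> 2" and big: "gap_sum h1 (k (idx n)) (R (idx n)) (J (idx n)) \<omega> \<ge> exp (\<rho> * real (idx n))" for n
  proof -
    define i where "i = idx n"
    define L where "L = k i + 2 * R i"
    have n2: "2 ^ (i + 1) \<le> n" "n < 2 ^ (i + 2)" using idx(1,2)[OF n] by (auto simp: i_def)
    have L: "real L \<le> A * (real i + 1)" unfolding L_def k_def R_def A_def by (rule block_length_le[OF c(2) c'0])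
    have JL: "J i * L \<le> n"
    proof -
      have "J i * L \<le> 2 ^ (i + 1)" unfolding J_def L_def k_def R_def block_count_def by simp
      then show ?thesis using n2 by simp
    qed
    have cost: "exp (\<delta> * real L + \<bar>h\<bar> + C + \<eta> * ln (real n + 1)) / c0\<^sup>2 \<le> \<kappa> i"
    proof -
      have "\<delta> * real L \<le> \<delta> * (A * (real i + 1))" using L \<delta> by (intro mult_left_mono) auto
      also have "\<dots> = \<rho> / 16 * (real i + 1)" using \<delta>(2) by (simp add: mult.assoc[symmetric])
      finally have 1: "\<delta> * real L \<le> \<rho> / 16 * (real i + 1)" .
      have "real n + 1 \<le> 2 ^ (i + 2)"
      proof -
        have "n + 1 \<le> 2 ^ (i + 2)" using n2 by simp
        then have "real (n + 1) \<le> real (2 ^ (i + 2))" by (rule of_nat_mono)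
        then show ?thesis by simp
      qed
      then have "ln (real n + 1) \<le> ln (2 ^ (i + 2))" by (subst ln_le_cancel_iff) auto
      also have "\<dots> = real (i + 2) * ln 2" by (simp add: ln_realpow del: power_Suc)
      also have "\<dots> \<le> real (i + 2) * 1" using ln_2_less_1 by (intro mult_left_mono) auto
      finally have 2: "\<eta> * ln (real n + 1) \<le> \<rho> / 16 * (real i + 2)"
        unfolding \<eta>_def using \<rho> by (intro mult_left_mono) auto
      have "\<delta> * real L + \<bar>h\<bar> + C + \<eta> * ln (real n + 1) \<le> (\<rho> / 4 + \<bar>h\<bar> + C) + \<rho> / 8 * real i"
        using 1 2 \<rho> by (simp add: algebra_simps)
      then have "exp (\<delta> * real L + \<bar>h\<bar> + C + \<eta> * ln (real n + 1)) \<le> exp (\<rho> / 4 + \<bar>h\<bar> + C) * exp (\<rho> / 8 * real i)"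
        by (simp only: exp_add[symmetric] exp_le_cancel_iff)
      then have "exp (\<delta> * real L + \<bar>h\<bar> + C + \<eta> * ln (real n + 1)) / c0\<^sup>2 \<le> exp (\<rho> / 4 + \<bar>h\<bar> + C) * exp (\<rho> / 8 * real i) / c0\<^sup>2"
        by (rule divide_right_mono) simp
      then show ?thesis by (simp add: \<kappa>_def K0_def)
    qed
    define G where "G = (\<Sum>j<J i. p (k i) / Zm h \<omega> (j * L + R i) (j * L + R i + k i))"
    have G: "G \<ge> exp (\<rho> * real i)"
    proof -
      have "gap_sum h1 (k i) (R i) (J i) \<omega> \<le> G"
        unfolding gap_sum_def G_def L_def
      proof (intro sum_mono divide_left_mono)
        fix j
        let ?a = "j * (k i + 2 * R i) + R i"
        have ab: "?a < ?a + k i" using kR(1)[of i] by simp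
        show "Zm h \<omega> ?a (?a + k i) \<le> Zm h1 \<omega> ?a (?a + k i)" using h1 by (intro window_minus_mono ab) auto
        show "0 < Zm h1 \<omega> ?a (?a + k i) * Zm h \<omega> ?a (?a + k i)" by (intro mult_pos_pos Zm_pos ab)
        show "0 \<le> p (k i)" using p_pos[OF kR(1)[of i]] by simp
      qed
      then show ?thesis using big by (simp add: i_def)
    qed
    have main: "(\<Sum>S | S \<in> traj 0 n \<and> \<not> gap_ge (k i) S. weight p (boltzmann h \<omega>) S)
       \<le> (\<Sum>S | S \<in> traj 0 n \<and> gap_ge (R i) S. weight p (boltzmann h \<omega>) S) + Zw h \<omega> 0 n / (1 + G / (1 + \<kappa> i)\<^sup>2)"
      unfolding G_def L_def
    proof (rule B.sum_no_gap_upper)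
      show "0 \<le> \<kappa> i" using K0 by (simp add: \<kappa>_def)
      fix x a b assume xab: "x \<le> n" "a < x" "x < b" "b - a \<le> k i + 2 * R i"
      have "p (b - a) \<le> exp (\<delta> * real L + \<bar>h\<bar> + C + \<eta> * ln (real n + 1)) / c0\<^sup>2 * (p (x - a) * exp (h + \<omega> x) * p (b - x))"
        by (rule forcing_cost[OF c0 _ C]) (use xab \<delta> \<eta> in \<open>auto simp: L_def\<close>)
      also have "\<dots> \<le> \<kappa> i * (p (x - a) * exp (h + \<omega> x) * p (b - x))"
      proof (rule mult_right_mono[OF cost])
        have "p (x - a) > 0" "p (b - x) > 0" using xab by (auto intro!: p_pos)
        then show "0 \<le> p (x - a) * exp (h + \<omega> x) * p (b - x)" by simp
      qed
      finally show "p (b - a) \<le> \<kappa> i * (p (x - a) * exp (h + \<omega> x) * p (b - x))" .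
    qed (use kR JL in \<open>auto simp: L_def\<close>)
    have Zp: "Zw h \<omega> 0 n > 0" by (rule Zw_pos) simp
    have "no_gap_ratio h \<omega> n (k i) \<le> ((\<Sum>S | S \<in> traj 0 n \<and> gap_ge (R i) S. weight p (boltzmann h \<omega>) S) + Zw h \<omega> 0 n / (1 + G / (1 + \<kappa> i)\<^sup>2)) / Zw h \<omega> 0 n"
      unfolding no_gap_ratio_def by (rule divide_right_mono[OF main]) (use Zp in simp)
    also have "\<dots> = gap_ratio h \<omega> n (R i) + 1 / (1 + G / (1 + \<kappa> i)\<^sup>2)"
      unfolding gap_ratio_def using Zp by (simp add: add_divide_distrib)
    also have "1 / (1 + G / (1 + \<kappa> i)\<^sup>2) \<le> (1 + K0)\<^sup>2 * exp (- (\<rho> / 2) * real i)"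
    proof -
      have \<kappa>1: "1 + \<kappa> i \<le> (1 + K0) * exp (\<rho> / 8 * real i)"
        using \<rho> by (simp add: \<kappa>_def distrib_right)
      have \<kappa>0: "1 + \<kappa> i > 0" using K0 by (simp add: \<kappa>_def add_pos_pos)
      have "(1 + \<kappa> i)\<^sup>2 \<le> ((1 + K0) * exp (\<rho> / 8 * real i))\<^sup>2"
        using \<kappa>1 \<kappa>0 by (intro power_mono) auto
      also have "\<dots> = (1 + K0)\<^sup>2 * exp (\<rho> / 4 * real i)"
        by (simp add: power_mult_distrib flip: exp_double)
      finally have sq: "(1 + \<kappa> i)\<^sup>2 \<le> (1 + K0)\<^sup>2 * exp (\<rho> / 4 * real i)" .
      have Gp: "G > 0" using G exp_gt_zero[of "\<rho> * real i"] by linarith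
      have "1 / (1 + G / (1 + \<kappa> i)\<^sup>2) \<le> 1 / (G / (1 + \<kappa> i)\<^sup>2)"
        using Gp \<kappa>0 by (intro divide_left_mono mult_pos_pos divide_pos_pos add_pos_pos) auto
      also have "\<dots> = (1 + \<kappa> i)\<^sup>2 / G" by simp
      also have "\<dots> \<le> ((1 + K0)\<^sup>2 * exp (\<rho> / 4 * real i)) / exp (\<rho> * real i)"
        using sq G Gp by (intro frac_le) auto
      also have "\<dots> = (1 + K0)\<^sup>2 * exp (\<rho> / 4 * real i - \<rho> * real i)" by (simp only: exp_diff times_divide_eq_right)
      also have "\<dots> \<le> (1 + K0)\<^sup>2 * exp (- (\<rho> / 2) * real i)"
      proof (rule mult_left_mono)
        have "0 \<le> \<rho> * real i" using \<rho> by simp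
        then show "exp (\<rho> / 4 * real i - \<rho> * real i) \<le> exp (- (\<rho> / 2) * real i)" by simp
      qed simp
      finally show ?thesis .
    qed
    finally show ?thesis by (simp add: i_def)
  qed
  have lim1: "(\<lambda>n. gap_ratio h \<omega> n (R (idx n))) \<longlonglongrightarrow> 0"
    unfolding R_def block_margin_def by (rule gap_ratio_tendsto[OF gen mu c'(1) c'mu idx(2,3)])
  have "(\<lambda>i::nat. (1 + K0)\<^sup>2 * exp (- (\<rho> / 2) * real i)) \<longlonglongrightarrow> 0" using \<rho> by real_asymp
  then have "(\<lambda>n. (1 + K0)\<^sup>2 * exp (- (\<rho> / 2) * real (idx n))) \<longlonglongrightarrow> 0"
    by (rule filterlim_compose[OF _ idx(3)])
  from tendsto_add[OF lim1 this]
  have lim: "(\<lambda>n. gap_ratio h \<omega> n (R (idx n)) + (1 + K0)\<^sup>2 * exp (- (\<rho> / 2) * real (idx n))) \<longlonglongrightarrow> 0" by simp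
  have gs': "eventually (\<lambda>n. gap_sum h1 (k (idx n)) (R (idx n)) (J (idx n)) \<omega> \<ge> exp (\<rho> * real (idx n))) sequentially"
    unfolding k_def R_def J_def by (rule eventually_compose_filterlim[OF gs idx(3)])
  show ?thesis
  proof (rule tendsto_sandwich[OF _ _ tendsto_const lim])
    show "eventually (\<lambda>n. 0 \<le> no_gap_ratio h \<omega> n (block_gap c (idx n))) sequentially"
      by (intro always_eventually allI gap_ratio_nonneg)
    show "eventually (\<lambda>n. no_gap_ratio h \<omega> n (block_gap c (idx n)) \<le> gap_ratio h \<omega> n (R (idx n)) + (1 + K0)\<^sup>2 * exp (- (\<rho> / 2) * real (idx n))) sequentially"
      using gs' eventually_ge_at_top[of 2] unfolding k_def[symmetric] by eventually_elim (rule bound)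
  qed
qed

end

theorem proposition1p7:
  fixes M :: "'a measure" and T :: "nat \<Rightarrow> 'a \<Rightarrow> nat"
    and alpha :: real and ell :: "real \<Rightarrow> real" and p :: "nat \<Rightarrow> real"
    and Q :: "(nat \<Rightarrow> real) measure"
  assumes "prob_space M"
    and "alpha \<ge> 0"
    and "\<And>x. x \<ge> 1 \<Longrightarrow> ell x \<ge> 0"
    and "slowly_varying ell"
    and "\<And>t. t \<ge> 1 \<Longrightarrow> p t = ell (real t) / real t powr (alpha + 1)"
    and "\<And>t. t \<ge> 1 \<Longrightarrow> p t > 0"
    and "iid_positive_times M T p"
    and "prob_space Q"
    and "sets Q = sets borel"
    and "centered_gaussian_sequence Q"
    and "stationary_sequence Q"
    and "summable (\<lambda>a. \<bar>covariance Q a\<bar>)"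
  shows "AE \<omega> in Q. \<forall>h > critical_point M T Q. \<forall>\<epsilon>>0.
    (\<lambda>n. measure (gibbs_measure M T n h \<omega>)
       {x \<in> space (gibbs_measure M T n h \<omega>).
          \<bar>real (max_gap T n x) / ln (real n) - 1 / alt_free_energy M T Q h\<bar> > \<epsilon>})
    \<longlonglongrightarrow> 0"
proof -
  interpret M: prob_space M by fact
  interpret R: renewal_process M T p
    by (unfold_locales) (use assms in auto)
  interpret Q: prob_space Q by fact
  interpret D: disordered_renewal Q p
  proof (unfold_locales)
    show "\<exists>c>0. \<forall>t\<ge>1. c * exp (- \<delta> * real t) \<le> p t" if "\<delta> > 0" for \<delta>
      by (rule renewal_law_subexponential[OF assms(4,3,5,6) that])
  qed (use assms R.law_le_1 in auto)
  have fe: "free_energy M T Q h = D.fe h" for h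
  proof -
    have "(\<lambda>n. \<integral>\<omega>. (1 / real n) * ln (partition_function M T n h \<omega>) \<partial>Q) \<longlonglongrightarrow> D.fe h"
    proof (rule Lim_transform_eventually[OF D.fe_tendsto])
      show "eventually (\<lambda>n. D.expected_log h n / real n = (\<integral>\<omega>. (1 / real n) * ln (partition_function M T n h \<omega>) \<partial>Q)) sequentially"
        using eventually_ge_at_top[of 1]
        by eventually_elim (simp add: R.partition_function_eq D.expected_log_def)
    qed
    then show ?thesis unfolding free_energy_def by (rule limI)
  qed
  have mu: "alt_free_energy M T Q h = D.mu h" for h
  proof -
    have "(\<lambda>n. - (1 / real n) * ln (\<integral>\<omega>. 1 / partition_function_minus M T n h \<omega> \<partial>Q)) \<longlonglongrightarrow> D.mu h"
    proof (rule Lim_transform_eventually[OF D.mu_tendsto])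
      show "eventually (\<lambda>n. - ln (D.moment 1 h n) / real n = - (1 / real n) * ln (\<integral>\<omega>. 1 / partition_function_minus M T n h \<omega> \<partial>Q)) sequentially"
        using eventually_ge_at_top[of 1]
      proof eventually_elim
        case (elim n)
        have "partition_function_minus M T n h \<omega> = D.Zm h \<omega> 0 n" for \<omega>
          using R.partition_function_eq[OF elim, of h \<omega>]
          by (simp only: partition_function_minus_def window_minus_def exp_minus divide_inverse mult.commute)
        then show ?case using D.integral_inverse_Zm[of 0 n h] elim by simp
      qed
    qed
    then show ?thesis unfolding alt_free_energy_def by (rule limI)
  qed
  \<comment> \<open>If the free energy at \<open>h\<close> were not positive, monotonicity would
    make \<open>h\<close> a lower bound of the set whose infimum is the critical point.\<close>
  have mu_pos: "D.mu h > 0" if h: "h > critical_point M T Q" for h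
  proof (rule D.mu_pos, rule ccontr)
    assume "\<not> D.fe h > 0"
    then have "h \<le> x" if "D.fe x > 0" for x using D.fe_mono[of x h] that by linarith
    \<comment> \<open>By \<open>fe_lower\<close> the free energy is at least 1 there, so the set is
      nonempty.\<close>
    moreover have "D.fe (1 - ln (p 1)) > 0" using D.fe_lower[of "1 - ln (p 1)"] by linarith
    ultimately have "h \<le> Inf {x. D.fe x > 0}" by (intro cInf_greatest) auto
    then show False using h by (simp add: critical_point_def fe)
  qed
  obtain idx :: "nat \<Rightarrow> nat" where idx: "\<And>n. n \<ge> 2 \<Longrightarrow> 2 ^ (idx n + 1) \<le> n" "\<And>n. n \<ge> 2 \<Longrightarrow> n < 2 ^ (idx n + 2)"
    "filterlim idx at_top sequentially"
    using dyadic_index by blast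
  show ?thesis
    using D.typical_AE
  proof (rule AE_mp, intro AE_I2 impI allI)
    fix \<omega> h and \<epsilon> :: real
    assume gen: "D.typical \<omega>" and h: "h > critical_point M T Q" and \<epsilon>: "\<epsilon> > 0"
    define m where "m = D.mu h"
    have m: "m > 0" unfolding m_def by (rule mu_pos[OF h])
    obtain c1 where c1: "c1 \<in> \<rat>" "1 / m < c1" "c1 < 1 / m + \<epsilon>"
      using Rats_dense_in_real[of "1 / m" "1 / m + \<epsilon>"] \<epsilon> by auto
    \<comment> \<open>The maximum with 0 keeps \<open>c2\<close> positive when
      \<open>\<epsilon>\<close> exceeds \<open>1 / m\<close>.\<close>
    obtain c2 where c2: "c2 \<in> \<rat>" "max (1 / m - \<epsilon>) 0 < c2" "c2 < 1 / m"
      using Rats_dense_in_real[of "max (1 / m - \<epsilon>) 0" "1 / m"] \<epsilon> m by auto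
    have c1m: "c1 * m > 1" using c1 m by (simp add: pos_divide_less_eq)
    have c2m: "c2 > 0" "c2 * m < 1" using c2 m by (auto simp: pos_less_divide_eq)
    have c1pos: "c1 > 0" using c1(2) m by (meson less_trans zero_less_divide_1_iff)
    have "(\<lambda>n. D.gap_ratio h \<omega> n (log_scale c1 (idx n + 1)) + D.no_gap_ratio h \<omega> n (D.block_gap c2 (idx n))) \<longlonglongrightarrow> 0 + 0"
      by (intro tendsto_add D.gap_ratio_tendsto D.no_gap_ratio_tendsto)
         (use gen m c1 c1m c2 c2m idx in \<open>auto simp: m_def\<close>)
    then have lim: "(\<lambda>n. D.gap_ratio h \<omega> n (log_scale c1 (idx n + 1)) + D.no_gap_ratio h \<omega> n (D.block_gap c2 (idx n))) \<longlonglongrightarrow> 0"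
      by simp
    show "(\<lambda>n. measure (gibbs_measure M T n h \<omega>) {x \<in> space (gibbs_measure M T n h \<omega>).
        \<epsilon> < \<bar>real (max_gap T n x) / ln (real n) - 1 / alt_free_energy M T Q h\<bar>}) \<longlonglongrightarrow> 0"
    proof (rule tendsto_sandwich[OF _ _ tendsto_const lim])
      show "eventually (\<lambda>n. measure (gibbs_measure M T n h \<omega>) {x \<in> space (gibbs_measure M T n h \<omega>).
        \<epsilon> < \<bar>real (max_gap T n x) / ln (real n) - 1 / alt_free_energy M T Q h\<bar>}
        \<le> D.gap_ratio h \<omega> n (log_scale c1 (idx n + 1)) + D.no_gap_ratio h \<omega> n (D.block_gap c2 (idx n))) sequentially"
        using eventually_ge_at_top[of 2]
      proof eventually_elim
        case (elim n)
        define i where "i = idx n"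
        define m1 where "m1 = log_scale c1 (i + 1)"
        define k where "k = D.block_gap c2 i"
        have n2: "2 ^ (i + 1) \<le> n" "n < 2 ^ (i + 2)" using idx elim by (auto simp: i_def)
        have lnn: "ln (real n) > 0" using elim by simp
        have ln_low: "real (i + 1) * ln 2 \<le> ln (real n)"
        proof -
          have "real (2 ^ (i + 1)) \<le> real n" using n2(1) by (rule of_nat_mono)
          then have "ln (2 ^ (i + 1)) \<le> ln (real n)" using elim by (subst ln_le_cancel_iff) auto
          then show ?thesis by (simp add: ln_realpow del: power_Suc)
        qed
        have ln_up: "ln (real n) \<le> real (i + 2) * ln 2"
        proof -
          have "real n \<le> real (2 ^ (i + 2))" using n2(2) by (intro of_nat_mono) auto
          then have "ln (real n) \<le> ln (2 ^ (i + 2))" using elim by (subst ln_le_cancel_iff) auto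
          then show ?thesis by (simp add: ln_realpow del: power_Suc)
        qed
        have m1: "m1 \<ge> 1" unfolding m1_def using c1pos by (intro log_scale_pos) auto
        have k1: "k \<ge> 1" unfolding k_def D.block_gap_def using c2m by (intro log_scale_pos) auto
        \<comment> \<open>A deviation by more than \<open>\<epsilon>\<close> forces either a gap of
          length \<open>m1\<close>, slightly above log n / m, or the absence of gaps of length
          \<open>k\<close>, slightly below log n / m, up to the rounding to dyadic scales.\<close>
        define E where "E S \<longleftrightarrow> gap_ge m1 S \<or> \<not> gap_ge k S" for S
        have "measure (gibbs_measure M T n h \<omega>) {x \<in> space (gibbs_measure M T n h \<omega>).
            \<epsilon> < \<bar>real (max_gap T n x) / ln (real n) - 1 / alt_free_energy M T Q h\<bar>}
          \<le> (\<Sum>S | S \<in> traj 0 n \<and> E S. weight p (boltzmann h \<omega>) S) / window p (boltzmann h \<omega>) 0 n"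
        proof (rule R.gibbs_measure_upper)
          show "n \<ge> 1" using elim by simp
          fix x assume x: "x \<in> space M" and dev: "\<epsilon> < \<bar>real (max_gap T n x) / ln (real n) - 1 / alt_free_energy M T Q h\<bar>"
          define g where "g = real (max_gap T n x)"
          have "g / ln (real n) > 1 / m + \<epsilon> \<or> g / ln (real n) < 1 / m - \<epsilon>"
            using dev unfolding mu m_def[symmetric] g_def by linarith
          then show "E (R.config n x)"
          proof
            assume "g / ln (real n) > 1 / m + \<epsilon>"
            then have "c1 < g / ln (real n)" using c1 by linarith
            then have "c1 * ln (real n) < g" using lnn by (simp add: pos_less_divide_eq)
            moreover have "c1 * (real (i + 1) * ln 2) \<le> c1 * ln (real n)" using ln_low c1pos by (intro mult_left_mono) auto
            ultimately have "c1 * (real (i + 1) * ln 2) \<le> real (max_gap T n x)" by (simp add: g_def)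
            \<comment> \<open>\<open>max_gap\<close> is an integer, so it also dominates the ceiling
              in \<open>log_scale\<close>.\<close>
            then have "m1 \<le> max_gap T n x" unfolding m1_def log_scale_def by (simp add: ceiling_le_iff nat_le_iff)
            then show ?thesis using R.gap_ge_config_iff[OF x m1, of n] by (simp add: E_def)
          next
            assume "g / ln (real n) < 1 / m - \<epsilon>"
            then have "g / ln (real n) < c2" using c2 by linarith
            then have "g < c2 * ln (real n)" using lnn by (simp add: pos_divide_less_eq)
            \<comment> \<open>This direction needs an upper bound on log n within the dyadic range,
              hence the \<open>i + 2\<close> in \<open>block_gap\<close>.\<close>
            also have "\<dots> \<le> c2 * (real (i + 2) * ln 2)" using ln_up c2m by (intro mult_left_mono) auto
            also have "\<dots> \<le> real k" unfolding k_def D.block_gap_def by (rule log_scale_ge)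
            finally have "\<not> k \<le> max_gap T n x" by (simp add: g_def)
            then show ?thesis using R.gap_ge_config_iff[OF x k1, of n] by (simp add: E_def)
          qed
        qed
        also have "\<dots> \<le> D.gap_ratio h \<omega> n m1 + D.no_gap_ratio h \<omega> n k"
        proof -
          have fin: "finite {S. S \<in> traj 0 n \<and> X S}" for X by (rule finite_subset[OF _ finite_traj[of 0 n]]) auto
          have "(\<Sum>S | S \<in> traj 0 n \<and> E S. weight p (boltzmann h \<omega>) S)
             \<le> (\<Sum>S\<in>{S. S \<in> traj 0 n \<and> gap_ge m1 S} \<union> {S. S \<in> traj 0 n \<and> \<not> gap_ge k S}. weight p (boltzmann h \<omega>) S)"
            by (rule sum_mono2) (auto simp: E_def intro: fin D.B.weight_nonneg)
          also have "\<dots> \<le> (\<Sum>S | S \<in> traj 0 n \<and> gap_ge m1 S. weight p (boltzmann h \<omega>) S)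
              + (\<Sum>S | S \<in> traj 0 n \<and> \<not> gap_ge k S. weight p (boltzmann h \<omega>) S)"
            by (subst sum.union_inter[symmetric]) (auto intro!: fin sum_nonneg D.B.weight_nonneg)
          finally show ?thesis
            unfolding D.gap_ratio_def D.no_gap_ratio_def add_divide_distrib[symmetric]
            using D.Zw_pos[of 0 n h \<omega>] by (intro divide_right_mono) auto
        qed
        finally show ?case by (simp add: m1_def k_def i_def)
      qed
    qed simp
  qed
qed

end
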